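(* Let $m\ge2$ and let $\mathcal{F}$ be a collection of $(m+1)$-tuples $(f,f_1,\dots,f_m)$ of non-negative measurable functions on $\mathbb{R}^n$. Consider a vector $\vec r=(r_1,\dots,r_{m+1})$ with $1\le r_1,\dots,r_{m+1}<\infty$, and exponents $\vec p=(p_1,\dots,p_m)$ with $1\le p_1,\dots,p_m\le\infty$, so that $\vec r\preceq_\star\vec p$. Assume that for every $\vec w=(w_1,\dots,w_m)\in A_{\vec p,\vec r}$ the inequality $$\|fw\|_{L^p}\le\varphi([\vec w]_{A_{\vec p,\vec r}})\prod_{i=1}^m\|f_iw_i\|_{L^{p_i}}$$ holds for every $(f,f_1,\dots,f_m)\in\mathcal{F}$, where $\frac1p:=\frac1{p_1}+\dots+\frac1{p_m}$, $w:=\prod_{i=1}^m w_i$, and $\varphi\ge0$ is a non-decreasing function. Then for all exponents $\vec q=(q_1,\dots,q_m)$ with $1<q_1,\dots,q_m\le\infty$ and $\vec r\prec\vec q$, there is a non-decreasing function $\widetilde\varphi\ge0$ such that for all weights $\vec v=(v_1,\dots,v_m)\in A_{\vec q,\vec r}$ the inequality $$\|fv\|_{L^q}\le\widetilde\varphi([\vec v]_{A_{\vec q,\vec r}})\prod_{i=1}^m\|f_iv_i\|_{L^{q_i}}$$ holds for every $(f,f_1,\dots,f_m)\in\mathcal{F}$, where $\frac1q:=\frac1{q_1}+\dots+\frac1{q_m}>0$ and $v:=\prod_{i=1}^m v_i$. Moreover, for the same family of exponents $\vec q$ and weights $\vec v$, and for all exponents $\vec s=(s_1,\dots,s_m)$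 with $1<s_1,\dots,s_m\le\infty$ and $\vec r\prec\vec s$, there is a non-decreasing function $\widetilde\varphi\ge0$ (independent of $\vec v$ and of the functions) such that $$\Big\|\big\{f^jv\big\}_j\Big\|_{L^q_{\ell^s}}\le\widetilde\varphi([\vec v]_{A_{\vec q,\vec r}})\prod_{i=1}^m\Big\|\big\{f_i^jv_i\big\}_j\Big\|_{L^{q_i}_{\ell^{s_i}}}$$ for all sequences $\{(f^j,f_1^j,\dots,f_m^j)\}_j\subset\mathcal{F}$, where $\frac1s:=\frac1{s_1}+\dots+\frac1{s_m}>0$.
   Context: All function spaces are over $\mathbb{R}^n$ with Lebesgue measure; $L^p$ with $0<p<1$ carries the usual quasi-norm. $Q$ denotes cubes in $\mathbb{R}^n$; $r'$ is the conjugate exponent of $r$ (so $1'=\infty$). Orderings: for $\vec p=(p_1,\dots,p_m)$ with $1\le p_i\le\infty$, $\frac1p:=\sum_{i=1}^m\frac1{p_i}$, and $\vec r=(r_1,\dots,r_{m+1})$ with $1\le r_i<\infty$: $\vec r\preceq_\star\vec p$ means $r_i\le p_i$ for $i=1,\dots,m$ and $r_{m+1}'\ge p$; $\vec r\prec\vec p$ means $r_i<p_i$ for $i=1,\dots,m$ and $r_{m+1}'>p$. Class $A_{\vec p,\vec r}$ (for $\vec r\preceq_\star\vec p$): put $\frac1{\delta_i}:=\frac1{r_i}-\frac1{p_i}\ge0$ for $1\le i\le m$ and $\frac1{\delta_{m+1}}:=\frac1p-\frac1{r_{m+1}'}\ge0$. Then $\vec w=(w_1,\dots,w_m)\in A_{\vec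 p,\vec r}$ means that each $w_i$ is measurable with $0<w_i<\infty$ a.e. and, with $w=\prod_{i=1}^mw_i$, $$[\vec w]_{A_{\vec p,\vec r}}=\sup_Q\Big(\frac1{|Q|}\int_Qw^{\delta_{m+1}}dx\Big)^{\frac1{\delta_{m+1}}}\prod_{i=1}^m\Big(\frac1{|Q|}\int_Qw_i^{-\delta_i}dx\Big)^{\frac1{\delta_i}}<\infty,$$ where the first factor is $\operatorname{ess\,sup}_Qw$ if $\delta_{m+1}=\infty$ (i.e. $p=r_{m+1}'$), and the factor for $w_i$ is $\operatorname{ess\,sup}_Qw_i^{-1}$ if $\delta_i=\infty$ (i.e. $p_i=r_i$). Vector-valued norm: $\|\{g_j\}_j\|_{L^q_{\ell^s}}=\big\|\,\|\{g_j\}_j\|_{\ell^s}\,\big\|_{L^q}$, with $\ell^\infty$ meaning the supremum over $j$. The functions $\varphi,\widetilde\varphi$ are finite-valued functions on $[0,\infty)$. *)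

theory Defs
  imports "HOL-Analysis.Analysis" "HOL-Probability.Essential_Supremum"
begin

text \<open>
  Functions on \<open>\<real>\<^sup>n\<close> are Lebesgue measurable with values in \<open>[0,\<infinity>]\<close>, and all exponents live in
  \<^typ>\<open>ennreal\<close>, where \<open>inverse 0 = \<infinity>\<close> and \<open>inverse \<infinity> = 0\<close>, so that reciprocals of exponents
  have their usual meaning.  Products follow the measure-theoretic convention \<open>0 * \<infinity> = 0\<close>.
  Tuples are functions on \<^typ>\<open>nat\<close> of which only the values at \<open>1, \<dots>, m\<close>
  (at \<open>1, \<dots>, m + 1\<close> for \<open>r\<close>) are used.
\<close>

text \<open>\<open>x\<^sup>a\<close> for \<open>x \<in> [0,\<infinity>]\<close>; only used for \<open>0 < a < \<infinity>\<close>.\<close>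

definition epowr :: "ennreal \<Rightarrow> real \<Rightarrow> ennreal" where
  "epowr x a = (if x = \<infinity> then \<infinity> else ennreal (enn2real x powr a))"

definition Lnorm :: "'a measure \<Rightarrow> ennreal \<Rightarrow> ('a \<Rightarrow> ennreal) \<Rightarrow> ennreal" where
  "Lnorm M p g =
    (if p = \<infinity> then esssup M g
     else epowr (\<integral>\<^sup>+ x. epowr (g x) (enn2real p) \<partial>M) (1 / enn2real p))"

definition lnorm :: "ennreal \<Rightarrow> (nat \<Rightarrow> ennreal) \<Rightarrow> ennreal" where
  "lnorm s a =
    (if s = \<infinity> then (SUP j. a j)
     else epowr (\<Sum>j. epowr (a j) (enn2real s)) (1 / enn2real s))"

definition Llnorm :: "'a measure \<Rightarrow> ennreal \<Rightarrow> ennreal \<Rightarrow> (nat \<Rightarrow> 'a \<Rightarrow> ennreal) \<Rightarrow> ennreal" where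
  "Llnorm M q s g = Lnorm M q (\<lambda>x. lnorm s (\<lambda>j. g j x))"

text \<open>\<open>(|Q|\<^sup>-\<^sup>1 \<integral>\<^sub>Q g\<^sup>\<delta>)\<^sup>1\<^sup>/\<^sup>\<delta>\<close>, to be read as the essential supremum of \<open>g\<close> over \<open>Q\<close> if \<open>\<delta> = \<infinity>\<close>.\<close>

definition cube_mean :: "(real ^ 'n) set \<Rightarrow> ennreal \<Rightarrow> (real ^ 'n \<Rightarrow> ennreal) \<Rightarrow> ennreal" where
  "cube_mean Q \<delta> g =
    (if \<delta> = \<infinity> then esssup (restrict_space lebesgue Q) g
     else epowr ((\<integral>\<^sup>+ x\<in>Q. epowr (g x) (enn2real \<delta>) \<partial>lebesgue) / emeasure lebesgue Q)
            (1 / enn2real \<delta>))"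

definition cubes :: "(real ^ 'n) set set" where
  "cubes = {cbox a (\<chi> i. a $ i + h) | a h. 0 < h}"

definition conj_exp :: "ennreal \<Rightarrow> ennreal" where
  "conj_exp r = inverse (1 - inverse r)"

definition harm_exp :: "nat \<Rightarrow> (nat \<Rightarrow> ennreal) \<Rightarrow> ennreal" where
  "harm_exp m p = inverse (\<Sum>i = 1..m. inverse (p i))"

definition exps_le :: "nat \<Rightarrow> (nat \<Rightarrow> ennreal) \<Rightarrow> (nat \<Rightarrow> ennreal) \<Rightarrow> bool" where
  "exps_le m r p \<longleftrightarrow> (\<forall>i\<in>{1..m}. r i \<le> p i) \<and> harm_exp m p \<le> conj_exp (r (m + 1))"

definition exps_less :: "nat \<Rightarrow> (nat \<Rightarrow> ennreal) \<Rightarrow> (nat \<Rightarrow> ennreal) \<Rightarrow> bool" where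
  "exps_less m r p \<longleftrightarrow> (\<forall>i\<in>{1..m}. r i < p i) \<and> harm_exp m p < conj_exp (r (m + 1))"

text \<open>
  The exponents \<open>\<delta>\<^sub>i\<close>.  Subtraction on \<^typ>\<open>ennreal\<close> is truncated at \<open>0\<close>, which plays no role under
  \<^term>\<open>exps_le m r p\<close>.
\<close>

definition delta :: "nat \<Rightarrow> (nat \<Rightarrow> ennreal) \<Rightarrow> (nat \<Rightarrow> ennreal) \<Rightarrow> nat \<Rightarrow> ennreal" where
  "delta m p r i =
    (if i = m + 1 then inverse (inverse (harm_exp m p) - inverse (conj_exp (r (m + 1))))
     else inverse (inverse (r i) - inverse (p i)))"

text \<open>The power \<open>w\<^sub>i\<^sup>-\<^sup>\<delta>\<close> is written as \<open>(w\<^sub>i\<^sup>-\<^sup>1)\<^sup>\<delta>\<close>.\<close>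

definition weight_const ::
  "nat \<Rightarrow> (nat \<Rightarrow> ennreal) \<Rightarrow> (nat \<Rightarrow> ennreal) \<Rightarrow> (nat \<Rightarrow> real ^ 'n \<Rightarrow> ennreal) \<Rightarrow> ennreal" where
  "weight_const m p r w =
    (SUP Q\<in>cubes.
       cube_mean Q (delta m p r (m + 1)) (\<lambda>x. \<Prod>i = 1..m. w i x) *
       (\<Prod>i = 1..m. cube_mean Q (delta m p r i) (\<lambda>x. inverse (w i x))))"

definition weight_class ::
  "nat \<Rightarrow> (nat \<Rightarrow> ennreal) \<Rightarrow> (nat \<Rightarrow> ennreal) \<Rightarrow> (nat \<Rightarrow> real ^ 'n \<Rightarrow> ennreal) set" where
  "weight_class m p r =
    {w. (\<forall>i\<in>{1..m}. w i \<in> borel_measurable lebesgue \<and>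
                     (AE x in lebesgue. 0 < w i x \<and> w i x < \<infinity>)) \<and>
        weight_const m p r w < \<infinity>}"

definition growth_fun :: "(real \<Rightarrow> real) \<Rightarrow> bool" where
  "growth_fun \<phi> \<longleftrightarrow> mono_on {0..} \<phi> \<and> (\<forall>t\<ge>0. 0 \<le> \<phi> t)"

end

(*
  The class condition is symmetric in the m+1 functions u_i = 1/w_i (i <= m) and u_(m+1) = w, whose
  product is 1. To change the exponent q_j alone, put b = 1/delta_j, b' = 1/delta_(m+1), c = b + b'
  and keep all factors except those of j and m+1. By Hoelder's inequality the product of the kept averages is
  comparable with the inverse of the average of u_j u_(m+1), which turns the class condition into
  a Muckenhoupt condition for one weight relative to the measure mu = (u_j u_(m+1))^(1/c) dx.
  The measures u_j^(1/b) dx and u_(m+1)^(1/b') dx are doubling, so Lerner's argument bounds the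
  maximal function of mu on the relevant weighted space with no reverse Hoelder inequality. A Rubio de
  Francia iteration then gives a majorant H with u_j / H and u_(m+1) H in the class of the old
  exponents. The hypothesis for these weights, with H built from f_j (if q_j decreases) or from f
  by duality (if q_j increases), is the conclusion for the new exponent.

  The exponents are changed one at a time, first those for which the sum of the 1/q_i grows, so that
  every intermediate tuple is admissible. For sequences of functions, the families of l^s norms
  satisfy the bound with exponent s by Fubini and Hoelder, and are extrapolated from s to q.
*)

theory Submission
  imports Defs
begin

section \<open>Powers and norms in \<open>[0,\<infinity>]\<close>\<close>

text \<open>The iteration runs in the class of the new exponents, where the weights are given.
  Strict inequalities there make b and b' positive, so that the powers 1/b and 1/b' exist. The old
  exponents may be endpoints, where an index such as b - t becomes 0. Reciprocals of exponents are
  the indices throughout: Hoelder's inequality is then addition of indices, and an infinite exponent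
  is the index 0.

  Let t be the change of the reciprocal. A majorant H has to dominate a given function H_0, its
  L^(1/t) norm has to be controlled by that of H_0, and moving it from u to v has to lower b and
  raise b' by t. The second demand explains the form H = beta^(ct/b) u^(t/b): then H^(1/t) =
  beta^(c/b) u^(1/b), and L^(c/b) with the weight u^(1/b) is the space on which the maximal function
  of mu is bounded.

  The constants depend on the weights only through a bound K for the class constant. The property
  carried from tuple to tuple is therefore "for every K there is a C"; a growth function is rebuilt
  from it at the very end.\<close>

lemma epowr_ennreal [simp]: "0 \<le> x \<Longrightarrow> epowr (ennreal x) a = ennreal (x powr a)"
  by (simp add: epowr_def)

lemma epowr_top [simp]: "epowr top a = top"
  by (simp add: epowr_def)

lemma epowr_0 [simp]: "epowr 0 a = 0"
  by (simp add: epowr_def)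

lemma epowr_1 [simp]: "epowr 1 a = 1"
  by (simp add: epowr_def)

lemma epowr_one [simp]: "epowr x 1 = x"
  by (cases x) auto

lemma epowr_mono: "x \<le> y \<Longrightarrow> 0 \<le> a \<Longrightarrow> epowr x a \<le> epowr y a"
  by (cases x; cases y) (auto intro!: ennreal_leI powr_mono2 simp: top_unique)

lemma epowr_mult: "0 < a \<Longrightarrow> epowr (x * y) a = epowr x a * epowr y a"
  by (cases x; cases y)
    (auto simp: ennreal_mult[symmetric] powr_mult ennreal_mult_top ennreal_top_mult)

lemma epowr_epowr [simp]: "epowr (epowr x a) b = epowr x (a * b)"
  by (cases x) (auto simp: powr_powr)

lemma epowr_add: "epowr x (a + b) = epowr x a * epowr x b"
  by (cases x) (auto simp: powr_add ennreal_mult)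

lemma epowr_eq_0_iff [simp]: "epowr x a = 0 \<longleftrightarrow> x = 0"
  by (cases x) auto

lemma epowr_eq_top_iff [simp]: "epowr x a = top \<longleftrightarrow> x = top"
  by (cases x) auto

lemma epowr_less_top_iff [simp]: "epowr x a < top \<longleftrightarrow> x < top"
  using epowr_eq_top_iff[of x a] by (simp add: less_top[symmetric] del: epowr_eq_top_iff)

lemma epowr_le_iff: "0 < a \<Longrightarrow> epowr x a \<le> z \<longleftrightarrow> x \<le> epowr z (1 / a)"
  using epowr_mono[of "epowr x a" z "1 / a"] epowr_mono[of x "epowr z (1 / a)" a]
  by auto

text \<open>By \<open>epowr_le_iff\<close> the power map is a lower adjoint, and such maps preserve
  suprema.\<close>

lemma epowr_SUP: "0 < a \<Longrightarrow> epowr (SUP i\<in>I. f i) a = (SUP i\<in>I. epowr (f i) a)"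
proof (rule antisym)
  assume a: "0 < a"
  show "epowr (SUP i\<in>I. f i) a \<le> (SUP i\<in>I. epowr (f i) a)"
    by (subst epowr_le_iff[OF a], rule SUP_least, subst epowr_le_iff[OF a, symmetric])
      (rule SUP_upper)
  show "(SUP i\<in>I. epowr (f i) a) \<le> epowr (SUP i\<in>I. f i) a"
    using a by (intro SUP_least epowr_mono SUP_upper) auto
qed

lemma borel_measurable_epowr [measurable (raw)]:
  assumes [measurable]: "f \<in> borel_measurable M"
  shows "(\<lambda>x. epowr (f x) a) \<in> borel_measurable M"
  unfolding epowr_def by measurable

lemma ennreal_inverse_mult_cancel: "x \<noteq> 0 \<Longrightarrow> x \<noteq> top \<Longrightarrow> x * inverse x = (1 :: ennreal)"
  by (cases x) (auto simp: inverse_ennreal ennreal_mult[symmetric] simp del: ennreal_1 simp flip: ennreal_1)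

lemma epowr_weighted_am_gm:
  assumes "0 < \<theta>" "\<theta> < 1"
  shows "epowr x \<theta> * epowr y (1 - \<theta>) \<le> ennreal \<theta> * x + ennreal (1 - \<theta>) * y"
proof (cases "x = top \<or> y = top")
  case True
  then show ?thesis using assms by (auto simp: ennreal_mult_top)
next
  case False
  then obtain a b where "x = ennreal a" "y = ennreal b" "0 \<le> a" "0 \<le> b"
    by (cases x; cases y) auto
  then show ?thesis
    using Youngs_inequality_0[of \<theta> "1 - \<theta>" a b] assms
    by (cases "a = 0 \<or> b = 0") (auto
      simp: ennreal_mult[symmetric] ennreal_plus[symmetric] simp del: ennreal_plus)
qed

text \<open>Normalise both integrals to 1 and integrate the pointwise weighted AM-GM inequality.
  Division by the integrals is legitimate only if both lie strictly between 0 and infinity, hence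
  the degenerate cases.\<close>

lemma nn_integral_Holder:
  assumes [measurable]: "f \<in> borel_measurable M" "g \<in> borel_measurable M"
    and \<theta>: "0 < \<theta>" "\<theta> < 1"
  shows "(\<integral>\<^sup>+x. epowr (f x) \<theta> * epowr (g x) (1 - \<theta>) \<partial>M)
    \<le> epowr (\<integral>\<^sup>+x. f x \<partial>M) \<theta> * epowr (\<integral>\<^sup>+x. g x \<partial>M) (1 - \<theta>)"
proof -
  define A where "A = (\<integral>\<^sup>+x. f x \<partial>M)"
  define B where "B = (\<integral>\<^sup>+x. g x \<partial>M)"
  consider "A = 0" | "B = 0" | "A \<noteq> 0" "B \<noteq> 0" "A = top \<or> B = top"
    | "A \<noteq> 0" "B \<noteq> 0" "A \<noteq> top" "B \<noteq> top" by blast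
  then show ?thesis
  proof cases
    case 1
    then have "AE x in M. f x = 0" by (simp add: A_def nn_integral_0_iff_AE)
    then have "(\<integral>\<^sup>+x. epowr (f x) \<theta> * epowr (g x) (1 - \<theta>) \<partial>M) = (\<integral>\<^sup>+x. 0 \<partial>M)"
      by (intro nn_integral_cong_AE) auto
    then show ?thesis by simp
  next
    case 2
    then have "AE x in M. g x = 0" by (simp add: B_def nn_integral_0_iff_AE)
    then have "(\<integral>\<^sup>+x. epowr (f x) \<theta> * epowr (g x) (1 - \<theta>) \<partial>M) = (\<integral>\<^sup>+x. 0 \<partial>M)"
      by (intro nn_integral_cong_AE) auto
    then show ?thesis by simp
  next
    case 3
    then show ?thesis
      by (auto simp: A_def[symmetric] B_def[symmetric] ennreal_mult_top ennreal_top_mult)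
  next
    case 4
    let ?C = "epowr A \<theta> * epowr B (1 - \<theta>)"
    have pw: "epowr (f x) \<theta> * epowr (g x) (1 - \<theta>)
        \<le> ?C * (ennreal \<theta> * (inverse A * f x) + ennreal (1 - \<theta>) * (inverse B * g x))" for x
    proof -
      have "f x = A * (inverse A * f x)" "g x = B * (inverse B * g x)"
        using 4 by (simp_all add: mult.assoc[symmetric] ennreal_inverse_mult_cancel)
      then have "epowr (f x) \<theta> * epowr (g x) (1 - \<theta>)
          = epowr (A * (inverse A * f x)) \<theta> * epowr (B * (inverse B * g x)) (1 - \<theta>)"
        by simp
      also have "\<dots> = ?C * (epowr (inverse A * f x) \<theta> * epowr (inverse B * g x) (1 - \<theta>))"
        using \<theta> by (subst (1 2) epowr_mult) (simp_all add: ac_simps)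
      also have "\<dots> \<le> ?C * (ennreal \<theta> * (inverse A * f x) + ennreal (1 - \<theta>) * (inverse B * g x))"
        by (intro mult_left_mono epowr_weighted_am_gm \<theta>) auto
      finally show ?thesis .
    qed
    have "(\<integral>\<^sup>+x. epowr (f x) \<theta> * epowr (g x) (1 - \<theta>) \<partial>M)
      \<le> (\<integral>\<^sup>+x. ?C * (ennreal \<theta> * (inverse A * f x) + ennreal (1 - \<theta>) * (inverse B * g x)) \<partial>M)"
      by (intro nn_integral_mono pw)
    also have "\<dots> = ?C * (ennreal \<theta> * (inverse A * A) + ennreal (1 - \<theta>) * (inverse B * B))"
      by (simp add: nn_integral_cmult nn_integral_add A_def B_def)
    also have "\<dots> = ?C"
      using 4 \<theta> ennreal_inverse_mult_cancel[of A] ennreal_inverse_mult_cancel[of B]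
      by (simp add: mult.commute[of "inverse _"] ennreal_plus[symmetric] del: ennreal_plus)
    finally show ?thesis by (simp add: A_def B_def)
  qed
qed

text \<open>The norm of L^(1/a), with a = 0 standing for L^infinity. In this indexing Hoelder's
  inequality adds indices, and the quasi-norm range a > 1 needs no separate treatment.\<close>

definition rnorm :: "'a measure \<Rightarrow> real \<Rightarrow> ('a \<Rightarrow> ennreal) \<Rightarrow> ennreal" where
  "rnorm M a g = (if a = 0 then esssup M g else epowr (\<integral>\<^sup>+x. epowr (g x) (1 / a) \<partial>M) a)"

lemma Lnorm_inverse: "0 \<le> a \<Longrightarrow> Lnorm M (inverse (ennreal a)) g = rnorm M a g"
proof (cases "a = 0")
  case False
  moreover assume "0 \<le> a"
  ultimately have "a > 0" by simp
  then show ?thesis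
    by (simp add: Lnorm_def rnorm_def inverse_ennreal field_simps)
qed (simp add: Lnorm_def rnorm_def)

lemma rnorm_mono_AE:
  assumes "f \<in> borel_measurable M" "AE x in M. f x \<le> g x" "0 \<le> a"
  shows "rnorm M a f \<le> rnorm M a g"
proof (cases "a = 0")
  case True
  then show ?thesis using assms by (simp add: rnorm_def esssup_AE_mono)
next
  case False
  then show ?thesis
    using assms by (auto simp: rnorm_def intro!: epowr_mono nn_integral_mono_AE elim!: eventually_mono)
qed

lemma rnorm_mono:
  assumes "f \<in> borel_measurable M" "\<And>x. f x \<le> g x" "0 \<le> a"
  shows "rnorm M a f \<le> rnorm M a g"
  using assms by (intro rnorm_mono_AE) auto

lemma rnorm_cong_AE:
  assumes "f \<in> borel_measurable M" "g \<in> borel_measurable M" "AE x in M. f x = g x" "0 \<le> a"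
  shows "rnorm M a f = rnorm M a g"
  using assms by (intro antisym rnorm_mono_AE) (auto elim!: eventually_mono)

lemma esssup_eq_0_iff:
  fixes f :: "'a \<Rightarrow> ennreal"
  assumes "f \<in> borel_measurable M"
  shows "esssup M f = 0 \<longleftrightarrow> (AE x in M. f x = 0)"
  using esssup_AE[of f M] esssup_I[OF assms, of 0] by auto

lemma rnorm_eq_0_iff:
  assumes [measurable]: "f \<in> borel_measurable M"
  shows "rnorm M a f = 0 \<longleftrightarrow> (AE x in M. f x = 0)"
  by (auto simp: rnorm_def nn_integral_0_iff_AE esssup_eq_0_iff)

lemma rnorm_Holder:
  assumes [measurable]: "f \<in> borel_measurable M" "g \<in> borel_measurable M" and ab: "0 \<le> a" "0 \<le> b"
  shows "rnorm M (a + b) (\<lambda>x. f x * g x) \<le> rnorm M a f * rnorm M b g"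
proof -
  \<comment> \<open>One factor in L^infinity: its essential supremum is pulled out almost
    everywhere. By commutativity this covers both degenerate indices.\<close>
  have esssup_case: "rnorm M a (\<lambda>x. f x * g x) \<le> rnorm M a f * esssup M g"
    if a: "0 \<le> a" and [measurable]: "f \<in> borel_measurable M" "g \<in> borel_measurable M" for a f g
  proof -
    have ae: "AE x in M. g x \<le> esssup M g" by (rule esssup_AE)
    show ?thesis
    proof (cases "a = 0")
      case True
      have "AE x in M. f x \<le> esssup M f" by (rule esssup_AE)
      with ae have "AE x in M. f x * g x \<le> esssup M f * esssup M g"
        by eventually_elim (rule mult_mono, auto)
      then show ?thesis using True by (simp add: rnorm_def esssup_I)
    next
      case False
      with a have a: "a > 0" by simp
      have "(\<integral>\<^sup>+x. epowr (f x * g x) (1 / a) \<partial>M)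
          \<le> (\<integral>\<^sup>+x. epowr (f x) (1 / a) * epowr (esssup M g) (1 / a) \<partial>M)"
        using ae a by (intro nn_integral_mono_AE)
          (auto simp: epowr_mult elim!: eventually_mono intro!: mult_left_mono epowr_mono)
      also have "\<dots> = (\<integral>\<^sup>+x. epowr (f x) (1 / a) \<partial>M) * epowr (esssup M g) (1 / a)"
        by (rule nn_integral_multc) simp
      finally have "epowr (\<integral>\<^sup>+x. epowr (f x * g x) (1 / a) \<partial>M) a
          \<le> epowr ((\<integral>\<^sup>+x. epowr (f x) (1 / a) \<partial>M) * epowr (esssup M g) (1 / a)) a"
        using a by (intro epowr_mono) auto
      then show ?thesis using a by (simp add: rnorm_def epowr_mult)
    qed
  qed
  consider "b = 0" | "a = 0" | "a > 0" "b > 0" using ab by linarith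
  then show ?thesis
  proof cases
    case 1
    then show ?thesis using esssup_case[of a f g] ab by (simp add: rnorm_def)
  next
    case 2
    then show ?thesis using esssup_case[of b g f] ab by (simp add: rnorm_def mult.commute)
  next
    case 3
    \<comment> \<open>In terms of f^(1/a) and g^(1/b) the integrand has the weights a/c and b/c,
      which sum to 1.\<close>
    define c where "c = a + b"
    have c: "c > 0" and th: "0 < a / c" "a / c < 1" "1 - a / c = b / c"
      using 3 by (auto simp: c_def field_simps)
    have "(\<integral>\<^sup>+x. epowr (f x * g x) (1 / c) \<partial>M)
      = (\<integral>\<^sup>+x. epowr (epowr (f x) (1 / a)) (a / c) * epowr (epowr (g x) (1 / b)) (1 - a / c) \<partial>M)"
      using 3 c th by (simp add: epowr_mult)
    also have "\<dots> \<le> epowr (\<integral>\<^sup>+x. epowr (f x) (1 / a) \<partial>M) (a / c)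
        * epowr (\<integral>\<^sup>+x. epowr (g x) (1 / b) \<partial>M) (1 - a / c)"
      by (rule nn_integral_Holder) (use th in auto)
    finally have "epowr (\<integral>\<^sup>+x. epowr (f x * g x) (1 / c) \<partial>M) c
      \<le> epowr (epowr (\<integral>\<^sup>+x. epowr (f x) (1 / a) \<partial>M) (a / c)
        * epowr (\<integral>\<^sup>+x. epowr (g x) (1 / b) \<partial>M) (1 - a / c)) c"
      using c by (intro epowr_mono) auto
    then show ?thesis using 3 c th by (simp add: rnorm_def epowr_mult c_def[symmetric])
  qed
qed

lemma rnorm_1_le: "emeasure M (space M) = 1 \<Longrightarrow> rnorm M a (\<lambda>_. 1) = 1"
  by (simp add: rnorm_def esssup_const)

lemma rnorm_Holder_prod:
  assumes "finite I" "I \<noteq> {}" "\<And>i. i \<in> I \<Longrightarrow> f i \<in> borel_measurable M" "\<And>i. i \<in> I \<Longrightarrow> 0 \<le> a i"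
  shows "rnorm M (\<Sum>i\<in>I. a i) (\<lambda>x. \<Prod>i\<in>I. f i x) \<le> (\<Prod>i\<in>I. rnorm M (a i) (f i))"
  using assms
proof (induction I rule: finite_ne_induct)
  case (insert i I)
  then have "rnorm M (a i + (\<Sum>i\<in>I. a i)) (\<lambda>x. f i x * (\<Prod>i\<in>I. f i x))
      \<le> rnorm M (a i) (f i) * rnorm M (\<Sum>i\<in>I. a i) (\<lambda>x. \<Prod>i\<in>I. f i x)"
    by (intro rnorm_Holder) (auto intro!: borel_measurable_prod_ennreal sum_nonneg)
  also have "\<dots> \<le> rnorm M (a i) (f i) * (\<Prod>i\<in>I. rnorm M (a i) (f i))"
    using insert by (intro mult_left_mono) auto
  finally show ?case using insert by simp
qed auto

lemma rnorm_cmult: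
  assumes [measurable]: "f \<in> borel_measurable M" and c: "c \<noteq> top" and a: "0 \<le> a"
  shows "rnorm M a (\<lambda>x. c * f x) = c * rnorm M a f"
proof (cases "a = 0")
  case False
  then show ?thesis
    using a by (simp add: rnorm_def epowr_mult nn_integral_cmult)
next
  case True
  \<comment> \<open>Applied with the factor \<open>inverse c\<close> to the function c f, this
    inequality also gives its own converse when c is neither 0 nor infinite.\<close>
  have le: "esssup M (\<lambda>x. c * f x) \<le> c * esssup M f"
    if [measurable]: "f \<in> borel_measurable M"
    for c and f :: "'a \<Rightarrow> ennreal"
    using esssup_AE[of f M] by (intro esssup_I) (auto elim!: eventually_mono intro!: mult_left_mono)
  show ?thesis
  proof (cases "c = 0")
    case True
    then show ?thesis using le[of f c] \<open>a = 0\<close> by (simp add: rnorm_def)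
  next
    case False
    have "c * esssup M f = c * esssup M (\<lambda>x. inverse c * (c * f x))"
      using ennreal_inverse_mult_cancel[OF False c]
      by (simp add: mult.assoc[symmetric] mult.commute[of "inverse c"])
    also have "\<dots> \<le> c * (inverse c * esssup M (\<lambda>x. c * f x))"
      by (intro mult_left_mono le) auto
    also have "\<dots> = esssup M (\<lambda>x. c * f x)"
      using ennreal_inverse_mult_cancel[OF False c] by (simp add: mult.assoc[symmetric])
    finally show ?thesis using le[of f c] \<open>a = 0\<close> by (auto simp: rnorm_def)
  qed
qed

section \<open>Cubes and averages over them\<close>

lemma cubesE:
  assumes "Q \<in> (cubes :: (real ^ 'n) set set)"
  obtains a h where "Q = cbox a (\<chi> i. a $ i + h)" "0 < h"
  using assms unfolding cubes_def by blast

lemma emeasure_cube: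
  fixes a :: "real ^ 'n"
  assumes "0 \<le> h"
  shows "emeasure lebesgue (cbox a (\<chi> i. a $ i + h)) = ennreal (h ^ CARD('n))"
proof -
  have "\<forall>b\<in>Basis. a \<bullet> b \<le> (\<chi> i. a $ i + h) \<bullet> b"
    using assms by (auto simp: Basis_vec_def inner_axis)
  moreover have "(\<Prod>b\<in>Basis. ((\<chi> i. a $ i + h) - a) \<bullet> b) = (\<Prod>b\<in>(Basis :: (real ^ 'n) set). h)"
    by (intro prod.cong refl) (auto simp: Basis_vec_def inner_axis)
  ultimately show ?thesis
    by (simp add: emeasure_lborel_cbox_eq)
qed

lemma cubes_measure:
  assumes "Q \<in> cubes"
  shows "Q \<in> sets lebesgue" "emeasure lebesgue Q \<noteq> 0" "emeasure lebesgue Q \<noteq> top"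
  using assms by (auto elim!: cubesE simp: emeasure_cube simp del: emeasure_completion)

text \<open>\<open>uniform_measure\<close> on Q has total mass 1, so every factor of the class
  condition is a norm over a probability space, and Hoelder's inequality between averages carries no
  constant.\<close>

lemma cube_mean_eq_rnorm:
  assumes Q: "Q \<in> cubes" and [measurable]: "g \<in> borel_measurable lebesgue" and a: "0 \<le> a"
  shows "cube_mean Q (inverse (ennreal a)) g = rnorm (uniform_measure lebesgue Q) a g"
proof -
  note [measurable] = cubes_measure(1)[OF Q]
  show ?thesis
  proof (cases "a = 0")
    case True
    \<comment> \<open>The two measures have the same null subsets of Q, so the essential suprema
      agree.\<close>
    have "esssup (restrict_space lebesgue Q) g = esssup (uniform_measure lebesgue Q) g"
      using cubes_measure[OF Q]
      by (subst (1 2) esssup_eq_AE)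
        (auto simp: AE_restrict_space_iff AE_uniform_measure less_top[symmetric] intro!: measurable_restrict_space1)
    then show ?thesis using True by (simp add: cube_mean_def rnorm_def)
  next
    case False
    with a have a: "a > 0" by simp
    then show ?thesis using cubes_measure[OF Q]
      by (simp add: cube_mean_def rnorm_def inverse_ennreal nn_integral_uniform_measure
          inverse_eq_divide del: emeasure_completion)
  qed
qed

section \<open>The maximal function of a doubling measure\<close>

abbreviation cube :: "real ^ 'n \<Rightarrow> real \<Rightarrow> (real ^ 'n) set" where
  "cube a h \<equiv> cbox a (\<chi> i. a $ i + h)"

lemma cubesI: "0 < h \<Longrightarrow> cube a h \<in> cubes"
  unfolding cubes_def by blast

text \<open>The corner moves by -h in every coordinate so that the enlarged cube is concentric with
  \<open>cube a h\<close>.\<close>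

abbreviation triple_cube :: "real ^ 'n \<Rightarrow> real \<Rightarrow> (real ^ 'n) set" where
  "triple_cube a h \<equiv> cube (\<chi> i. a $ i - h) (3 * h)"

lemma cubes_meeting_subset_triple:
  assumes "cube b h' \<inter> cube a h \<noteq> {}" "h' \<le> h"
  shows "cube b h' \<subseteq> triple_cube a h"
proof
  fix x assume x: "x \<in> cube b h'"
  obtain z where z: "z \<in> cube b h'" "z \<in> cube a h" using assms by blast
  show "x \<in> triple_cube a h"
    unfolding mem_box_cart
  proof
    fix i
    have "b $ i \<le> x $ i" "x $ i \<le> b $ i + h'" "b $ i \<le> z $ i" "z $ i \<le> b $ i + h'"
      "a $ i \<le> z $ i" "z $ i \<le> a $ i + h"
      using x z by (auto simp: mem_box_cart)
    then show "(\<chi> i. a $ i - h) $ i \<le> x $ i \<and> x $ i \<le> (\<chi> i. (\<chi> i. a $ i - h) $ i + 3 * h) $ i"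
      using assms by simp
  qed
qed

text \<open>Greedy selection: keep a cube of maximal side, drop all cubes that meet it, recurse on
  the others. A dropped cube is no larger than the kept one that it meets, so it lies in the triple
  of that one.\<close>

lemma Vitali_finite_cubes:
  fixes I :: "((real ^ 'n) \<times> real) set"
  assumes "finite I" "\<And>a h. (a, h) \<in> I \<Longrightarrow> 0 \<le> h"
  obtains J where "J \<subseteq> I" "disjoint_family_on (\<lambda>(a, h). cube a h) J"
    "(\<Union>(a, h)\<in>I. cube a h) \<subseteq> (\<Union>(a, h)\<in>J. triple_cube a h)"
proof -
  have "\<exists>J\<subseteq>I. disjoint_family_on (\<lambda>(a, h). cube a h) J \<and>
      (\<forall>(b, h')\<in>I. \<exists>(a, h)\<in>J. cube b h' \<inter> cube a h \<noteq> {} \<and> h' \<le> h)"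
    using assms
  proof (induction I rule: finite_psubset_induct)
    case (psubset I)
    show ?case
    proof (cases "I = {}")
      case False
      then have "Max (snd ` I) \<in> snd ` I" using psubset.hyps by (intro Max_in) auto
      then obtain a h where ah: "(a, h) \<in> I" "h = Max (snd ` I)" by auto
      have max: "h' \<le> h" if "(b, h') \<in> I" for b h'
        unfolding ah(2) using that psubset.hyps by (intro Max_ge) (auto intro!: image_eqI[of _ _ "(b, h')"])
      have "0 \<le> h" using psubset.prems ah by blast
      then have "a \<in> cube a h" by (simp add: mem_box_cart)
      \<comment> \<open>The family left for the recursion is strictly smaller because the chosen
        cube, being nonempty, meets itself.\<close>
      let ?I' = "{(b, h') \<in> I. cube b h' \<inter> cube a h = {}}"
      have "?I' \<subset> I" using ah \<open>a \<in> cube a h\<close> by auto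
      moreover have "0 \<le> h'" if "(b, h') \<in> ?I'" for b h'
        using that psubset.prems by auto
      ultimately have "\<exists>J\<subseteq>?I'. disjoint_family_on (\<lambda>(a, h). cube a h) J \<and>
          (\<forall>(b, h')\<in>?I'. \<exists>(a, h)\<in>J. cube b h' \<inter> cube a h \<noteq> {} \<and> h' \<le> h)"
        by (rule psubset.IH)
      then obtain J where J: "J \<subseteq> ?I'" "disjoint_family_on (\<lambda>(a, h). cube a h) J"
        "\<forall>(b, h')\<in>?I'. \<exists>(a, h)\<in>J. cube b h' \<inter> cube a h \<noteq> {} \<and> h' \<le> h"
        by blast
      show ?thesis
      proof (intro exI[of _ "insert (a, h) J"] conjI ballI)
        show "disjoint_family_on (\<lambda>(a, h). cube a h) (insert (a, h) J)"
          using J(1,2) unfolding disjoint_family_on_def by fast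
        fix p assume "p \<in> I"
        then show "case p of (b, h') \<Rightarrow> \<exists>(a, h)\<in>insert (a, h) J. cube b h' \<inter> cube a h \<noteq> {} \<and> h' \<le> h"
          using J(3) max by (cases "p \<in> ?I'"; cases p) auto
      qed (use J(1) ah in auto)
    qed (auto simp: disjoint_family_on_def)
  qed
  then obtain J where J: "J \<subseteq> I" "disjoint_family_on (\<lambda>(a, h). cube a h) J"
    "\<forall>(b, h')\<in>I. \<exists>(a, h)\<in>J. cube b h' \<inter> cube a h \<noteq> {} \<and> h' \<le> h"
    by blast
  have "cube b h' \<subseteq> (\<Union>(a, h)\<in>J. triple_cube a h)" if bh: "(b, h') \<in> I" for b h'
  proof -
    obtain a h where "(a, h) \<in> J" "cube b h' \<inter> cube a h \<noteq> {}" "h' \<le> h"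
      using J(3) bh by fast
    then show ?thesis using cubes_meeting_subset_triple[of b h' a h] by auto
  qed
  then show ?thesis using that J by blast
qed

section \<open>The maximal function and its weak type bound\<close>

abbreviation average :: "(real ^ 'n) measure \<Rightarrow> (real ^ 'n) set \<Rightarrow> (real ^ 'n \<Rightarrow> ennreal) \<Rightarrow> ennreal" where
  "average \<nu> Q g \<equiv> (\<integral>\<^sup>+y\<in>Q. g y \<partial>\<nu>) / emeasure \<nu> Q"

text \<open>Requiring x in the interior of Q makes the sets where the maximal function exceeds a
  level open. It is then Borel for arbitrary g, and countably many cubes exhaust such a set; a cube
  loses only its boundary, a null set.\<close>

definition maxfun :: "(real ^ 'n) measure \<Rightarrow> (real ^ 'n \<Rightarrow> ennreal) \<Rightarrow> real ^ 'n \<Rightarrow> ennreal" where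
  "maxfun \<nu> g x = (SUP Q\<in>{Q \<in> cubes. x \<in> interior Q}. average \<nu> Q g)"

lemma maxfun_gt_eq:
  "{x. l < maxfun \<nu> g x}
    = \<Union>{interior Q | Q. Q \<in> cubes \<and> l < average \<nu> Q g}"
  by (auto simp: maxfun_def less_SUP_iff)

lemma borel_maxfun: "maxfun \<nu> g \<in> borel_measurable borel"
proof (rule borel_measurableI_greater)
  show "{x \<in> space borel. l < maxfun \<nu> g x} \<in> sets borel" for l
    using maxfun_gt_eq[of l \<nu> g] by (auto intro!: borel_open)
qed

text \<open>Doubling is stated for triples because these are the enlargements in the covering
  argument.\<close>

locale doubling_measure =
  fixes \<nu> :: "(real ^ 'n) measure" and D :: real
  assumes sets_nu [measurable_cong, simp]: "sets \<nu> = sets lebesgue"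
    and cube_pos: "Q \<in> cubes \<Longrightarrow> emeasure \<nu> Q \<noteq> 0"
    and cube_finite: "Q \<in> cubes \<Longrightarrow> emeasure \<nu> Q \<noteq> top"
    and doubling: "0 < h \<Longrightarrow> emeasure \<nu> (triple_cube a h) \<le> ennreal D * emeasure \<nu> (cube a h)"
    and D_nonneg: "0 \<le> D"
begin

lemma space_nu [simp]: "space \<nu> = UNIV"
  using sets_eq_imp_space_eq[OF sets_nu] by simp

lemma measurable_maxfun [measurable]: "maxfun \<nu> g \<in> borel_measurable \<nu>"
  using borel_maxfun[of \<nu> g] by (simp add: measurable_completion cong: measurable_cong_sets)

lemma sets_cubes [measurable]: "Q \<in> cubes \<Longrightarrow> Q \<in> sets \<nu>"
  by (simp add: cubes_measure)

text \<open>A cube with average above l satisfies l nu(Q) \<le> integral of g over Q. For disjoint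
  selected cubes these integrals add up to at most the integral of g, and passing to their triples
  costs the factor D.\<close>

lemma weak_type:
  assumes [measurable]: "g \<in> borel_measurable \<nu>" and l: "0 < l"
  shows "ennreal l * emeasure \<nu> {x. ennreal l < maxfun \<nu> g x} \<le> ennreal D * (\<integral>\<^sup>+x. g x \<partial>\<nu>)"
proof -
  define good where "good = {(a, h). 0 < h \<and>
    ennreal l < average \<nu> (cube a h) g}"
  have good: "ennreal l * emeasure \<nu> (cube a h) \<le> (\<integral>\<^sup>+y\<in>cube a h. g y \<partial>\<nu>)" "0 < h"
    if "(a, h) \<in> good" for a h
  proof -
    show "0 < h" using that by (simp add: good_def)
    then have "emeasure \<nu> (cube a h) \<noteq> 0" "emeasure \<nu> (cube a h) \<noteq> top"
      using cube_pos cube_finite cubesI by blast+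
    then have eq: "average \<nu> (cube a h) g * emeasure \<nu> (cube a h)
        = (\<integral>\<^sup>+y\<in>cube a h. g y \<partial>\<nu>)"
      by (simp add: ennreal_divide_times less_top[symmetric])
    have "ennreal l \<le> average \<nu> (cube a h) g"
      using that by (simp add: good_def less_imp_le)
    from mult_right_mono[OF this, of "emeasure \<nu> (cube a h)"]
    show "ennreal l * emeasure \<nu> (cube a h) \<le> (\<integral>\<^sup>+y\<in>cube a h. g y \<partial>\<nu>)"
      by (simp only: eq zero_le)
  qed
  have fin: "ennreal l * emeasure \<nu> (\<Union>(a, h)\<in>I. cube a h) \<le> ennreal D * (\<integral>\<^sup>+x. g x \<partial>\<nu>)"
    if I: "finite I" "I \<subseteq> good" for I
  proof -
    obtain J where J: "J \<subseteq> I" "disjoint_family_on (\<lambda>(a, h). cube a h) J"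
      "(\<Union>(a, h)\<in>I. cube a h) \<subseteq> (\<Union>(a, h)\<in>J. triple_cube a h)"
      using Vitali_finite_cubes[of I] I good(2)[THEN less_imp_le] by blast
    have Jg: "J \<subseteq> good" "finite J" using J I by (auto dest: finite_subset)
    have "emeasure \<nu> (\<Union>(a, h)\<in>I. cube a h) \<le> emeasure \<nu> (\<Union>(a, h)\<in>J. triple_cube a h)"
      using Jg by (intro emeasure_mono J) auto
    also have "\<dots> \<le> (\<Sum>(a, h)\<in>J. emeasure \<nu> (triple_cube a h))"
      using Jg emeasure_subadditive_finite[of J "\<lambda>(a, h). triple_cube a h" \<nu>]
      by (auto simp: case_prod_unfold image_subset_iff)
    also have "\<dots> \<le> (\<Sum>(a, h)\<in>J. ennreal D * emeasure \<nu> (cube a h))"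
    proof (rule sum_mono)
      fix p assume "p \<in> J"
      moreover obtain a h where "p = (a, h)" by (cases p)
      ultimately show "(case p of (a, h) \<Rightarrow> emeasure \<nu> (triple_cube a h))
          \<le> (case p of (a, h) \<Rightarrow> ennreal D * emeasure \<nu> (cube a h))"
        using Jg good(2)[of a h] doubling[of h a] by auto
    qed
    finally have "ennreal l * emeasure \<nu> (\<Union>(a, h)\<in>I. cube a h)
        \<le> ennreal l * (\<Sum>(a, h)\<in>J. ennreal D * emeasure \<nu> (cube a h))"
      by (rule mult_left_mono) simp
    also have "\<dots> = ennreal D * (\<Sum>(a, h)\<in>J. ennreal l * emeasure \<nu> (cube a h))"
      by (simp add: sum_distrib_left case_prod_unfold ac_simps)
    also have "\<dots> \<le> ennreal D * (\<Sum>(a, h)\<in>J. \<integral>\<^sup>+y\<in>cube a h. g y \<partial>\<nu>)"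
      using Jg good(1) by (intro mult_left_mono sum_mono) auto
    also have "(\<Sum>(a, h)\<in>J. \<integral>\<^sup>+y\<in>cube a h. g y \<partial>\<nu>)
        = (\<integral>\<^sup>+y\<in>(\<Union>(a, h)\<in>J. cube a h). g y \<partial>\<nu>)"
    proof -
      let ?C = "\<lambda>(a, h). cube a h"
      have [measurable]: "cube a h \<in> sets \<nu>" for a h by simp
      have "(\<Sum>p\<in>J. \<integral>\<^sup>+y\<in>?C p. g y \<partial>\<nu>) = (\<integral>\<^sup>+y. (\<Sum>p\<in>J. g y * indicator (?C p) y) \<partial>\<nu>)"
        by (rule nn_integral_sum[symmetric]) (auto simp: case_prod_unfold)
      also have "\<dots> = (\<integral>\<^sup>+y\<in>(\<Union>p\<in>J. ?C p). g y \<partial>\<nu>)"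
        by (simp only: indicator_UN_disjoint[OF Jg(2) J(2)] sum_distrib_left)
      finally show ?thesis by (simp add: case_prod_unfold)
    qed
    also have "\<dots> \<le> (\<integral>\<^sup>+y. g y \<partial>\<nu>)"
      by (intro nn_integral_mono) (auto split: split_indicator)
    finally show ?thesis by (simp add: mult_left_mono)
  qed
  \<comment> \<open>The level set is a union of open interiors, so countably many of them cover it;
    continuity of the measure from below reduces these to finite unions.\<close>
  let ?F = "{interior Q | Q. Q \<in> cubes \<and> ennreal l < average \<nu> Q g}"
  obtain F where F: "F \<subseteq> ?F" "countable F" "\<Union>F = \<Union>?F"
    by (rule Lindelof[of ?F]) auto
  have "\<forall>U\<in>F. \<exists>p. p \<in> good \<and> U \<subseteq> (case p of (a, h) \<Rightarrow> cube a h)"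
  proof
    fix U assume "U \<in> F"
    then obtain Q where Q: "U = interior Q" "Q \<in> cubes" "ennreal l < average \<nu> Q g"
      using F by auto
    from Q(2) obtain a h where "Q = cube a h" "0 < h" by (rule cubesE)
    then show "\<exists>p. p \<in> good \<and> U \<subseteq> (case p of (a, h) \<Rightarrow> cube a h)"
      using Q interior_subset[of Q] by (intro exI[of _ "(a, h)"]) (auto simp: good_def simp del: interior_cbox)
  qed
  from bchoice[OF this] obtain p
    where p: "\<forall>U\<in>F. p U \<in> good \<and> U \<subseteq> (case p U of (a, h) \<Rightarrow> cube a h)" ..
  show ?thesis
  proof (cases "F = {}")
    case True
    then have "{x. ennreal l < maxfun \<nu> g x} = {}" unfolding maxfun_gt_eq using F(3) by simp
    then show ?thesis by (simp only: emeasure_empty mult_zero_right zero_le)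
  next
    case False
    define U where "U = from_nat_into F"
    have U: "range U = F" using False F(2) by (simp add: U_def range_from_nat_into)
    have "open (U n)" for n
    proof -
      have "U n \<in> F" unfolding U[symmetric] by (rule rangeI)
      then have "U n \<in> ?F" by (rule subsetD[OF F(1)])
      then obtain Q where "U n = interior Q" by (elim CollectE exE conjE)
      then show ?thesis by simp
    qed
    then have meas: "U n \<in> sets \<nu>" for n by (auto intro!: borel_open)
    have "{x. ennreal l < maxfun \<nu> g x} = \<Union>(range U)"
      unfolding maxfun_gt_eq F(3)[symmetric] U ..
    also have "\<dots> = (\<Union>n. \<Union>k\<in>{..<n}. U k)"
      by blast
    finally have "emeasure \<nu> {x. ennreal l < maxfun \<nu> g x} = (SUP n. emeasure \<nu> (\<Union>k\<in>{..<n}. U k))"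
      using meas by (subst SUP_emeasure_incseq) (auto intro!: incseq_SucI intro: less_SucI)
    then have "ennreal l * emeasure \<nu> {x. ennreal l < maxfun \<nu> g x}
        = (SUP n. ennreal l * emeasure \<nu> (\<Union>k\<in>{..<n}. U k))"
      by (simp add: SUP_mult_left_ennreal)
    also have "\<dots> \<le> ennreal D * (\<integral>\<^sup>+x. g x \<partial>\<nu>)"
    proof (rule SUP_least)
      fix n
      have "(\<Union>k\<in>{..<n}. U k) \<subseteq> (\<Union>(a, h)\<in>(p \<circ> U) ` {..<n}. cube a h)"
      proof safe
        fix x k assume k: "k < n" "x \<in> U k"
        have "U k \<in> F" unfolding U[symmetric] by (rule rangeI)
        with p k have "x \<in> (case p (U k) of (a, h) \<Rightarrow> cube a h)" by (meson subsetD)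
        then show "x \<in> (\<Union>(a, h)\<in>(p \<circ> U) ` {..<n}. cube a h)"
          using k by (intro UN_I[of "p (U k)"]) auto
      qed
      then have "ennreal l * emeasure \<nu> (\<Union>k\<in>{..<n}. U k)
          \<le> ennreal l * emeasure \<nu> (\<Union>(a, h)\<in>(p \<circ> U) ` {..<n}. cube a h)"
        by (intro mult_left_mono emeasure_mono) (auto simp: case_prod_unfold intro!: sets.finite_UN)
      also have "\<dots> \<le> ennreal D * (\<integral>\<^sup>+x. g x \<partial>\<nu>)"
        using p by (intro fin) (auto simp: U[symmetric])
      finally show "ennreal l * emeasure \<nu> (\<Union>k\<in>{..<n}. U k) \<le> ennreal D * (\<integral>\<^sup>+x. g x \<partial>\<nu>)" .
    qed
    finally show ?thesis .
  qed
qed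

lemma maxfun_mono:
  assumes "\<And>x. f x \<le> g x"
  shows "maxfun \<nu> f x \<le> maxfun \<nu> g x"
  unfolding maxfun_def using assms
  by (intro SUP_mono) (auto intro!: bexI divide_right_mono_ennreal nn_integral_mono mult_right_mono)

lemma maxfun_cmult:
  assumes [measurable]: "g \<in> borel_measurable \<nu>"
  shows "maxfun \<nu> (\<lambda>x. c * g x) x = c * maxfun \<nu> g x"
  unfolding maxfun_def SUP_mult_left_ennreal
proof (intro SUP_cong refl)
  fix Q assume "Q \<in> {Q \<in> cubes. x \<in> interior Q}"
  then have [measurable]: "Q \<in> sets \<nu>" using sets_cubes by blast
  show "average \<nu> Q (\<lambda>y. c * g y) = c * (average \<nu> Q g)"
    by (simp add: mult.assoc nn_integral_cmult ennreal_times_divide)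
qed

lemma maxfun_add_const:
  assumes [measurable]: "g \<in> borel_measurable \<nu>"
  shows "maxfun \<nu> (\<lambda>x. g x + c) x \<le> maxfun \<nu> g x + c"
  unfolding maxfun_def
proof (rule SUP_least)
  fix Q assume Q: "Q \<in> {Q \<in> cubes. x \<in> interior Q}"
  then have [measurable]: "Q \<in> sets \<nu>" using sets_cubes by blast
  then have Q': "Q \<in> sets lebesgue" by (simp add: cubes_measure)
  have "average \<nu> Q (\<lambda>y. (g y + c))
      = average \<nu> Q g + c * (emeasure \<nu> Q / emeasure \<nu> Q)"
    using Q' by (simp add: distrib_right nn_integral_add nn_integral_cmult_indicator
        add_divide_distrib_ennreal ennreal_times_divide)
  also have "emeasure \<nu> Q / emeasure \<nu> Q = 1"
    using Q cube_pos cube_finite by (simp add: less_top[symmetric])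
  also have "average \<nu> Q g \<le> (SUP Q\<in>{Q \<in> cubes. x \<in> interior Q}. average \<nu> Q g)"
    using Q by (rule SUP_upper)
  finally show "average \<nu> Q (\<lambda>y. (g y + c))
      \<le> (SUP Q\<in>{Q \<in> cubes. x \<in> interior Q}. average \<nu> Q g) + c"
    by (simp add: add_right_mono)
qed

text \<open>The part of g below height l adds at most l to the maximal function, so a value above 2
  l forces the part above l to have maximal function above l. Interpolation needs this right-hand
  side, which sees only the large values of g.\<close>

lemma level_set_maxfun:
  assumes [measurable]: "g \<in> borel_measurable \<nu>" and l: "0 < l"
  shows "emeasure \<nu> {x. ennreal (2 * l) < maxfun \<nu> g x}
    \<le> ennreal (D / l) * (\<integral>\<^sup>+x. g x * indicator {x. ennreal l < g x} x \<partial>\<nu>)"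
proof -
  define g' where "g' x = g x * indicator {x. ennreal l < g x} x" for x
  have [measurable]: "g' \<in> borel_measurable \<nu>" unfolding g'_def by measurable
  have "maxfun \<nu> g x \<le> maxfun \<nu> (\<lambda>x. g' x + ennreal l) x" for x
    by (rule maxfun_mono) (auto simp: g'_def split: split_indicator)
  also have "\<dots> x \<le> maxfun \<nu> g' x + ennreal l" for x
    by (rule maxfun_add_const) simp
  finally have le: "maxfun \<nu> g x \<le> maxfun \<nu> g' x + ennreal l" for x .
  have "emeasure \<nu> {x. ennreal (2 * l) < maxfun \<nu> g x} \<le> emeasure \<nu> {x. ennreal l < maxfun \<nu> g' x}"
  proof (rule emeasure_mono)
    show "{x. ennreal (2 * l) < maxfun \<nu> g x} \<subseteq> {x. ennreal l < maxfun \<nu> g' x}"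
    proof (safe, rule ccontr)
      fix x
      assume x: "ennreal (2 * l) < maxfun \<nu> g x" "\<not> ennreal l < maxfun \<nu> g' x"
      have "maxfun \<nu> g x \<le> ennreal l + ennreal l"
        using le[of x] x(2) by (meson add_right_mono order_trans not_less)
      then show False using x(1) l by (simp add: ennreal_plus[symmetric] del: ennreal_plus)
    qed
    have "{x \<in> space \<nu>. ennreal l < maxfun \<nu> g' x} \<in> sets \<nu>" by measurable
    then show "{x. ennreal l < maxfun \<nu> g' x} \<in> sets \<nu>" by simp
  qed
  also have "\<dots> = ennreal (1 / l) * (ennreal l * emeasure \<nu> {x. ennreal l < maxfun \<nu> g' x})"
    using l by (simp add: mult.assoc[symmetric] ennreal_mult[symmetric])
  also have "\<dots> \<le> ennreal (1 / l) * (ennreal D * (\<integral>\<^sup>+x. g' x \<partial>\<nu>))"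
    by (intro mult_left_mono weak_type l) auto
  also have "\<dots> = ennreal (D / l) * (\<integral>\<^sup>+x. g' x \<partial>\<nu>)"
    using l D_nonneg by (simp add: mult.assoc[symmetric] ennreal_mult[symmetric])
  finally show ?thesis by (simp add: g'_def)
qed

end

text \<open>A geometric sum is comparable with its last term: beta/(beta - 1) comes from the series,
  the other beta from passing from 2 g to g. The threshold 2^k < 2 g means g > 2^k/2, the truncation
  height that belongs to the level 2^k.\<close>

lemma sum_geometric_below_threshold:
  fixes g \<beta> p :: real
  assumes p: "1 < p" and \<beta>: "\<beta> = 2 powr (p - 1)" and g: "0 \<le> g"
  shows "(\<Sum>k<n. if 2 ^ k < 2 * g then \<beta> ^ k else 0) \<le> \<beta>\<^sup>2 / (\<beta> - 1) * g powr (p - 1)"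
proof (induction n)
  case 0
  have "1 < \<beta>" using p \<beta> by simp
  then show ?case by simp
next
  case (Suc n)
  have b: "1 < \<beta>" using p \<beta> by simp
  \<comment> \<open>If the new term is present, the whole sum is bounded at once by the full
    geometric sum; the induction hypothesis serves the case of a vanishing new term.\<close>
  show ?case
  proof (cases "2 ^ n < 2 * g")
    case True
    have "(\<Sum>k<Suc n. if 2 ^ k < 2 * g then \<beta> ^ k else 0) \<le> (\<Sum>k<Suc n. \<beta> ^ k)"
      using b by (intro sum_mono) auto
    also have "\<dots> = (\<beta> ^ Suc n - 1) / (\<beta> - 1)"
      using b by (subst geometric_sum) auto
    also have "\<dots> \<le> \<beta> / (\<beta> - 1) * \<beta> ^ n"
      using b by (simp add: divide_right_mono)
    also have "\<dots> \<le> \<beta> / (\<beta> - 1) * (\<beta> * g powr (p - 1))"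
    proof (rule mult_left_mono)
      have "\<beta> ^ n = (2 ^ n) powr (p - 1)"
        by (simp add: \<beta> powr_powr powr_realpow[symmetric] mult.commute)
      also have "\<dots> \<le> (2 * g) powr (p - 1)"
        using True p by (intro powr_mono2) auto
      also have "\<dots> = \<beta> * g powr (p - 1)"
        using g by (simp add: \<beta> powr_mult)
      finally show "\<beta> ^ n \<le> \<beta> * g powr (p - 1)" .
    qed (use b in simp)
    also have "\<dots> = \<beta>\<^sup>2 / (\<beta> - 1) * g powr (p - 1)"
      by (simp add: power2_eq_square)
    finally show ?thesis .
  next
    case False
    then show ?thesis using Suc by simp
  qed
qed

lemma ennreal_le_suminf: "f k \<le> (\<Sum>k. f k :: ennreal)"
  using sum_le_suminf[OF summableI, of "{k}" f] by simp

text \<open>A discrete layer-cake bound: for finite y the single term with 2^k < y \<le> 2^(k+1)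
  dominates y^p. Only levels with k \<ge> 0 occur, hence y > 1.\<close>

lemma epowr_le_dyadic_sum:
  assumes "0 < p" "1 < y"
  shows "epowr y p \<le> (\<Sum>k. ennreal ((2 ^ Suc k) powr p) * indicator {y. ennreal (2 ^ k) < y} y)"
proof (cases y)
  case (real y')
  with assms have y': "1 < y'" by (simp add: one_less_ennreal)
  obtain n :: nat where "y' < 2 ^ n" using real_arch_pow[of 2 y'] by auto
  define k where "k = (LEAST k. y' \<le> 2 ^ Suc k)"
  have ex: "y' \<le> 2 ^ Suc n" using \<open>y' < 2 ^ n\<close> y' by simp
  have k: "y' \<le> 2 ^ Suc k" unfolding k_def by (rule LeastI[of _ n]) (rule ex)
  have "2 ^ k < y'"
  proof (cases k)
    case (Suc j)
    then have "\<not> y' \<le> 2 ^ Suc j" unfolding k_def using not_less_Least[of j "\<lambda>k. y' \<le> 2 ^ Suc k"] by auto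
    then show ?thesis using Suc by simp
  qed (use y' in simp)
  then have "epowr y p \<le> ennreal ((2 ^ Suc k) powr p) * indicator {y. ennreal (2 ^ k) < y} y"
    using k y' real assms(1) by (auto intro!: ennreal_leI powr_mono2 simp: ennreal_less_iff)
  also have "\<dots> \<le> (\<Sum>k. ennreal ((2 ^ Suc k) powr p) * indicator {y. ennreal (2 ^ k) < y} y)"
    by (rule ennreal_le_suminf)
  finally show ?thesis .
next
  \<comment> \<open>At infinity all indicators are 1 and every coefficient is at least 1, so the
    series diverges.\<close>
  case top
  have "of_nat n \<le> (\<Sum>k. ennreal ((2 ^ Suc k) powr p) * indicator {y. ennreal (2 ^ k) < y} y)" for n
  proof -
    have "of_nat n = (\<Sum>k<n. 1 :: ennreal)" by simp
    also have "\<dots> \<le> (\<Sum>k<n. ennreal ((2 ^ Suc k) powr p) * indicator {y. ennreal (2 ^ k) < y} y)"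
    proof (rule sum_mono)
      fix k :: nat
      have "1 \<le> ((2 :: real) ^ Suc k) powr p"
        using assms(1) by (intro ge_one_powr_ge_zero one_le_power) auto
      then show "1 \<le> ennreal ((2 ^ Suc k) powr p) * indicator {y. ennreal (2 ^ k) < y} y"
        using top by simp
    qed
    also have "\<dots> \<le> (\<Sum>k. ennreal ((2 ^ Suc k) powr p) * indicator {y. ennreal (2 ^ k) < y} y)"
      by (rule sum_le_suminf) auto
    finally show ?thesis .
  qed
  then have "(\<Sum>k. ennreal ((2 ^ Suc k) powr p) * indicator {y. ennreal (2 ^ k) < y} y) = top"
    using ennreal_SUP_of_nat_eq_top by (metis (no_types, lifting) SUP_least top.extremum_unique)
  then show ?thesis by simp
qed

text \<open>With beta = 2^(p - 1), the factor 2 D 2^p collects the heights of the dyadic layers and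
  the weak type constants, and beta^2/(beta - 1) is the geometric sum. It blows up as p tends to
  1.\<close>

definition maxfun_const :: "real \<Rightarrow> real \<Rightarrow> real" where
  "maxfun_const D p =
    2 * D * 2 powr p * ((2 powr (p - 1))\<^sup>2 / (2 powr (p - 1) - 1))"

context doubling_measure
begin

text \<open>Marcinkiewicz interpolation over the dyadic levels 2^k with k \<ge> 0, which reach only
  the values above 1.\<close>

lemma strong_type_above_1:
  assumes [measurable]: "g \<in> borel_measurable \<nu>" and p: "1 < p"
  shows "(\<integral>\<^sup>+x. epowr (maxfun \<nu> g x) p * indicator {x. 1 < maxfun \<nu> g x} x \<partial>\<nu>)
    \<le> ennreal (maxfun_const D p) * (\<integral>\<^sup>+x. epowr (g x) p \<partial>\<nu>)"
proof -
  define \<beta> where "\<beta> = 2 powr (p - 1)"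
  have b: "1 < \<beta>" using p by (simp add: \<beta>_def)
  define h where "h k x = (g x * indicator {x. ennreal (2 ^ k / 2) < g x} x)" for k :: nat and x
  have [measurable]: "h k \<in> borel_measurable \<nu>" for k unfolding h_def by measurable
  have set: "{x. ennreal (2 ^ k) < maxfun \<nu> g x} \<in> sets \<nu>" for k :: nat
  proof -
    have "{x \<in> space \<nu>. ennreal (2 ^ k) < maxfun \<nu> g x} \<in> sets \<nu>" by measurable
    then show ?thesis by simp
  qed
  \<comment> \<open>The k-th layer has height (2^(k+1))^p and measure at most D/(2^k/2) times an
    integral; dividing 2^(kp) by 2^k leaves beta^k.\<close>
  have coef: "(2 ^ Suc k) powr p * (D / (2 ^ k / 2)) = 2 * D * 2 powr p * \<beta> ^ k" for k :: nat
  proof -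
    have "(2 ^ Suc k :: real) powr p = 2 powr p * ((2 powr p) ^ k)"
      by (simp add: powr_mult powr_realpow[symmetric] powr_powr mult.commute)
    moreover have "\<beta> ^ k = (2 powr p) ^ k / 2 ^ k"
      by (simp add: \<beta>_def powr_diff power_divide)
    ultimately show ?thesis by simp
  qed
  have "(\<integral>\<^sup>+x. epowr (maxfun \<nu> g x) p * indicator {x. 1 < maxfun \<nu> g x} x \<partial>\<nu>)
    \<le> (\<integral>\<^sup>+x. (\<Sum>k. ennreal ((2 ^ Suc k) powr p) * indicator {x. ennreal (2 ^ k) < maxfun \<nu> g x} x) \<partial>\<nu>)"
    using epowr_le_dyadic_sum[of p "maxfun \<nu> g _"] p
    by (intro nn_integral_mono) (auto simp: indicator_def)
  also have "\<dots> = (\<Sum>k. ennreal ((2 ^ Suc k) powr p) * emeasure \<nu> {x. ennreal (2 ^ k) < maxfun \<nu> g x})"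
    using set by (subst nn_integral_suminf) (auto simp: nn_integral_cmult_indicator)
  also have "\<dots> \<le> (\<Sum>k. ennreal ((2 ^ Suc k) powr p) * (ennreal (D / (2 ^ k / 2)) * (\<integral>\<^sup>+x. h k x \<partial>\<nu>)))"
  proof (intro suminf_le mult_left_mono)
    show "emeasure \<nu> {x. ennreal (2 ^ k) < maxfun \<nu> g x} \<le> ennreal (D / (2 ^ k / 2)) * (\<integral>\<^sup>+x. h k x \<partial>\<nu>)" for k
      using level_set_maxfun[of g "2 ^ k / 2"] by (simp add: h_def)
  qed auto
  also have "\<dots> = (\<Sum>k. ennreal (2 * D * 2 powr p) * (\<integral>\<^sup>+x. ennreal (\<beta> ^ k) * h k x \<partial>\<nu>))"
  proof (intro suminf_cong)
    fix k
    have "ennreal ((2 ^ Suc k) powr p) * (ennreal (D / (2 ^ k / 2)) * (\<integral>\<^sup>+x. h k x \<partial>\<nu>))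
        = ennreal ((2 ^ Suc k) powr p * (D / (2 ^ k / 2))) * (\<integral>\<^sup>+x. h k x \<partial>\<nu>)"
      using D_nonneg by (subst ennreal_mult) (auto simp: mult.assoc)
    also have "\<dots> = ennreal (2 * D * 2 powr p) * (\<integral>\<^sup>+x. ennreal (\<beta> ^ k) * h k x \<partial>\<nu>)"
      unfolding coef using D_nonneg b by (subst ennreal_mult) (auto simp: mult.assoc nn_integral_cmult)
    finally show "ennreal ((2 ^ Suc k) powr p) * (ennreal (D / (2 ^ k / 2)) * (\<integral>\<^sup>+x. h k x \<partial>\<nu>))
        = ennreal (2 * D * 2 powr p) * (\<integral>\<^sup>+x. ennreal (\<beta> ^ k) * h k x \<partial>\<nu>)" .
  qed
  also have "\<dots> = ennreal (2 * D * 2 powr p) * (\<integral>\<^sup>+x. (\<Sum>k. ennreal (\<beta> ^ k) * h k x) \<partial>\<nu>)"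
    by (subst nn_integral_suminf) auto
  also have "\<dots> \<le> ennreal (2 * D * 2 powr p) * (\<integral>\<^sup>+x. ennreal (\<beta>\<^sup>2 / (\<beta> - 1)) * epowr (g x) p \<partial>\<nu>)"
  proof (intro mult_left_mono nn_integral_mono)
    fix x
    show "(\<Sum>k. ennreal (\<beta> ^ k) * h k x) \<le> ennreal (\<beta>\<^sup>2 / (\<beta> - 1)) * epowr (g x) p"
    proof (cases "g x")
      case (real y)
      show ?thesis
      proof (rule suminf_le_const)
        fix n
        have "(\<Sum>k<n. ennreal (\<beta> ^ k) * h k x) = (\<Sum>k<n. ennreal (y * (if 2 ^ k < 2 * y then \<beta> ^ k else 0)))"
          using real b by (intro sum.cong refl)
            (auto simp: h_def ennreal_less_iff ennreal_mult[symmetric] mult.commute split: split_indicator)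
        also have "\<dots> = ennreal (y * (\<Sum>k<n. if 2 ^ k < 2 * y then \<beta> ^ k else 0))"
          using real b by (subst sum_ennreal) (auto simp: sum_distrib_left)
        also have "\<dots> \<le> ennreal (y * (\<beta>\<^sup>2 / (\<beta> - 1) * y powr (p - 1)))"
          using real p by (intro ennreal_leI mult_left_mono sum_geometric_below_threshold) (auto simp: \<beta>_def)
        also have "y * (\<beta>\<^sup>2 / (\<beta> - 1) * y powr (p - 1)) = \<beta>\<^sup>2 / (\<beta> - 1) * y powr p"
          using real by (cases "y = 0") (auto simp: powr_diff)
        finally show "(\<Sum>k<n. ennreal (\<beta> ^ k) * h k x) \<le> ennreal (\<beta>\<^sup>2 / (\<beta> - 1)) * epowr (g x) p"
          using real b by (simp add: ennreal_mult[symmetric])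
      qed auto
    next
      case top
      then show ?thesis using b by (simp add: ennreal_mult_top)
    qed
  qed auto
  also have "\<dots> = ennreal (maxfun_const D p) * (\<integral>\<^sup>+x. epowr (g x) p \<partial>\<nu>)"
    using b D_nonneg by (simp add: maxfun_const_def \<beta>_def[symmetric] nn_integral_cmult mult.assoc[symmetric] ennreal_mult[symmetric])
  finally show ?thesis .
qed

text \<open>Both sides are homogeneous in g, so the previous estimate for 2^N g covers the set where
  the maximal function exceeds 2^(-N). These sets increase to the set where it is positive.\<close>

theorem strong_type:
  assumes [measurable]: "g \<in> borel_measurable \<nu>" and p: "1 < p"
  shows "(\<integral>\<^sup>+x. epowr (maxfun \<nu> g x) p \<partial>\<nu>) \<le> ennreal (maxfun_const D p) * (\<integral>\<^sup>+x. epowr (g x) p \<partial>\<nu>)"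
proof -
  define A where "A N = {x. 1 < ennreal (2 ^ N) * maxfun \<nu> g x}" for N :: nat
  have [measurable]: "A N \<in> sets \<nu>" for N
  proof -
    have "{x \<in> space \<nu>. 1 < ennreal (2 ^ N) * maxfun \<nu> g x} \<in> sets \<nu>" by measurable
    then show ?thesis by (simp add: A_def)
  qed
  have "incseq A"
  proof (rule incseq_SucI)
    fix N
    have "ennreal (2 ^ N) * maxfun \<nu> g x \<le> ennreal (2 ^ Suc N) * maxfun \<nu> g x" for x
      by (intro mult_right_mono ennreal_leI) auto
    then show "A N \<le> A (Suc N)" by (auto simp: A_def intro: less_le_trans)
  qed
  have bound: "(\<integral>\<^sup>+x. epowr (maxfun \<nu> g x) p * indicator (A N) x \<partial>\<nu>)
    \<le> ennreal (maxfun_const D p) * (\<integral>\<^sup>+x. epowr (g x) p \<partial>\<nu>)" for N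
  proof -
    let ?c = "ennreal (2 ^ N)"
    have c: "epowr ?c p * inverse (epowr ?c p) = 1"
      by (intro ennreal_inverse_mult_cancel) auto
    have "epowr ?c p * (\<integral>\<^sup>+x. epowr (maxfun \<nu> g x) p * indicator (A N) x \<partial>\<nu>)
      = (\<integral>\<^sup>+x. epowr (maxfun \<nu> (\<lambda>x. ?c * g x) x) p * indicator {x. 1 < maxfun \<nu> (\<lambda>x. ?c * g x) x} x \<partial>\<nu>)"
      using p by (subst nn_integral_cmult[symmetric]) (auto simp: maxfun_cmult epowr_mult A_def mult.assoc)
    also have "\<dots> \<le> ennreal (maxfun_const D p) * (\<integral>\<^sup>+x. epowr (?c * g x) p \<partial>\<nu>)"
      using p by (intro strong_type_above_1) auto
    also have "\<dots> = epowr ?c p * (ennreal (maxfun_const D p) * (\<integral>\<^sup>+x. epowr (g x) p \<partial>\<nu>))"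
      using p by (simp add: epowr_mult nn_integral_cmult mult.left_commute)
    finally have "inverse (epowr ?c p) * (epowr ?c p * (\<integral>\<^sup>+x. epowr (maxfun \<nu> g x) p * indicator (A N) x \<partial>\<nu>))
       \<le> inverse (epowr ?c p) * (epowr ?c p * (ennreal (maxfun_const D p) * (\<integral>\<^sup>+x. epowr (g x) p \<partial>\<nu>)))"
      by (rule mult_left_mono) simp
    then show ?thesis
      using c by (simp only: mult.assoc[symmetric] mult.commute[of "inverse _"] mult_1)
  qed
  have "epowr (maxfun \<nu> g x) p = (SUP N. epowr (maxfun \<nu> g x) p * indicator (A N) x)" for x
  proof (cases "maxfun \<nu> g x = 0")
    case False
    have "\<exists>N. x \<in> A N"
    proof (cases "maxfun \<nu> g x")
      case (real y)
      then have "0 < y" using False by (cases "y = 0") auto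
      then obtain N :: nat where "1 / y < 2 ^ N" using real_arch_pow[of 2 "1 / y"] by auto
      then show ?thesis using \<open>0 < y\<close> real
        by (intro exI[of _ N]) (auto simp: A_def ennreal_mult[symmetric] one_less_ennreal divide_simps)
    qed (auto simp: A_def ennreal_mult_top)
    then obtain N where "x \<in> A N" by blast
    then show ?thesis
      by (intro antisym SUP_upper2[of N] SUP_least) (auto split: split_indicator)
  qed auto
  then have "(\<integral>\<^sup>+x. epowr (maxfun \<nu> g x) p \<partial>\<nu>)
      = (\<integral>\<^sup>+x. (SUP N. epowr (maxfun \<nu> g x) p * indicator (A N) x) \<partial>\<nu>)" by simp
  also have "\<dots> = (SUP N. \<integral>\<^sup>+x. epowr (maxfun \<nu> g x) p * indicator (A N) x \<partial>\<nu>)"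
    using \<open>incseq A\<close>
    by (intro nn_integral_monotone_convergence_SUP)
      (auto simp: incseq_def le_fun_def split: split_indicator)
  also have "\<dots> \<le> ennreal (maxfun_const D p) * (\<integral>\<^sup>+x. epowr (g x) p \<partial>\<nu>)"
    by (intro SUP_least bound)
  finally show ?thesis .
qed

end

section \<open>Weighted bounds and the Rubio de Francia algorithm\<close>

abbreviation weighted :: "(real ^ 'n \<Rightarrow> real) \<Rightarrow> (real ^ 'n) measure" where
  "weighted s \<equiv> density lebesgue (\<lambda>x. ennreal (s x))"

lemma nn_integral_weighted:
  assumes "s \<in> borel_measurable lebesgue" "g \<in> borel_measurable lebesgue"
  shows "(\<integral>\<^sup>+x. g x \<partial>weighted s) = (\<integral>\<^sup>+x. ennreal (s x) * g x \<partial>lebesgue)"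
  using assms by (intro nn_integral_density) auto

text \<open>\<open>maxfun\<close> sees a cube only from its interior, whereas the estimates are
  integrated over the closed cube.\<close>

lemma AE_interior_cube:
  assumes "Q \<in> cubes"
  shows "AE x in lebesgue. x \<in> Q \<longrightarrow> x \<in> interior Q"
proof -
  obtain a h where Q: "Q = cube a h" using assms by (rule cubesE)
  have "negligible (frontier Q)"
    unfolding Q by (intro negligible_convex_frontier convex_box)
  then have "AE x in lebesgue. x \<notin> frontier Q"
    by (simp add: negligible_iff_null_sets AE_not_in)
  then show ?thesis
    by eventually_elim (auto simp: frontier_def Q)
qed

lemma ennreal_suminf_Suc_le: "(\<Sum>k. f (Suc k) :: ennreal) \<le> (\<Sum>k. f k)"
proof (rule suminf_le_const)
  fix n
  have "(\<Sum>k<n. f (Suc k)) = sum f (Suc ` {..<n})" by (simp add: sum.reindex)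
  also have "\<dots> \<le> (\<Sum>k. f k)" by (rule sum_le_suminf) auto
  finally show "(\<Sum>k<n. f (Suc k)) \<le> (\<Sum>k. f k)" .
qed simp

text \<open>Relative to mu = s^theta tau^(1 - theta), put p = 1/theta and omega = s/mu. Then tau/mu
  is the dual weight omega^(-1/(p-1)), and \<open>joint\<close> is the Muckenhoupt A_p condition for
  omega over mu, with constant K^(1/theta): Hoelder's inequality on cubes is reversed up to
  K.\<close>

locale weight_pair =
  fixes s \<tau> :: "real ^ 'n \<Rightarrow> real" and \<theta> K D :: real
  assumes s_meas [measurable]: "s \<in> borel_measurable lebesgue"
    and t_meas [measurable]: "\<tau> \<in> borel_measurable lebesgue"
    and s_pos: "0 < s x" and t_pos: "0 < \<tau> x"
    and theta: "0 < \<theta>" "\<theta> < 1" and K_pos: "0 < K"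
    and doubling_s: "doubling_measure (weighted s) D"
    and doubling_t: "doubling_measure (weighted \<tau>) D"
    and joint: "Q \<in> cubes \<Longrightarrow>
      epowr (emeasure (weighted s) Q) \<theta> * epowr (emeasure (weighted \<tau>) Q) (1 - \<theta>)
      \<le> ennreal K * emeasure (weighted (\<lambda>x. s x powr \<theta> * \<tau> x powr (1 - \<theta>))) Q"
begin

abbreviation mu where "mu x \<equiv> s x powr \<theta> * \<tau> x powr (1 - \<theta>)"

sublocale S: doubling_measure "weighted s" D by (rule doubling_s)
sublocale T: doubling_measure "weighted \<tau>" D by (rule doubling_t)

lemma mu_pos: "0 < mu x"
  using s_pos t_pos by (simp add: less_imp_neq[symmetric])

lemma mu_cube_pos: "Q \<in> cubes \<Longrightarrow> emeasure (weighted mu) Q \<noteq> 0"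
  using joint[of Q] S.cube_pos[of Q] T.cube_pos[of Q] by auto

lemma mu_cube_finite:
  assumes "Q \<in> cubes"
  shows "emeasure (weighted mu) Q \<noteq> top"
proof -
  note [measurable] = cubes_measure(1)[OF assms]
  have "emeasure (weighted mu) Q = (\<integral>\<^sup>+x. epowr (ennreal (s x) * indicator Q x) \<theta> *
      epowr (ennreal (\<tau> x) * indicator Q x) (1 - \<theta>) \<partial>lebesgue)"
    using s_pos t_pos
    by (subst emeasure_density) (auto simp: less_imp_le ennreal_mult split: split_indicator intro!: nn_integral_cong)
  also have "\<dots> \<le> epowr (emeasure (weighted s) Q) \<theta> * epowr (emeasure (weighted \<tau>) Q) (1 - \<theta>)"
    using theta by (subst (1 2) emeasure_density) (auto intro!: nn_integral_Holder)
  also have "\<dots> < top"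
    using assms S.cube_finite[of Q] T.cube_finite[of Q]
    by (simp add: ennreal_mult_less_top epowr_less_top_iff less_top del: epowr_eq_top_iff)
  finally show ?thesis by simp
qed

text \<open>This is (M_tau(f mu/tau))^(p-1) mu/s with p = 1/theta. The quotients of densities are
  such that integration against tau, then against s, becomes integration against mu.\<close>

definition lerner :: "(real ^ 'n \<Rightarrow> ennreal) \<Rightarrow> real ^ 'n \<Rightarrow> ennreal" where
  "lerner f y = epowr (maxfun (weighted \<tau>) (\<lambda>z. f z * ennreal ((s z / \<tau> z) powr \<theta>)) y) ((1 - \<theta>) / \<theta>)
    * ennreal ((\<tau> y / s y) powr (1 - \<theta>))"

lemma measurable_lerner [measurable]: "lerner f \<in> borel_measurable lebesgue"
proof -
  have [measurable]: "maxfun (weighted \<tau>) g \<in> borel_measurable lebesgue" for g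
    using T.measurable_maxfun[of g] by (simp cong: measurable_cong_sets)
  show ?thesis unfolding lerner_def by measurable
qed

text \<open>Lerner's argument: averages over \<open>mu\<close> become averages over \<open>\<tau>\<close>, then over \<open>s\<close>.\<close>

lemma maxfun_mu_le:
  assumes [measurable]: "f \<in> borel_measurable lebesgue"
  shows "maxfun (weighted mu) f x
    \<le> ennreal (K powr (1 / (1 - \<theta>))) * epowr (maxfun (weighted s) (lerner f) x) (\<theta> / (1 - \<theta>))"
  unfolding maxfun_def[of "weighted mu"]
proof (rule SUP_least)
  fix Q assume "Q \<in> {Q \<in> cubes. x \<in> interior Q}"
  then have Q: "Q \<in> cubes" "x \<in> interior Q" by auto
  note [measurable] = cubes_measure(1)[OF Q(1)]
  let ?S = "emeasure (weighted s) Q" and ?T = "emeasure (weighted \<tau>) Q"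
    and ?M = "emeasure (weighted mu) Q"
  define g where "g z = f z * ennreal ((s z / \<tau> z) powr \<theta>)" for z
  have [measurable]: "g \<in> borel_measurable lebesgue" unfolding g_def by measurable
  define A where "A = average (weighted \<tau>) Q g"
  define e where "e = \<theta> / (1 - \<theta>)"
  have e: "0 < e" "1 / e = (1 - \<theta>) / \<theta>" using theta by (auto simp: e_def)
  obtain n1 where n1: "?S = ennreal n1" "0 < n1"
    using S.cube_pos[OF Q(1)] S.cube_finite[OF Q(1)] by (cases ?S) (auto simp: order_less_le)
  obtain n2 where n2: "?T = ennreal n2" "0 < n2"
    using T.cube_pos[OF Q(1)] T.cube_finite[OF Q(1)] by (cases ?T) (auto simp: order_less_le)
  obtain n3 where n3: "?M = ennreal n3" "0 < n3"
    using mu_cube_pos[OF Q(1)] mu_cube_finite[OF Q(1)] by (cases ?M) (auto simp: order_less_le)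
  \<comment> \<open>The condition \<open>joint\<close> raised to the power 1/(1 - theta) and solved
    for the ratio of tau(Q) to mu(Q).\<close>
  have n: "n2 / n3 \<le> K powr (1 / (1 - \<theta>)) * (n3 / n1) powr e"
  proof -
    have "n1 powr \<theta> * n2 powr (1 - \<theta>) \<le> K * n3"
      using joint[OF Q(1)] n1 n2 n3 K_pos by (simp add: ennreal_mult[symmetric] less_imp_le)
    then have "(n1 powr \<theta> * n2 powr (1 - \<theta>)) powr (1 / (1 - \<theta>)) \<le> (K * n3) powr (1 / (1 - \<theta>))"
      using theta n1 n2 by (intro powr_mono2) auto
    then have "n1 powr e * n2 \<le> K powr (1 / (1 - \<theta>)) * n3 powr (1 / (1 - \<theta>))"
      using n1 n2 n3 K_pos theta by (simp add: powr_mult powr_powr e_def)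
    also have "1 / (1 - \<theta>) = e + 1" using theta by (simp add: e_def field_simps)
    also have "n3 powr (e + 1) = n3 powr e * n3" using n3 by (simp add: powr_add)
    finally show ?thesis
      using n1 n2 n3 by (simp add: powr_divide field_simps \<open>1 / (1 - \<theta>) = e + 1\<close>)
  qed
  have eq1: "(\<integral>\<^sup>+y\<in>Q. f y \<partial>weighted mu) = (\<integral>\<^sup>+y\<in>Q. g y \<partial>weighted \<tau>)"
  proof -
    have "mu y = \<tau> y * (s y / \<tau> y) powr \<theta>" for y
      using s_pos[of y] t_pos[of y] by (simp add: powr_divide powr_diff)
    then show ?thesis
      using s_pos t_pos
      by (subst (1 2) nn_integral_weighted)
        (auto simp: g_def ennreal_mult less_imp_le ac_simps intro!: nn_integral_cong)
  qed
  \<comment> \<open>\<open>A\<close> is one of the averages of g over tau, hence at most the maximal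
    function at almost every point of Q. So a constant times mu(Q) is bounded by the integral of
    \<open>lerner f\<close> against s.\<close>
  have "epowr A (1 / e) * ?M = (\<integral>\<^sup>+y. ennreal (mu y) * epowr A (1 / e) * indicator Q y \<partial>lebesgue)"
    by (subst emeasure_density) (auto simp: nn_integral_cmult[symmetric] ac_simps intro!: nn_integral_cong)
  also have "\<dots> \<le> (\<integral>\<^sup>+y. ennreal (s y) * (lerner f y * indicator Q y) \<partial>lebesgue)"
  proof (intro nn_integral_mono_AE)
    show "AE y in lebesgue. ennreal (mu y) * epowr A (1 / e) * indicator Q y
        \<le> ennreal (s y) * (lerner f y * indicator Q y)"
      using AE_interior_cube[OF Q(1)]
    proof eventually_elim
      case (elim y)
      show ?case
      proof (cases "y \<in> Q")
        case True
        then have A: "A \<le> maxfun (weighted \<tau>) g y"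
          unfolding A_def maxfun_def using Q elim by (intro SUP_upper) auto
        have "s y / s y powr (1 - \<theta>) = s y powr \<theta>"
          using powr_diff[of "s y" 1 "1 - \<theta>"] s_pos[of y] by simp
        then have mu_eq: "mu y = s y * (\<tau> y / s y) powr (1 - \<theta>)"
          using s_pos[of y] t_pos[of y] by (simp add: powr_divide flip: times_divide_eq_left)
        from A have "ennreal (mu y) * epowr A (1 / e) \<le> ennreal (mu y) * epowr (maxfun (weighted \<tau>) g y) (1 / e)"
          using e(1) by (intro mult_left_mono epowr_mono) auto
        also have "\<dots> = ennreal (s y) * lerner f y"
          unfolding mu_eq using s_pos[of y]
          by (simp add: lerner_def g_def[symmetric] e ennreal_mult less_imp_le ac_simps)
        finally show ?thesis using True by simp
      qed simp
    qed
  qed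
  also have "\<dots> = (\<integral>\<^sup>+y\<in>Q. lerner f y \<partial>weighted s)"
    by (rule nn_integral_weighted[symmetric]) measurable
  finally have "epowr A (1 / e) * ?M / ?S \<le> average (weighted s) Q (lerner f)"
    by (rule divide_right_mono_ennreal)
  also have "\<dots> \<le> maxfun (weighted s) (lerner f) x"
    unfolding maxfun_def using Q by (intro SUP_upper) auto
  finally have "epowr (epowr A (1 / e) * ?M / ?S) e \<le> epowr (maxfun (weighted s) (lerner f) x) e"
    using e by (intro epowr_mono) auto
  also have "epowr (epowr A (1 / e) * ?M / ?S) e = A * ennreal ((n3 / n1) powr e)"
    using e(1) n1 n3 by (simp add: epowr_mult divide_ennreal ennreal_times_divide[symmetric])
  finally have A: "A * ennreal ((n3 / n1) powr e) \<le> epowr (maxfun (weighted s) (lerner f) x) e" .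
  \<comment> \<open>Since f mu = g tau, the average over mu is A times tau(Q)/mu(Q).\<close>
  have "average (weighted mu) Q f = A * ennreal (n2 / n3)"
    unfolding eq1 A_def using n2 n3
    by (simp add: divide_ennreal_def inverse_ennreal ennreal_mult[symmetric] mult.assoc divide_inverse
        mult.assoc[symmetric, of "inverse n2"])
  also have "\<dots> \<le> A * (ennreal (K powr (1 / (1 - \<theta>))) * ennreal ((n3 / n1) powr e))"
    using n by (intro mult_left_mono) (auto simp: ennreal_mult[symmetric] intro!: ennreal_leI)
  also have "\<dots> = ennreal (K powr (1 / (1 - \<theta>))) * (A * ennreal ((n3 / n1) powr e))"
    by (simp add: ac_simps)
  also have "\<dots> \<le> ennreal (K powr (1 / (1 - \<theta>))) * epowr (maxfun (weighted s) (lerner f) x) e"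
    using A by (intro mult_left_mono) auto
  finally show "average (weighted mu) Q f
    \<le> ennreal (K powr (1 / (1 - \<theta>))) * epowr (maxfun (weighted s) (lerner f) x) (\<theta> / (1 - \<theta>))"
    by (simp add: e_def)
qed

section \<open>Boundedness of the maximal function of mu\<close>

abbreviation power_integral :: "(real ^ 'n \<Rightarrow> ennreal) \<Rightarrow> ennreal" where
  "power_integral f \<equiv> (\<integral>\<^sup>+x. epowr (f x) (1 / \<theta>) \<partial>weighted s)"

text \<open>The power of K is the constant of \<open>maxfun_mu_le\<close> raised to 1/theta. The
  other factors are the maximal theorems for s at exponent 1/(1 - theta) and for tau at exponent
  1/theta.\<close>

definition bound where
  "bound = K powr (1 / (\<theta> * (1 - \<theta>))) * (maxfun_const D (1 / (1 - \<theta>)) * maxfun_const D (1 / \<theta>))"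

lemma maxfun_const_nonneg: "0 \<le> D \<Longrightarrow> 1 < p \<Longrightarrow> 0 \<le> maxfun_const D p"
  unfolding maxfun_const_def by (intro mult_nonneg_nonneg divide_nonneg_nonneg) (auto simp: ge_one_powr_ge_zero)

text \<open>The exponents fit exactly. The pointwise bound raised to 1/theta leaves M_s at exponent
  1/(1 - theta); once M_s is removed, s times the power 1/(1 - theta) of \<open>lerner f\<close> is
  tau (M_tau g)^(1/theta), and once M_tau is removed, tau g^(1/theta) is s f^(1/theta).\<close>

theorem weighted_maxfun_bound:
  assumes [measurable]: "f \<in> borel_measurable lebesgue"
  shows "power_integral (maxfun (weighted mu) f)
    \<le> ennreal bound * power_integral f"
proof -
  let ?g = "\<lambda>z. f z * ennreal ((s z / \<tau> z) powr \<theta>)"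
  let ?k = "K powr (1 / (\<theta> * (1 - \<theta>)))" and ?c1 = "maxfun_const D (1 / (1 - \<theta>))" and ?c2 = "maxfun_const D (1 / \<theta>)"
  have [measurable]: "maxfun (weighted \<tau>) h \<in> borel_measurable lebesgue"
    "maxfun (weighted s) h \<in> borel_measurable lebesgue" for h
    using T.measurable_maxfun[of h] S.measurable_maxfun[of h] by (simp_all cong: measurable_cong_sets)
  have c: "0 \<le> ?c1" "0 \<le> ?c2"
    using theta S.D_nonneg by (auto intro!: maxfun_const_nonneg)
  have "power_integral (maxfun (weighted mu) f)
    \<le> (\<integral>\<^sup>+x. epowr (ennreal (K powr (1 / (1 - \<theta>)))
        * epowr (maxfun (weighted s) (lerner f) x) (\<theta> / (1 - \<theta>))) (1 / \<theta>) \<partial>weighted s)"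
    using theta by (intro nn_integral_mono epowr_mono maxfun_mu_le) auto
  also have "\<dots> = ennreal ?k * (\<integral>\<^sup>+x. epowr (maxfun (weighted s) (lerner f) x) (1 / (1 - \<theta>)) \<partial>weighted s)"
    using theta by (simp add: epowr_mult powr_powr nn_integral_cmult mult.commute)
  also have "\<dots> \<le> ennreal ?k * (ennreal ?c1 * (\<integral>\<^sup>+x. epowr (lerner f x) (1 / (1 - \<theta>)) \<partial>weighted s))"
    using theta by (intro mult_left_mono S.strong_type) (auto cong: measurable_cong_sets)
  also have "(\<integral>\<^sup>+x. epowr (lerner f x) (1 / (1 - \<theta>)) \<partial>weighted s)
      = (\<integral>\<^sup>+x. epowr (maxfun (weighted \<tau>) ?g x) (1 / \<theta>) \<partial>weighted \<tau>)"
  proof -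
    have "ennreal (s x) * epowr (lerner f x) (1 / (1 - \<theta>))
        = ennreal (\<tau> x) * epowr (maxfun (weighted \<tau>) ?g x) (1 / \<theta>)" for x
    proof -
      have "epowr (lerner f x) (1 / (1 - \<theta>)) = epowr (maxfun (weighted \<tau>) ?g x) (1 / \<theta>) * ennreal (\<tau> x / s x)"
        unfolding lerner_def using theta s_pos[of x] t_pos[of x] by (subst epowr_mult) (auto simp: powr_powr)
      moreover have "ennreal (s x) * ennreal (\<tau> x / s x) = ennreal (\<tau> x)"
        using s_pos[of x] t_pos[of x] by (simp add: ennreal_mult[symmetric])
      ultimately show ?thesis
        by (simp only: mult.left_commute[of "ennreal (s x)"] mult.commute[of _ "ennreal (\<tau> x)"])
    qed
    then show ?thesis by (simp add: nn_integral_weighted)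
  qed
  also have "\<dots> \<le> ennreal ?c2 * (\<integral>\<^sup>+x. epowr (?g x) (1 / \<theta>) \<partial>weighted \<tau>)"
    using theta by (intro T.strong_type) (auto cong: measurable_cong_sets)
  also have "(\<integral>\<^sup>+x. epowr (?g x) (1 / \<theta>) \<partial>weighted \<tau>) = power_integral f"
  proof -
    have "ennreal (\<tau> x) * epowr (?g x) (1 / \<theta>) = ennreal (s x) * epowr (f x) (1 / \<theta>)" for x
    proof -
      have "epowr (?g x) (1 / \<theta>) = epowr (f x) (1 / \<theta>) * ennreal (s x / \<tau> x)"
        using theta s_pos[of x] t_pos[of x] by (subst epowr_mult) (auto simp: powr_powr)
      moreover have "ennreal (\<tau> x) * ennreal (s x / \<tau> x) = ennreal (s x)"
        using s_pos[of x] t_pos[of x] by (simp add: ennreal_mult[symmetric])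
      ultimately show ?thesis
        by (simp only: mult.left_commute[of "ennreal (\<tau> x)"] mult.commute[of _ "ennreal (s x)"])
    qed
    then show ?thesis by (simp add: nn_integral_weighted)
  qed
  finally show ?thesis
    using c by (simp add: bound_def ennreal_mult mult_left_mono mult.assoc)
qed

section \<open>The Rubio de Francia iteration\<close>

definition rdf_const where
  "rdf_const = max bound 1 powr \<theta>"

lemma rdf_const_pos: "0 < rdf_const"
  by (simp add: rdf_const_def)

text \<open>The majorant is the series of 2^(-k) T^k alpha_0, where T is the maximal operator of mu
  divided by \<open>rdf_const\<close>. That number bounds the operator norm (the maximum with 1
  keeps it positive), so T does not increase the power integral. T shifts the series by one index at
  the cost of a factor 2, which makes the sum an A_1 weight over mu; its first term is
  alpha_0.\<close>

theorem rubio_de_francia: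
  fixes \<alpha>\<^sub>0 :: "real ^ 'n \<Rightarrow> ennreal"
  defines "I \<equiv> power_integral \<alpha>\<^sub>0"
  assumes a0 [measurable]: "\<alpha>\<^sub>0 \<in> borel_measurable lebesgue" and I: "I \<noteq> 0" "I \<noteq> top"
  obtains \<beta> where "\<beta> \<in> borel_measurable lebesgue" "\<And>x. 0 < \<beta> x"
    "AE x in lebesgue. \<alpha>\<^sub>0 x \<le> ennreal (\<beta> x)"
    "power_integral (\<lambda>x. ennreal (\<beta> x)) \<le> ennreal (2 powr (1 / \<theta>)) * I"
    "\<And>Q. Q \<in> cubes \<Longrightarrow> AE x in lebesgue. x \<in> Q \<longrightarrow>
      average (weighted mu) Q (\<lambda>y. ennreal (\<beta> y))
      \<le> ennreal (2 * rdf_const * \<beta> x)"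
proof -
  let ?M = "weighted mu" and ?P = "1 / \<theta>"
  define T where "T f x = inverse (ennreal rdf_const) * maxfun ?M f x" for f x
  define F where "F k = (T ^^ k) \<alpha>\<^sub>0" for k
  have [measurable]: "maxfun ?M f \<in> borel_measurable lebesgue" for f
    using borel_maxfun[of ?M f] by (simp add: measurable_completion)
  have F_Suc: "F (Suc k) x = inverse (ennreal rdf_const) * maxfun ?M (F k) x" for k x
    by (simp add: F_def T_def)
  have maxF: "maxfun ?M (F k) x = ennreal rdf_const * F (Suc k) x" for k x
    using rdf_const_pos by (simp add: F_Suc mult.assoc[symmetric] ennreal_inverse_mult_cancel)
  have [measurable]: "F k \<in> borel_measurable lebesgue" for k
  proof (cases k)
    case (Suc j)
    have "F k = (\<lambda>x. inverse (ennreal rdf_const) * maxfun ?M (F j) x)"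
      by (rule ext) (simp add: Suc F_Suc)
    then show ?thesis by simp
  qed (simp add: F_def)
  have F_norm: "power_integral (F k) \<le> I" for k
  proof (induction k)
    case (Suc k)
    have c: "epowr (inverse (ennreal rdf_const)) ?P = ennreal (1 / max bound 1)"
      using theta by (simp add: rdf_const_def inverse_ennreal powr_powr inverse_powr powr_divide divide_inverse)
    have "power_integral (\<lambda>x. F (Suc k) x)
        = ennreal (1 / max bound 1) * power_integral (maxfun ?M (F k))"
      unfolding F_Suc using theta by (simp add: epowr_mult nn_integral_cmult c)
    also have "\<dots> \<le> ennreal (1 / max bound 1) * (ennreal bound * power_integral (F k))"
      by (intro mult_left_mono weighted_maxfun_bound) auto
    also have "\<dots> = ennreal (bound / max bound 1) * power_integral (F k)"
      by (simp add: mult.assoc[symmetric] ennreal_mult'[symmetric])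
    also have "\<dots> \<le> 1 * I"
      using Suc.IH by (intro mult_mono) (auto simp: ennreal_le_1)
    finally show ?case by simp
  qed (simp add: F_def I_def)
  define \<alpha> where "\<alpha> x = (\<Sum>k. ennreal ((1 / 2) ^ k) * F k x)" for x
  have [measurable]: "\<alpha> \<in> borel_measurable lebesgue" unfolding \<alpha>_def by measurable
  have ge: "\<alpha>\<^sub>0 x \<le> \<alpha> x" for x
    using ennreal_le_suminf[of "\<lambda>k. ennreal ((1 / 2) ^ k) * F k x" 0] by (simp add: \<alpha>_def F_def)
  have geo: "(\<Sum>k. ennreal ((1 / 2) ^ k)) = 2"
    using suminf_geometric[of "1 / 2 :: real"] by (subst suminf_ennreal2) auto
  have norm: "power_integral \<alpha> \<le> ennreal (2 powr ?P) * I"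
  proof -
    \<comment> \<open>Hoelder's inequality over the naturals with the weights 2^(-k). The weights
      sum to 2, which leaves the factor 2^(1/theta - 1).\<close>
    have pw: "epowr (\<alpha> x) ?P \<le> ennreal (2 powr (?P - 1)) * (\<Sum>k. ennreal ((1 / 2) ^ k) * epowr (F k x) ?P)" for x
    proof -
      have "\<alpha> x = (\<integral>\<^sup>+k. epowr (ennreal ((1 / 2) ^ k) * epowr (F k x) ?P) \<theta> * epowr (ennreal ((1 / 2) ^ k)) (1 - \<theta>) \<partial>count_space UNIV)"
      proof -
        have "epowr (c * epowr y ?P) \<theta> * epowr c (1 - \<theta>) = c * y" for c y
        proof -
          have "epowr (c * epowr y ?P) \<theta> * epowr c (1 - \<theta>) = epowr c \<theta> * epowr c (1 - \<theta>) * y"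
            using theta by (simp add: epowr_mult mult.assoc mult.commute[of y])
          then show ?thesis by (simp add: epowr_add[symmetric])
        qed
        then show ?thesis by (simp only: \<alpha>_def nn_integral_count_space_nat)
      qed
      also have "\<dots> \<le> epowr (\<integral>\<^sup>+k. ennreal ((1 / 2) ^ k) * epowr (F k x) ?P \<partial>count_space UNIV) \<theta>
          * epowr (\<integral>\<^sup>+k. ennreal ((1 / 2) ^ k) \<partial>count_space UNIV) (1 - \<theta>)"
        using theta by (intro nn_integral_Holder) auto
      finally have "epowr (\<alpha> x) ?P \<le> epowr (epowr (\<Sum>k. ennreal ((1 / 2) ^ k) * epowr (F k x) ?P) \<theta> * epowr 2 (1 - \<theta>)) ?P"
        using theta by (intro epowr_mono) (auto simp: nn_integral_count_space_nat geo)
      also have "\<dots> = epowr 2 (?P - 1) * (\<Sum>k. ennreal ((1 / 2) ^ k) * epowr (F k x) ?P)"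
        using theta by (simp add: epowr_mult diff_divide_distrib mult.commute)
      also have "epowr 2 (?P - 1) = ennreal (2 powr (?P - 1))"
        using epowr_ennreal[of 2 "?P - 1"] by simp
      finally show ?thesis .
    qed
    have "power_integral \<alpha>
      \<le> (\<integral>\<^sup>+x. ennreal (2 powr (?P - 1)) * (\<Sum>k. ennreal ((1 / 2) ^ k) * epowr (F k x) ?P) \<partial>weighted s)"
      by (intro nn_integral_mono pw)
    also have "\<dots> = ennreal (2 powr (?P - 1)) * (\<Sum>k. ennreal ((1 / 2) ^ k) * power_integral (F k))"
      by (simp add: nn_integral_cmult nn_integral_suminf)
    also have "\<dots> \<le> ennreal (2 powr (?P - 1)) * (\<Sum>k. ennreal ((1 / 2) ^ k) * I)"
      using F_norm by (intro mult_left_mono suminf_le) auto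
    also have "\<dots> = ennreal (2 powr (?P - 1)) * (2 * I)"
      by (simp add: ennreal_suminf_multc geo)
    also have "\<dots> = ennreal (2 powr ?P) * I"
      by (simp add: powr_diff mult.assoc[symmetric] ennreal_mult''[symmetric] flip: ennreal_numeral)
    finally show ?thesis .
  qed
  have avg: "average ?M Q \<alpha> \<le> ennreal (2 * rdf_const) * \<alpha> x"
    if Q: "Q \<in> cubes" "x \<in> interior Q" for Q x
  proof -
    note [measurable] = cubes_measure(1)[OF Q(1)]
    have "average ?M Q \<alpha>
        = (\<Sum>k. ennreal ((1 / 2) ^ k) * (\<integral>\<^sup>+y\<in>Q. F k y \<partial>?M)) / emeasure ?M Q"
      unfolding \<alpha>_def
      by (simp add: ennreal_suminf_multc[symmetric] nn_integral_suminf mult.assoc nn_integral_cmult)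
    also have "\<dots> = (\<Sum>k. ennreal ((1 / 2) ^ k) * (average ?M Q (F k)))"
      by (simp add: divide_ennreal_def ennreal_suminf_multc[symmetric] mult.assoc)
    also have "\<dots> \<le> (\<Sum>k. ennreal ((1 / 2) ^ k) * maxfun ?M (F k) x)"
      using Q by (intro suminf_le mult_left_mono) (auto simp: maxfun_def intro!: SUP_upper)
    \<comment> \<open>\<open>F (Suc k)\<close> carries half the weight of its predecessor in the
      series; this is the 2 in the constant.\<close>
    also have "\<dots> = (\<Sum>k. ennreal (2 * rdf_const) * (ennreal ((1 / 2) ^ Suc k) * F (Suc k) x))"
    proof (intro suminf_cong)
      fix k
      have "ennreal ((1 / 2) ^ k) * ennreal rdf_const = ennreal (2 * rdf_const) * ennreal ((1 / 2) ^ Suc k)"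
        using rdf_const_pos by (simp add: ennreal_mult[symmetric] less_imp_le mult.commute)
      then show "ennreal ((1 / 2) ^ k) * maxfun ?M (F k) x
          = ennreal (2 * rdf_const) * (ennreal ((1 / 2) ^ Suc k) * F (Suc k) x)"
        unfolding maxF by (simp only: mult.assoc[symmetric])
    qed
    also have "\<dots> = ennreal (2 * rdf_const) * (\<Sum>k. ennreal ((1 / 2) ^ Suc k) * F (Suc k) x)"
      by simp
    also have "\<dots> \<le> ennreal (2 * rdf_const) * \<alpha> x"
      unfolding \<alpha>_def
      by (intro mult_left_mono ennreal_suminf_Suc_le[of "\<lambda>k. ennreal ((1 / 2) ^ k) * F k x"]) simp
    finally show ?thesis .
  qed
  \<comment> \<open>A zero at a single point would make all averages over cubes around it vanish.
    Such cubes exhaust the space, so alpha_0 would be 0 almost everywhere, against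
    \<open>I \<noteq> 0\<close>. Positivity thus holds at every point.\<close>
  have pos: "\<alpha> x \<noteq> 0" for x
  proof
    assume zero: "\<alpha> x = 0"
    define Q where "Q n = cube (\<chi> i. x $ i - real (Suc n)) (2 * real (Suc n))" for n
    have Q: "Q n \<in> cubes" for n unfolding Q_def by (intro cubesI) auto
    have inQ: "x \<in> interior (Q n)" for n
      by (simp add: Q_def interior_cbox mem_box_cart)
    have "AE y in lebesgue. y \<in> Q n \<longrightarrow> \<alpha> y = 0" for n
    proof -
      note [measurable] = cubes_measure(1)[OF Q[of n]]
      have "(\<integral>\<^sup>+y\<in>Q n. \<alpha> y \<partial>?M) = 0"
        using avg[OF Q[of n] inQ] zero mu_cube_finite[OF Q[of n]]
        by (simp add: ennreal_divide_eq_0_iff)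
      then have "AE y in ?M. \<alpha> y * indicator (Q n) y = 0"
        by (subst (asm) nn_integral_0_iff_AE) auto
      then have "AE y in lebesgue. \<alpha> y * indicator (Q n) y = 0"
        using mu_pos by (subst (asm) AE_density) auto
      then show ?thesis by (auto elim!: eventually_mono)
    qed
    then have "AE y in lebesgue. \<forall>n. y \<in> Q n \<longrightarrow> \<alpha> y = 0"
      by (subst AE_all_countable) auto
    moreover have "\<exists>n. y \<in> Q n" for y
    proof -
      obtain n where n: "norm (y - x) < real n" using reals_Archimedean2 by blast
      have "\<bar>y $ i - x $ i\<bar> < real n" for i
        using component_le_norm_cart[of "y - x" i] n by simp
      then have "x $ i - (1 + real n) \<le> y $ i \<and> y $ i \<le> x $ i - (1 + real n) + 2 * (1 + real n)" for i
        by (smt (verit))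
      then show ?thesis by (intro exI[of _ n]) (simp add: Q_def mem_box_cart)
    qed
    ultimately have "AE y in lebesgue. \<alpha>\<^sub>0 y = 0"
      by (elim eventually_mono) (metis ge le_zero_eq)
    then have "I = (\<integral>\<^sup>+y. 0 \<partial>weighted s)"
      unfolding I_def by (intro nn_integral_cong_AE) (auto simp: AE_density elim!: eventually_mono)
    then show False using I by simp
  qed
  have fin: "AE x in lebesgue. \<alpha> x \<noteq> top"
  proof -
    have "ennreal (2 powr ?P) * I \<noteq> top" using I by (auto simp: ennreal_mult_eq_top_iff)
    then have "power_integral \<alpha> \<noteq> top" using norm by (auto simp: top_unique)
    then have "AE x in weighted s. epowr (\<alpha> x) ?P \<noteq> \<infinity>"
      by (intro nn_integral_PInf_AE) auto
    then show ?thesis using s_pos by (subst (asm) AE_density) auto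
  qed
  \<comment> \<open>The value infinity occurs only on a null set; replacing it by 1 keeps the
    majorant real and positive everywhere.\<close>
  define \<beta> where "\<beta> x = (if \<alpha> x = top then 1 else enn2real (\<alpha> x))" for x
  have ae: "AE x in lebesgue. ennreal (\<beta> x) = \<alpha> x"
    using fin by eventually_elim (auto simp: \<beta>_def less_top)
  have [measurable]: "\<beta> \<in> borel_measurable lebesgue" unfolding \<beta>_def by measurable
  have ae_s: "AE x in weighted s. ennreal (\<beta> x) = \<alpha> x"
    and ae_M: "AE x in ?M. ennreal (\<beta> x) = \<alpha> x"
    using ae by (auto simp: AE_density elim!: eventually_mono)
  show thesis
  proof (rule that)
    show "\<beta> \<in> borel_measurable lebesgue" by measurable
    show "0 < \<beta> x" for x
      using pos[of x] by (auto simp: \<beta>_def enn2real_positive_iff less_top zero_less_iff_neq_zero)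
    show "AE x in lebesgue. \<alpha>\<^sub>0 x \<le> ennreal (\<beta> x)"
      using ae by eventually_elim (simp add: ge)
    have "power_integral (\<lambda>x. ennreal (\<beta> x)) = power_integral \<alpha>"
      using ae_s by (intro nn_integral_cong_AE) (auto elim!: eventually_mono)
    then show "power_integral (\<lambda>x. ennreal (\<beta> x)) \<le> ennreal (2 powr ?P) * I"
      using norm by simp
    fix Q :: "(real ^ 'n) set" assume Q: "Q \<in> cubes"
    have eq: "(\<integral>\<^sup>+y\<in>Q. ennreal (\<beta> y) \<partial>?M) = (\<integral>\<^sup>+y\<in>Q. \<alpha> y \<partial>?M)"
      using ae_M by (intro nn_integral_cong_AE) (auto elim!: eventually_mono)
    show "AE x in lebesgue. x \<in> Q \<longrightarrow>
      average ?M Q (\<lambda>y. ennreal (\<beta> y)) \<le> ennreal (2 * rdf_const * \<beta> x)"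
      unfolding eq using ae AE_interior_cube[OF Q]
    proof eventually_elim
      case (elim x)
      then show ?case
        using avg[OF Q, of x] rdf_const_pos by (auto simp: ennreal_mult'' ennreal_mult' less_imp_le)
    qed
  qed
qed

end

section \<open>Pairs of exponents\<close>

abbreviation cube_norm :: "(real ^ 'n) set \<Rightarrow> real \<Rightarrow> (real ^ 'n \<Rightarrow> ennreal) \<Rightarrow> ennreal" where
  "cube_norm Q \<equiv> rnorm (uniform_measure lebesgue Q)"

abbreviation weight_norm :: "(real ^ 'n) set \<Rightarrow> real \<Rightarrow> (real ^ 'n \<Rightarrow> real) \<Rightarrow> ennreal" where
  "weight_norm Q a g \<equiv> cube_norm Q a (\<lambda>x. ennreal (g x))"

lemma rnorm_epowr:
  assumes "0 < a" "0 < k"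
  shows "rnorm M (a * k) (\<lambda>x. epowr (g x) k) = epowr (rnorm M a g) k"
  using assms by (simp add: rnorm_def field_simps)

lemma emeasure_uniform_cube: "Q \<in> cubes \<Longrightarrow> emeasure (uniform_measure lebesgue Q) UNIV = 1"
  using cubes_measure[of Q]
  by (simp add: emeasure_uniform_measure less_top[symmetric] del: emeasure_completion)

lemma AE_uniform_cube:
  assumes "Q \<in> cubes"
  shows "(AE x in uniform_measure lebesgue Q. P x) \<longleftrightarrow> (AE x in lebesgue. x \<in> Q \<longrightarrow> P x)"
  using cubes_measure[OF assms]
  by (intro AE_uniform_measure) (auto simp: less_top[symmetric] simp del: emeasure_completion)

lemma not_AE_False_uniform_cube: "Q \<in> cubes \<Longrightarrow> \<not> (AE x in uniform_measure lebesgue Q. False)"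
  using emeasure_uniform_cube[of Q] AE_iff_measurable[of UNIV "uniform_measure lebesgue Q" "\<lambda>_. False"]
  by simp

lemma cube_norm_nonzero:
  assumes "Q \<in> cubes" and [measurable]: "g \<in> borel_measurable lebesgue" and "\<And>x. 0 < g x"
  shows "cube_norm Q a g \<noteq> 0"
proof
  assume "cube_norm Q a g = 0"
  then have "AE x in uniform_measure lebesgue Q. g x = 0"
    by (subst (asm) rnorm_eq_0_iff) auto
  then have "AE x in uniform_measure lebesgue Q. False"
    using assms(3) by (auto elim!: eventually_mono simp: less_le)
  then show False using not_AE_False_uniform_cube[OF assms(1)] by simp
qed

lemma cube_norm_eq:
  assumes Q: "Q \<in> cubes" and [measurable]: "g \<in> borel_measurable lebesgue" and a: "0 < a"
  shows "cube_norm Q a g = epowr ((\<integral>\<^sup>+x\<in>Q. epowr (g x) (1 / a) \<partial>lebesgue) / emeasure lebesgue Q) a"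
proof -
  note [measurable] = cubes_measure(1)[OF Q]
  show ?thesis
    using a by (simp add: rnorm_def nn_integral_uniform_measure del: emeasure_completion)
qed

text \<open>The integral grows with the domain, so only the normalisation by the volume is
  lost.\<close>

lemma cube_norm_subset:
  assumes Q: "Q \<in> cubes" "Q' \<in> cubes" "Q \<subseteq> Q'" and g [measurable]: "g \<in> borel_measurable lebesgue" and a: "0 \<le> a"
  shows "cube_norm Q a g \<le> epowr (emeasure lebesgue Q' / emeasure lebesgue Q) a * cube_norm Q' a g"
proof (cases "a = 0")
  case True
  have "AE x in uniform_measure lebesgue Q'. g x \<le> esssup (uniform_measure lebesgue Q') g"
    by (rule esssup_AE)
  then have "AE x in uniform_measure lebesgue Q. g x \<le> esssup (uniform_measure lebesgue Q') g"
    unfolding AE_uniform_cube[OF Q(1)] AE_uniform_cube[OF Q(2)] using Q(3) by (auto elim!: eventually_mono)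
  then have "cube_norm Q 0 g \<le> cube_norm Q' 0 g"
    by (auto simp: rnorm_def intro!: esssup_I)
  \<comment> \<open>\<open>epowr x 0\<close> is 1 except at 0 and infinity, so the volumes have to
    be positive and finite.\<close>
  moreover have "epowr (emeasure lebesgue Q' / emeasure lebesgue Q) 0 = 1"
    using cubes_measure[OF Q(1)] cubes_measure[OF Q(2)]
    by (auto simp: epowr_def enn2real_eq_0_iff ennreal_divide_eq_0_iff ennreal_divide_eq_top_iff simp del: emeasure_completion)
  ultimately show ?thesis using True by simp
next
  case False
  with a have a: "0 < a" by simp
  let ?q = "emeasure lebesgue Q" and ?q' = "emeasure lebesgue Q'"
  have "(\<integral>\<^sup>+x\<in>Q. epowr (g x) (1 / a) \<partial>lebesgue) / ?q \<le> (\<integral>\<^sup>+x\<in>Q'. epowr (g x) (1 / a) \<partial>lebesgue) / ?q"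
    using Q(3) by (intro divide_right_mono_ennreal nn_integral_mono) (auto split: split_indicator)
  also have "\<dots> = ?q' / ?q * ((\<integral>\<^sup>+x\<in>Q'. epowr (g x) (1 / a) \<partial>lebesgue) / ?q')"
  proof -
    have "?q' * inverse ?q' = 1"
      using cubes_measure[OF Q(2)] by (intro ennreal_inverse_mult_cancel)
    then show ?thesis
      by (simp only: divide_ennreal_def mult.commute[of ?q'] mult.assoc mult.left_commute[of ?q'])
        (simp add: mult.left_commute mult.commute)
  qed
  finally show ?thesis
    using Q g a by (simp only: cube_norm_eq epowr_mult[symmetric]) (intro epowr_mono, auto)
qed

text \<open>R stands for 3^n, the volume ratio of a triple cube and its cube; the outer R is the
  growth of the volume, the power is the growth of the average of u^(1/b).\<close>

definition pair_doubling :: "real \<Rightarrow> real \<Rightarrow> real \<Rightarrow> real \<Rightarrow> real \<Rightarrow> real" where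
  "pair_doubling R b b' N C = R * (R powr (b' + N) * C) powr (1 / b)"

text \<open>u and v are the two functions affected by the change, b and b' their indices, and G Q is
  the product of the kept averages, which changes by at most a power N of the volume ratio. With
  Hoelder's inequality, \<open>lower\<close> and \<open>upper\<close> make the average of u v
  comparable with 1/G Q.\<close>

locale exponent_pair =
  fixes u v :: "real ^ 'n \<Rightarrow> real" and G :: "(real ^ 'n) set \<Rightarrow> ennreal" and b b' N C :: real
  assumes u_meas [measurable]: "u \<in> borel_measurable lebesgue"
    and v_meas [measurable]: "v \<in> borel_measurable lebesgue"
    and u_pos: "0 < u x" and v_pos: "0 < v x"
    and b_pos: "0 < b" and b'_pos: "0 < b'" and N_nonneg: "0 \<le> N" and C_pos: "0 < C"
    and lower: "Q \<in> cubes \<Longrightarrow> 1 \<le> weight_norm Q (b + b') (\<lambda>x. u x * v x) * G Q"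
    and rest_mono: "Q \<in> cubes \<Longrightarrow> Q' \<in> cubes \<Longrightarrow> Q \<subseteq> Q' \<Longrightarrow>
      G Q \<le> epowr (emeasure lebesgue Q' / emeasure lebesgue Q) N * G Q'"
    and upper: "Q \<in> cubes \<Longrightarrow>
      weight_norm Q b u * weight_norm Q b' v * G Q \<le> ennreal C"
begin

text \<open>The symmetry in (u, b) and (v, b') lets one construction serve both an increase and a
  decrease of the exponent.\<close>

lemma swap: "exponent_pair v u G b' b N C"
proof (unfold_locales, goal_cases)
  case (9 Q)
  then show ?case using lower[of Q] by (simp only: add.commute mult.commute[of "v _"])
next
  case (11 Q)
  then show ?case using upper[of Q] by (simp only: mult.commute[of "cube_norm Q b' _"])
qed (use u_pos v_pos b_pos b'_pos N_nonneg C_pos rest_mono in auto)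

abbreviation s where "s x \<equiv> u x powr (1 / b)"
abbreviation \<tau> where "\<tau> x \<equiv> v x powr (1 / b')"

lemma cube_norm_real:
  assumes Q: "Q \<in> cubes" and [measurable]: "g \<in> borel_measurable lebesgue" and g: "\<And>x. 0 < g x" and a: "0 < a"
  shows "weight_norm Q a g
    = epowr (emeasure (weighted (\<lambda>x. g x powr (1 / a))) Q / emeasure lebesgue Q) a"
proof -
  note [measurable] = cubes_measure(1)[OF Q]
  show ?thesis using Q g a
    by (subst cube_norm_eq) (auto simp: emeasure_density less_imp_le simp del: emeasure_completion)
qed

lemma emeasure_weight:
  assumes Q: "Q \<in> cubes" and "g \<in> borel_measurable lebesgue" "\<And>x. 0 < g x" "0 < a"
  shows "emeasure (weighted (\<lambda>x. g x powr (1 / a))) Q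
    = emeasure lebesgue Q * epowr (weight_norm Q a g) (1 / a)"
proof -
  have "e * (w / e) = w" if "e \<noteq> 0" "e \<noteq> top" for e w :: ennreal
    using ennreal_inverse_mult_cancel[OF that] by (simp add: divide_ennreal_def mult.left_commute[of e])
  from this[OF cubes_measure(2,3)[OF Q]] show ?thesis
    using assms by (subst cube_norm_real) auto
qed

text \<open>The two-sided bounds force all four quantities to be positive and finite, so the later
  estimates are computations with real numbers.\<close>

lemma norms:
  assumes Q: "Q \<in> cubes"
  obtains x y z g where
    "weight_norm Q b u = ennreal x" "0 < x"
    "weight_norm Q b' v = ennreal y" "0 < y"
    "weight_norm Q (b + b') (\<lambda>x. u x * v x) = ennreal z" "0 < z"
    "G Q = ennreal g" "0 < g" "1 \<le> z * g" "z \<le> x * y" "x * y * g \<le> C"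
proof -
  let ?X = "weight_norm Q b u" and ?Y = "weight_norm Q b' v"
    and ?Z = "weight_norm Q (b + b') (\<lambda>x. u x * v x)"
  have nz: "?X \<noteq> 0" "?Y \<noteq> 0" "?Z \<noteq> 0"
    by (rule cube_norm_nonzero[OF Q]; simp add: u_pos v_pos)+
  have "G Q \<noteq> 0" using lower[OF Q] by auto
  have "?X * ?Y * G Q \<noteq> top" using upper[OF Q] by (auto simp: top_unique)
  then have nt: "?X \<noteq> top" "?Y \<noteq> top" "G Q \<noteq> top"
    using nz \<open>G Q \<noteq> 0\<close> by (auto simp: ennreal_mult_eq_top_iff)
  have ZXY: "?Z \<le> ?X * ?Y"
    using b_pos b'_pos u_pos v_pos rnorm_Holder[of "\<lambda>x. ennreal (u x)" "uniform_measure lebesgue Q" "\<lambda>x. ennreal (v x)" b b']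
    by (simp add: ennreal_mult less_imp_le)
  then have "?Z \<noteq> top" using nt by (auto simp: top_unique ennreal_mult_eq_top_iff)
  then obtain x y z g where *: "?X = ennreal x" "?Y = ennreal y" "?Z = ennreal z" "G Q = ennreal g"
    "0 \<le> x" "0 \<le> y" "0 \<le> z" "0 \<le> g"
    using nt by (cases ?X; cases ?Y; cases ?Z; cases "G Q") auto
  then have "0 < x" "0 < y" "0 < z" "0 < g" using nz \<open>G Q \<noteq> 0\<close> by (auto simp: less_le)
  moreover have "1 \<le> z * g" "z \<le> x * y" "x * y * g \<le> C"
    using lower[OF Q] ZXY upper[OF Q] C_pos calculation unfolding *
    by (auto simp: ennreal_mult[symmetric] less_imp_le)
  ultimately show thesis using * that by blast
qed

text \<open>On the small cube 1 \<le> x y g. Replacing y and g by their values on the triple costs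
  powers of R, and there x' y' g' \<le> C. Hence x' \<le> x R^(b'+N) C, and the powers 1/b of x and
  x' are the averages of s.\<close>

lemma doubling_u: "doubling_measure (weighted s) (pair_doubling (3 ^ CARD('n)) b b' N C)"
proof
  show "sets (weighted s) = sets lebesgue" by simp
  fix Q :: "(real ^ 'n) set" assume Q: "Q \<in> cubes"
  obtain x where "weight_norm Q b u = ennreal x" "0 < x" using norms[OF Q] .
  then show "emeasure (weighted s) Q \<noteq> 0" "emeasure (weighted s) Q \<noteq> top"
    using emeasure_weight[OF Q u_meas u_pos b_pos] cubes_measure[OF Q] by (auto simp: ennreal_mult_eq_top_iff simp del: emeasure_completion)
next
  fix h :: real and a :: "real ^ 'n" assume h: "0 < h"
  define R :: real where "R = 3 ^ CARD('n)"
  have R: "0 < R" by (simp add: R_def)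
  let ?Q = "cube a h" and ?Q' = "triple_cube a h"
  have Q: "?Q \<in> cubes" "?Q' \<in> cubes" using h by (intro cubesI; simp)+
  have sub: "?Q \<subseteq> ?Q'"
    using cubes_meeting_subset_triple[of a h a h] h by (auto simp: mem_box_cart)
  have leb: "emeasure lebesgue ?Q' = ennreal (R * h ^ CARD('n))" "emeasure lebesgue ?Q = ennreal (h ^ CARD('n))"
    using emeasure_cube[of "3 * h" "\<chi> i. a $ i - h"] emeasure_cube[of h a] h
    by (simp_all only: R_def power_mult_distrib)
  have ratio: "emeasure lebesgue ?Q' / emeasure lebesgue ?Q = ennreal R"
    unfolding leb using h R by (subst divide_ennreal) auto
  obtain x y z g where q: "weight_norm ?Q b u = ennreal x" "0 < x"
    "weight_norm ?Q b' v = ennreal y" "0 < y"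
    "weight_norm ?Q (b + b') (\<lambda>x. u x * v x) = ennreal z" "0 < z"
    "G ?Q = ennreal g" "0 < g" "1 \<le> z * g" "z \<le> x * y" "x * y * g \<le> C"
    using norms[OF Q(1)] .
  obtain x' y' z' g' where q': "weight_norm ?Q' b u = ennreal x'" "0 < x'"
    "weight_norm ?Q' b' v = ennreal y'" "0 < y'"
    "weight_norm ?Q' (b + b') (\<lambda>x. u x * v x) = ennreal z'" "0 < z'"
    "G ?Q' = ennreal g'" "0 < g'" "1 \<le> z' * g'" "z' \<le> x' * y'" "x' * y' * g' \<le> C"
    using norms[OF Q(2)] .
  have y: "y \<le> R powr b' * y'"
    using cube_norm_subset[OF Q sub, of "\<lambda>x. ennreal (v x)" b'] b'_pos q q' R unfolding ratio
    by (simp add: ennreal_mult[symmetric])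
  have g: "g \<le> R powr N * g'"
    using rest_mono[OF Q sub] q q' R unfolding ratio by (simp add: ennreal_mult[symmetric])
  have "1 \<le> z * g" by fact
  also have "z * g \<le> (x * y) * g" using q by (intro mult_right_mono) auto
  also have "\<dots> = x * (y * g)" by simp
  also have "\<dots> \<le> x * ((R powr b' * y') * (R powr N * g'))"
    using q q' y g by (intro mult_left_mono mult_mono) auto
  also have "\<dots> = x * R powr (b' + N) * (y' * g')" by (simp add: powr_add)
  finally have "x' * 1 \<le> x' * (x * R powr (b' + N) * (y' * g'))"
    using q' by (intro mult_left_mono) auto
  also have "\<dots> = x * R powr (b' + N) * (x' * y' * g')" by simp
  also have "\<dots> \<le> x * R powr (b' + N) * C" using q q' by (intro mult_left_mono) auto
  finally have "x' \<le> x * (R powr (b' + N) * C)" by simp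
  then have "x' powr (1 / b) \<le> (x * (R powr (b' + N) * C)) powr (1 / b)"
    using q' b_pos by (intro powr_mono2) auto
  also have "\<dots> = x powr (1 / b) * (R powr (b' + N) * C) powr (1 / b)"
    using q R C_pos by (simp add: powr_mult)
  finally have main: "x' powr (1 / b) \<le> x powr (1 / b) * (R powr (b' + N) * C) powr (1 / b)" .
  have "emeasure (weighted s) ?Q' = ennreal (R * h ^ CARD('n) * x' powr (1 / b))"
    unfolding emeasure_weight[OF Q(2) u_meas u_pos b_pos] leb q' using q' h R by (simp add: ennreal_mult)
  also have "\<dots> \<le> ennreal (R * h ^ CARD('n) * (x powr (1 / b) * (R powr (b' + N) * C) powr (1 / b)))"
    using h R by (intro ennreal_leI mult_left_mono main) auto
  also have "\<dots> = ennreal (pair_doubling R b b' N C) * ennreal (h ^ CARD('n) * x powr (1 / b))"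
    using h R by (simp add: ennreal_mult[symmetric] pair_doubling_def ac_simps)
  also have "ennreal (h ^ CARD('n) * x powr (1 / b)) = emeasure (weighted s) ?Q"
    unfolding emeasure_weight[OF Q(1) u_meas u_pos b_pos] leb q using q h by (simp add: ennreal_mult)
  finally show "emeasure (weighted s) ?Q' \<le> ennreal (pair_doubling (3 ^ CARD('n)) b b' N C) * emeasure (weighted s) ?Q"
    by (simp only: R_def)
qed (simp add: pair_doubling_def)

end

definition pair_max :: "real \<Rightarrow> real \<Rightarrow> real \<Rightarrow> real \<Rightarrow> real \<Rightarrow> real" where
  "pair_max R b b' N C = max (pair_doubling R b b' N C) (pair_doubling R b' b N C)"

lemma doubling_measure_mono:
  fixes \<nu> :: "(real ^ 'n) measure"
  assumes "doubling_measure \<nu> D" "D \<le> D'"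
  shows "doubling_measure \<nu> D'"
proof -
  interpret doubling_measure \<nu> D by fact
  show ?thesis
  proof
    fix h :: real and a :: "real ^ 'n" assume "0 < h"
    have "emeasure \<nu> (triple_cube a h) \<le> ennreal D * emeasure \<nu> (cube a h)"
      by (rule doubling) fact
    also have "\<dots> \<le> ennreal D' * emeasure \<nu> (cube a h)"
      using assms(2) by (intro mult_right_mono ennreal_leI) auto
    finally show "emeasure \<nu> (triple_cube a h) \<le> ennreal D' * emeasure \<nu> (cube a h)" .
  qed (use cube_pos cube_finite D_nonneg assms(2) in auto)
qed

context exponent_pair
begin

lemma mu_eq: "s x powr (b / (b + b')) * \<tau> x powr (1 - b / (b + b')) = (u x * v x) powr (1 / (b + b'))"
proof -
  have "1 - b / (b + b') = b' / (b + b')" using b_pos b'_pos by (simp add: field_simps)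
  then show ?thesis
    using b_pos b'_pos u_pos[of x] v_pos[of x] by (simp add: powr_powr powr_mult)
qed

text \<open>From x y g \<le> C \<le> C z g follows x y \<le> C z, a reversed Hoelder inequality on
  Q. Its power 1/(b + b'), multiplied by the volume, is the joint condition with theta = b/(b +
  b').\<close>

lemma weight_pair: "weight_pair s \<tau> (b / (b + b')) (C powr (1 / (b + b'))) (pair_max (3 ^ CARD('n)) b b' N C)"
proof (intro weight_pair.intro)
  interpret sw: exponent_pair v u G b' b N C by (rule swap)
  show "doubling_measure (weighted s) (pair_max (3 ^ CARD('n)) b b' N C)"
    "doubling_measure (weighted \<tau>) (pair_max (3 ^ CARD('n)) b b' N C)"
    using doubling_u sw.doubling_u by (auto simp: pair_max_def intro: doubling_measure_mono)
  fix Q :: "(real ^ 'n) set" assume Q: "Q \<in> cubes"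
  define c where "c = b + b'"
  have c: "0 < c" "b / c < 1" "1 - b / c = b' / c" using b_pos b'_pos by (auto simp: c_def field_simps)
  obtain x y z g where q: "weight_norm Q b u = ennreal x" "0 < x"
    "weight_norm Q b' v = ennreal y" "0 < y"
    "weight_norm Q c (\<lambda>x. u x * v x) = ennreal z" "0 < z"
    "G Q = ennreal g" "0 < g" "1 \<le> z * g" "z \<le> x * y" "x * y * g \<le> C"
    using norms[OF Q] unfolding c_def .
  obtain e where e: "emeasure lebesgue Q = ennreal e" "0 < e"
    using cubes_measure[OF Q] by (cases "emeasure lebesgue Q") (auto simp: less_le)
  have "x * y * g \<le> C * z * g"
    using q(9,11) C_pos mult_left_mono[of 1 "z * g" C] unfolding mult.assoc[of C] by linarith
  then have "x * y \<le> C * z" using mult_right_le_imp_le[of "x * y" g "C * z"] q by blast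
  then have "(x * y) powr (1 / c) \<le> (C * z) powr (1 / c)"
    using q c by (intro powr_mono2) auto
  then have xy: "x powr (1 / c) * y powr (1 / c) \<le> C powr (1 / c) * z powr (1 / c)"
    using q C_pos by (simp add: powr_mult)
  have mu: "emeasure (weighted (\<lambda>x. s x powr (b / c) * \<tau> x powr (1 - b / c))) Q
      = ennreal (e * z powr (1 / c))"
    unfolding mu_eq[folded c_def] using Q u_pos v_pos c q(6) e
    by (subst emeasure_weight) (auto simp: q(5) ennreal_mult)
  have "epowr (emeasure (weighted s) Q) (b / c) * epowr (emeasure (weighted \<tau>) Q) (1 - b / c)
      = ennreal ((e * x powr (1 / b)) powr (b / c) * (e * y powr (1 / b')) powr (b' / c))"
    unfolding emeasure_weight[OF Q u_meas u_pos b_pos] emeasure_weight[OF Q v_meas v_pos b'_pos] c(3) q e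
    using q e by (simp add: ennreal_mult[symmetric])
  also have "(e * x powr (1 / b)) powr (b / c) * (e * y powr (1 / b')) powr (b' / c)
      = (e powr (b / c) * e powr (b' / c)) * (x powr (1 / c) * y powr (1 / c))"
    using q e b_pos b'_pos by (simp add: powr_mult powr_powr)
  also have "e powr (b / c) * e powr (b' / c) = e"
    using e c by (simp add: powr_add[symmetric] add_divide_distrib[symmetric] c_def)
  also have "ennreal (e * (x powr (1 / c) * y powr (1 / c))) \<le> ennreal (e * (C powr (1 / c) * z powr (1 / c)))"
    using xy e by (intro ennreal_leI mult_left_mono) auto
  also have "\<dots> = ennreal (C powr (1 / c)) * emeasure (weighted (\<lambda>x. s x powr (b / c) * \<tau> x powr (1 - b / c))) Q"
    unfolding mu using e by (simp add: ennreal_mult[symmetric] mult.left_commute)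
  finally show "epowr (emeasure (weighted s) Q) (b / (b + b')) * epowr (emeasure (weighted \<tau>) Q) (1 - b / (b + b'))
      \<le> ennreal (C powr (1 / (b + b'))) * emeasure (weighted (\<lambda>x. s x powr (b / (b + b')) * \<tau> x powr (1 - b / (b + b')))) Q"
    by (simp only: c_def)
qed (use b_pos b'_pos C_pos u_pos v_pos in \<open>auto simp: less_imp_neq[symmetric]\<close>)

end

text \<open>The A_1 constant 2 \<open>rdf_const\<close> enters with the power (b + b') t/b that beta
  has in H.\<close>

definition pair_const :: "real \<Rightarrow> real \<Rightarrow> real \<Rightarrow> real \<Rightarrow> real \<Rightarrow> real \<Rightarrow> real" where
  "pair_const R b b' N C t =
    (2 * weight_pair.rdf_const (b / (b + b')) (C powr (1 / (b + b'))) (pair_max R b b' N C)) powr ((b + b') * t / b) * C"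

context exponent_pair
begin

text \<open>With k = c t/b, j = 1 - t/b and H = beta^k u^(t/b) one has u/H = beta^(-k) u^j and v H =
  (beta (u v)^(1/c))^k v^j. The A_1 bound controls the negative power of beta by the average of beta
  over mu, and this average cancels against the one in the norm of v H.\<close>

theorem rubio_de_francia_pair:
  fixes H\<^sub>0 :: "real ^ 'n \<Rightarrow> real"
  assumes t: "0 < t" "t \<le> b"
    and [measurable]: "H\<^sub>0 \<in> borel_measurable lebesgue" and H0: "\<And>x. 0 \<le> H\<^sub>0 x"
    and norm_H0: "rnorm lebesgue t (\<lambda>x. ennreal (H\<^sub>0 x)) \<noteq> 0" "rnorm lebesgue t (\<lambda>x. ennreal (H\<^sub>0 x)) \<noteq> top"
  obtains H where "H \<in> borel_measurable lebesgue" "\<And>x. 0 < H x" "AE x in lebesgue. H\<^sub>0 x \<le> H x"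
    "rnorm lebesgue t (\<lambda>x. ennreal (H x)) \<le> ennreal (2 powr ((b + b') * t / b)) * rnorm lebesgue t (\<lambda>x. ennreal (H\<^sub>0 x))"
    "\<And>Q. Q \<in> cubes \<Longrightarrow> weight_norm Q (b - t) (\<lambda>x. u x / H x) *
      weight_norm Q (b' + t) (\<lambda>x. v x * H x) * G Q \<le> ennreal (pair_const (3 ^ CARD('n)) b b' N C t)"
proof -
  define c where "c = b + b'"
  have c: "0 < c" "b < c" using b_pos b'_pos by (auto simp: c_def)
  define B where "B = 2 * weight_pair.rdf_const (b / c) (C powr (1 / c)) (pair_max (3 ^ CARD('n)) b b' N C)"
  interpret W: weight_pair s \<tau> "b / c" "C powr (1 / c)" "pair_max (3 ^ CARD('n)) b b' N C"
    unfolding c_def by (rule weight_pair)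
  have B: "0 < B" using W.rdf_const_pos by (simp add: B_def)
  have mu: "W.mu x = (u x * v x) powr (1 / c)" for x
    using mu_eq by (simp only: c_def)
  \<comment> \<open>Chosen so that alpha_0^k u^(t/b) = H_0; its power integral against s is then the
    integral of H_0^(1/t).\<close>
  define \<alpha>\<^sub>0 where "\<alpha>\<^sub>0 x = ennreal ((H\<^sub>0 x * u x powr (- t / b)) powr (b / (c * t)))" for x
  have [measurable]: "\<alpha>\<^sub>0 \<in> borel_measurable lebesgue" unfolding \<alpha>\<^sub>0_def by measurable
  have s_cancel: "s x * u x powr (- 1 / b) = 1" for x
    using u_pos[of x] by (simp add: powr_add[symmetric] add_divide_distrib[symmetric])
  have "(\<integral>\<^sup>+x. epowr (\<alpha>\<^sub>0 x) (1 / (b / c)) \<partial>weighted s) = (\<integral>\<^sup>+x. epowr (ennreal (H\<^sub>0 x)) (1 / t) \<partial>lebesgue)"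
  proof -
    have "ennreal (s x) * epowr (\<alpha>\<^sub>0 x) (1 / (b / c)) = epowr (ennreal (H\<^sub>0 x)) (1 / t)" for x
    proof -
      have "((H\<^sub>0 x * u x powr (- t / b)) powr (b / (c * t))) powr (1 / (b / c)) = H\<^sub>0 x powr (1 / t) * u x powr (- 1 / b)"
        using t b_pos c H0[of x] by (simp add: powr_powr powr_mult)
      then have "s x * ((H\<^sub>0 x * u x powr (- t / b)) powr (b / (c * t))) powr (1 / (b / c)) = H\<^sub>0 x powr (1 / t)"
        using s_cancel[of x] by (simp add: mult.left_commute)
      then show ?thesis using H0[of x] by (simp add: \<alpha>\<^sub>0_def ennreal_mult[symmetric])
    qed
    then show ?thesis by (subst nn_integral_weighted) auto
  qed
  also have "\<dots> = epowr (rnorm lebesgue t (\<lambda>x. ennreal (H\<^sub>0 x))) (1 / t)"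
    using t by (simp add: rnorm_def)
  finally have I: "(\<integral>\<^sup>+x. epowr (\<alpha>\<^sub>0 x) (1 / (b / c)) \<partial>weighted s)
    = epowr (rnorm lebesgue t (\<lambda>x. ennreal (H\<^sub>0 x))) (1 / t)" .
  obtain \<beta> where [measurable]: "\<beta> \<in> borel_measurable lebesgue" and \<beta>: "\<And>x. 0 < \<beta> x"
    "AE x in lebesgue. \<alpha>\<^sub>0 x \<le> ennreal (\<beta> x)"
    "(\<integral>\<^sup>+x. epowr (ennreal (\<beta> x)) (1 / (b / c)) \<partial>weighted s)
      \<le> ennreal (2 powr (1 / (b / c))) * epowr (rnorm lebesgue t (\<lambda>x. ennreal (H\<^sub>0 x))) (1 / t)"
    "\<And>Q. Q \<in> cubes \<Longrightarrow> AE x in lebesgue. x \<in> Q \<longrightarrow>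
      average (weighted W.mu) Q (\<lambda>y. ennreal (\<beta> y))
      \<le> ennreal (B * \<beta> x)"
    using W.rubio_de_francia[of \<alpha>\<^sub>0] norm_H0 unfolding I B_def by (auto simp: mult.assoc)
  define k where "k = c * t / b"
  have k: "0 < k" using c t b_pos by (simp add: k_def)
  \<comment> \<open>The power of u that remains after u^(t/b) has been taken out; it is 0 in the
    endpoint case t = b.\<close>
  define j where "j = (b - t) / b"
  have j: "0 \<le> j" "j + t / b = 1" using t b_pos by (auto simp: j_def field_simps)
  define H where "H x = \<beta> x powr k * u x powr (t / b)" for x
  have [measurable]: "H \<in> borel_measurable lebesgue" unfolding H_def by measurable
  have H_pos: "0 < H x" for x using \<beta>(1)[of x] u_pos[of x] by (simp add: H_def less_imp_neq[symmetric])
  show thesis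
  proof (rule that)
    show "H \<in> borel_measurable lebesgue" by measurable
    show "0 < H x" for x by (rule H_pos)
    show "AE x in lebesgue. H\<^sub>0 x \<le> H x"
      using \<beta>(2)
    proof eventually_elim
      case (elim x)
      then have "((H\<^sub>0 x * u x powr (- t / b)) powr (b / (c * t))) powr k \<le> \<beta> x powr k"
        using \<beta>(1)[of x] k by (intro powr_mono2) (auto simp: \<alpha>\<^sub>0_def)
      also have "((H\<^sub>0 x * u x powr (- t / b)) powr (b / (c * t))) powr k = H\<^sub>0 x * u x powr (- t / b)"
        using c t b_pos H0[of x] by (simp add: powr_powr k_def)
      finally have "H\<^sub>0 x * u x powr (- t / b) * u x powr (t / b) \<le> H x"
        unfolding H_def by (intro mult_right_mono) auto
      moreover have "u x powr (- t / b) * u x powr (t / b) = 1"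
        using u_pos[of x] by (simp add: powr_add[symmetric])
      ultimately show ?case by (simp add: mult.assoc)
    qed
    have "(\<integral>\<^sup>+x. epowr (ennreal (H x)) (1 / t) \<partial>lebesgue) = (\<integral>\<^sup>+x. epowr (ennreal (\<beta> x)) (1 / (b / c)) \<partial>weighted s)"
    proof -
      have "H x powr (1 / t) = s x * \<beta> x powr (c / b)" for x
        using t b_pos by (simp add: H_def powr_mult powr_powr k_def mult.commute)
      then show ?thesis
        using H_pos \<beta>(1)
        by (subst nn_integral_weighted) (auto simp: less_imp_le ennreal_mult)
    qed
    then have "rnorm lebesgue t (\<lambda>x. ennreal (H x))
      \<le> epowr (ennreal (2 powr (1 / (b / c))) * epowr (rnorm lebesgue t (\<lambda>x. ennreal (H\<^sub>0 x))) (1 / t)) t"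
      using \<beta>(3) t by (simp add: rnorm_def epowr_mono)
    also have "\<dots> = ennreal (2 powr ((b + b') * t / b)) * rnorm lebesgue t (\<lambda>x. ennreal (H\<^sub>0 x))"
      using t by (simp add: epowr_mult powr_powr c_def)
    finally show "rnorm lebesgue t (\<lambda>x. ennreal (H x)) \<le> \<dots>" .
    fix Q :: "(real ^ 'n) set" assume Q: "Q \<in> cubes"
    note [measurable] = cubes_measure(1)[OF Q]
    obtain x y z g where q: "weight_norm Q b u = ennreal x" "0 < x"
      "weight_norm Q b' v = ennreal y" "0 < y"
      "weight_norm Q c (\<lambda>x. u x * v x) = ennreal z" "0 < z"
      "G Q = ennreal g" "0 < g" "1 \<le> z * g" "z \<le> x * y" "x * y * g \<le> C"
      using norms[OF Q] unfolding c_def .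
    obtain e where e: "emeasure lebesgue Q = ennreal e" "0 < e"
      using cubes_measure[OF Q] by (cases "emeasure lebesgue Q") (auto simp: less_le)
    have muQ: "emeasure (weighted W.mu) Q = ennreal (e * z powr (1 / c))"
      unfolding mu using Q u_pos v_pos c q(6) e
      by (subst emeasure_weight) (auto simp: q(5) ennreal_mult)
    let ?A = "average (weighted W.mu) Q (\<lambda>y. ennreal (\<beta> y))"
    have ae: "AE x in uniform_measure lebesgue Q. ?A \<le> ennreal (B * \<beta> x)"
      unfolding AE_uniform_cube[OF Q] by (rule \<beta>(4)[OF Q])
    have intA: "(\<integral>\<^sup>+y\<in>Q. ennreal (\<beta> y) \<partial>weighted W.mu) = emeasure lebesgue Q *
        weight_norm Q 1 (\<lambda>x. \<beta> x * W.mu x)"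
    proof -
      have "(\<integral>\<^sup>+y\<in>Q. ennreal (\<beta> y) \<partial>weighted W.mu) = (\<integral>\<^sup>+y\<in>Q. ennreal (\<beta> y * W.mu y) \<partial>lebesgue)"
        using \<beta>(1) by (subst nn_integral_weighted) (auto simp: ennreal_mult less_imp_le ac_simps)
      moreover have "ennreal e * (w / ennreal e) = w" for w
        using ennreal_inverse_mult_cancel[of "ennreal e"] e
        by (simp add: divide_ennreal_def mult.left_commute[of "ennreal e"])
      ultimately show ?thesis using Q by (subst cube_norm_eq) (auto simp: e)
    qed
    \<comment> \<open>The average is at most the real number B beta(x) for almost every x in Q, and
      Q has positive measure.\<close>
    have "?A \<noteq> top"
    proof
      assume "?A = top"
      then have "AE x in uniform_measure lebesgue Q. False" using ae by (simp add: top_unique)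
      then show False using not_AE_False_uniform_cube[OF Q] by simp
    qed
    moreover have "?A \<noteq> 0"
    proof -
      have "weight_norm Q 1 (\<lambda>x. \<beta> x * W.mu x) \<noteq> 0"
        by (rule cube_norm_nonzero[OF Q]) (use \<beta>(1) W.mu_pos in auto)
      then show ?thesis unfolding intA muQ e using e q
        by (simp add: ennreal_divide_eq_0_iff)
    qed
    ultimately obtain A where A: "?A = ennreal A" "0 < A" by (cases ?A) (auto simp: less_le)
    have normA: "weight_norm Q 1 (\<lambda>x. \<beta> x * W.mu x) = ennreal (A * z powr (1 / c))"
    proof -
      let ?n = "weight_norm Q 1 (\<lambda>x. \<beta> x * W.mu x)"
      have "ennreal e * ?n / ennreal (e * z powr (1 / c)) = ennreal A"
        using A(1) unfolding intA muQ e .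
      moreover from this have "?n \<noteq> top" using e q by (auto simp: ennreal_mult_top ennreal_top_divide)
      then obtain n where n: "?n = ennreal n" "0 \<le> n" by (cases ?n) auto
      ultimately have "ennreal (e * n / (e * z powr (1 / c))) = ennreal A"
        using e q by (simp add: ennreal_mult[symmetric] divide_ennreal)
      then have "n / z powr (1 / c) = A" using e q n A by (simp add: ennreal_inj)
      then show ?thesis using n q by (simp add: field_simps)
    qed
    \<comment> \<open>For j = 0 the norm is the essential supremum of the constant 1.\<close>
    have powr_case: "weight_norm Q (a * j) (\<lambda>x. f x powr j) = ennreal (w powr j)"
      if "weight_norm Q a f = ennreal w" "0 < w" "\<And>x. 0 < f x" "0 < a" for a f w
    proof (cases "j = 0")
      case True
      then show ?thesis using that emeasure_uniform_cube[OF Q]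
        by (simp add: rnorm_1_le less_imp_neq[symmetric])
    next
      case False
      then show ?thesis using that j rnorm_epowr[of a j "uniform_measure lebesgue Q" "\<lambda>x. ennreal (f x)"]
        by (simp add: less_imp_le)
    qed
    have bound_u: "weight_norm Q (b - t) (\<lambda>x. u x / H x) \<le> ennreal ((B / A) powr k * x powr j)"
    proof -
      have "AE x in uniform_measure lebesgue Q. ennreal (u x / H x) \<le> ennreal ((B / A) powr k) * ennreal (u x powr j)"
        using ae
      proof eventually_elim
        case (elim x)
        then have "A \<le> B * \<beta> x" unfolding A(1) using B \<beta>(1)[of x] by simp
        then have "1 / \<beta> x \<le> B / A" using A \<beta>(1)[of x] by (simp add: field_simps)
        then have "(1 / \<beta> x) powr k \<le> (B / A) powr k" using k \<beta>(1)[of x] by (intro powr_mono2) auto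
        moreover have "u x / H x = (1 / \<beta> x) powr k * u x powr j"
        proof -
          have "u x = u x powr j * u x powr (t / b)" using u_pos[of x] j by (simp add: powr_add[symmetric])
          then have "u x / u x powr (t / b) = u x powr j"
            using u_pos[of x] by (simp add: field_simps)
          then show ?thesis using \<beta>(1)[of x] by (simp add: H_def powr_divide field_simps)
        qed
        ultimately show ?case
          by (auto simp: ennreal_mult[symmetric] intro!: ennreal_leI mult_right_mono)
      qed
      then have "weight_norm Q (b - t) (\<lambda>x. u x / H x)
          \<le> cube_norm Q (b - t) (\<lambda>x. ennreal ((B / A) powr k) * ennreal (u x powr j))"
        using t by (intro rnorm_mono_AE) auto
      also have "\<dots> = ennreal ((B / A) powr k) * weight_norm Q (b - t) (\<lambda>x. u x powr j)"
        using t by (intro rnorm_cmult) auto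
      also have "weight_norm Q (b - t) (\<lambda>x. u x powr j) = ennreal (x powr j)"
        using powr_case[of b u x] q u_pos b_pos by (simp add: j_def)
      finally show ?thesis by (simp add: ennreal_mult)
    qed
    have bound_v: "weight_norm Q (b' + t) (\<lambda>x. v x * H x) \<le> ennreal ((A * z powr (1 / c)) powr k * y powr j)"
    proof -
      have "b' + t = k + b' * j" using b_pos by (simp add: k_def j_def c_def field_simps)
      moreover have "v x * H x = (\<beta> x * W.mu x) powr k * v x powr j" for x
      proof -
        have "((u x * v x) powr (1 / c)) powr k = u x powr (t / b) * v x powr (t / b)"
          using c u_pos[of x] v_pos[of x] by (simp add: powr_powr powr_mult k_def)
        moreover have "v x powr (t / b) * v x powr j = v x"
          using v_pos[of x] j by (simp add: powr_add[symmetric] add.commute)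
        ultimately show ?thesis
          using \<beta>(1)[of x] unfolding mu H_def
          by (simp add: powr_mult mult.assoc)
      qed
      ultimately have "weight_norm Q (b' + t) (\<lambda>x. v x * H x)
          = cube_norm Q (k + b' * j) (\<lambda>x. ennreal ((\<beta> x * W.mu x) powr k) * ennreal (v x powr j))"
        by (simp add: ennreal_mult)
      also have "\<dots> \<le> weight_norm Q k (\<lambda>x. (\<beta> x * W.mu x) powr k) * weight_norm Q (b' * j) (\<lambda>x. v x powr j)"
        using k j b'_pos by (intro rnorm_Holder) auto
      also have "weight_norm Q (b' * j) (\<lambda>x. v x powr j) = ennreal (y powr j)"
        using powr_case[of b' v y] q v_pos b'_pos by simp
      also have "weight_norm Q k (\<lambda>x. (\<beta> x * W.mu x) powr k) = ennreal ((A * z powr (1 / c)) powr k)"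
        using rnorm_epowr[of 1 k "uniform_measure lebesgue Q" "\<lambda>x. ennreal (\<beta> x * W.mu x)"] k normA \<beta>(1) A
        by (simp add: less_imp_le)
      finally show ?thesis by (simp add: ennreal_mult)
    qed
    have "weight_norm Q (b - t) (\<lambda>x. u x / H x) * weight_norm Q (b' + t) (\<lambda>x. v x * H x) * G Q
      \<le> ennreal ((B / A) powr k * x powr j) * ennreal ((A * z powr (1 / c)) powr k * y powr j) * ennreal g"
      unfolding q(7) by (intro mult_mono bound_u bound_v) auto
    also have "\<dots> = ennreal ((B / A) powr k * x powr j * ((A * z powr (1 / c)) powr k * y powr j) * g)"
      using q by (simp add: ennreal_mult)
    \<comment> \<open>Here the average A cancels. What is left contains z^(t/b), and z \<le> x y
      supplies the missing power of x y.\<close>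
    also have "(B / A) powr k * x powr j * ((A * z powr (1 / c)) powr k * y powr j) * g
      = B powr k * ((x * y) powr j * z powr (t / b)) * g"
      using A B q c by (simp add: powr_divide powr_mult powr_powr k_def)
    also have "\<dots> \<le> B powr k * ((x * y) powr j * (x * y) powr (t / b)) * g"
      using q t b_pos by (intro mult_right_mono mult_left_mono powr_mono2) auto
    also have "(x * y) powr j * (x * y) powr (t / b) = x * y"
      using q j by (simp add: powr_add[symmetric])
    also have "B powr k * (x * y) * g \<le> B powr k * C"
      using q by (simp add: mult.assoc mult_left_mono)
    also have "\<dots> = pair_const (3 ^ CARD('n)) b b' N C t"
      by (simp add: pair_const_def B_def k_def c_def)
    finally show "weight_norm Q (b - t) (\<lambda>x. u x / H x) *
      weight_norm Q (b' + t) (\<lambda>x. v x * H x) * G Q \<le> ennreal (pair_const (3 ^ CARD('n)) b b' N C t)"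
      by (simp add: ennreal_leI)
  qed
qed

end

section \<open>Changing one exponent\<close>

lemma epowr_sum:
  assumes "finite I" "I \<noteq> {}"
  shows "epowr x (\<Sum>i\<in>I. a i) = (\<Prod>i\<in>I. epowr x (a i))"
  using assms by (induction I rule: finite_ne_induct) (auto simp: epowr_add)

lemma prod_mono_ennreal:
  fixes f g :: "'a \<Rightarrow> ennreal"
  assumes "\<And>i. i \<in> I \<Longrightarrow> f i \<le> g i"
  shows "(\<Prod>i\<in>I. f i) \<le> (\<Prod>i\<in>I. g i)"
  using assms by (induction I rule: infinite_finite_induct) (auto intro!: mult_mono)

lemma AE_mult_pos_eq_0_iff:
  assumes "\<And>x. 0 < g x"
  shows "(AE x in M. f x * ennreal (g x) = 0) \<longleftrightarrow> (AE x in M. f x = 0)"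
proof -
  have "ennreal (g x) \<noteq> 0" for x using assms[of x] by simp
  then show ?thesis by simp
qed

definition class_product ::
  "nat \<Rightarrow> (nat \<Rightarrow> real) \<Rightarrow> real \<Rightarrow> (nat \<Rightarrow> real) \<Rightarrow> (nat \<Rightarrow> real ^ 'n \<Rightarrow> real) \<Rightarrow> (real ^ 'n) set \<Rightarrow> ennreal" where
  "class_product m d e x w Q = weight_norm Q ((\<Sum>i = 1..m. x i) - e) (\<lambda>z. \<Prod>i = 1..m. w i z) *
    (\<Prod>i = 1..m. weight_norm Q (d i - x i) (\<lambda>z. 1 / w i z))"

text \<open>Real weights that are positive at every point can be multiplied and divided by H without
  exceptional sets; the weights of \<open>weight_class\<close> are reduced to them by changes on
  null sets.\<close>

definition real_weights :: "nat \<Rightarrow> (nat \<Rightarrow> real ^ 'n \<Rightarrow> real) \<Rightarrow> bool" where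
  "real_weights m w \<longleftrightarrow> (\<forall>i\<in>{1..m}. w i \<in> borel_measurable lebesgue \<and> (\<forall>z. 0 < w i z))"

lemma real_weightsD:
  assumes "real_weights m w" "i \<in> {1..m}"
  shows "w i \<in> borel_measurable lebesgue" "0 < w i z"
  using assms by (auto simp: real_weights_def)

lemma real_weights_prod:
  assumes "real_weights m w"
  shows "(\<lambda>z. \<Prod>i = 1..m. w i z) \<in> borel_measurable lebesgue" "0 < (\<Prod>i = 1..m. w i z)"
  using real_weightsD[OF assms] by (auto intro!: borel_measurable_prod prod_pos)

text \<open>
  Exponents enter through their reciprocals: \<open>x i = 1 / p\<^sub>i\<close>, \<open>d i = 1 / r\<^sub>i\<close> and
  \<open>e = 1 - 1 / r\<^sub>m\<^sub>+\<^sub>1\<close>, so that \<open>1 / \<delta>\<^sub>i = d i - x i\<close> and \<open>1 / \<delta>\<^sub>m\<^sub>+\<^sub>1 = (\<Sum>i. x i) - e\<close>.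
\<close>

abbreviation product_bound ::
  "nat \<Rightarrow> (nat \<Rightarrow> real) \<Rightarrow> (nat \<Rightarrow> real ^ 'n \<Rightarrow> real) \<Rightarrow>
    (real ^ 'n \<Rightarrow> ennreal) \<Rightarrow> (nat \<Rightarrow> real ^ 'n \<Rightarrow> ennreal) \<Rightarrow> real \<Rightarrow> bool" where
  "product_bound m x w f fs C \<equiv>
    rnorm lebesgue (\<Sum>i = 1..m. x i) (\<lambda>z. f z * ennreal (\<Prod>i = 1..m. w i z))
    \<le> ennreal C * (\<Prod>i = 1..m. rnorm lebesgue (x i) (\<lambda>z. fs i z * ennreal (w i z)))"

text \<open>Uniformity over all weights with class constant at most K replaces the growth function.
  In this form the steps from tuple to tuple compose directly, each one replacing K by another
  number.\<close>

definition weighted_bound ::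
  "nat \<Rightarrow> (nat \<Rightarrow> real) \<Rightarrow> real \<Rightarrow> (nat \<Rightarrow> real) \<Rightarrow>
    ((real ^ 'n \<Rightarrow> ennreal) \<times> (nat \<Rightarrow> real ^ 'n \<Rightarrow> ennreal)) set \<Rightarrow> bool" where
  "weighted_bound m d e x \<F> \<longleftrightarrow> (\<forall>K. \<exists>C>0. \<forall>w. real_weights m w \<longrightarrow>
    (\<forall>Q\<in>cubes. class_product m d e x w Q \<le> ennreal K) \<longrightarrow>
    (\<forall>(f, fs)\<in>\<F>. product_bound m x w f fs C))"

lemma weighted_boundE:
  fixes \<F> :: "((real ^ 'n \<Rightarrow> ennreal) \<times> (nat \<Rightarrow> real ^ 'n \<Rightarrow> ennreal)) set"
  assumes "weighted_bound m d e x \<F>"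
  obtains C where "0 < C" "\<And>w f fs. real_weights m w \<Longrightarrow>
      (\<And>Q. Q \<in> cubes \<Longrightarrow> class_product m d e x w Q \<le> ennreal K) \<Longrightarrow> (f, fs) \<in> \<F> \<Longrightarrow>
      product_bound m x w f fs C"
proof -
  from assms[unfolded weighted_bound_def, THEN spec, of K] obtain C where C: "0 < C"
    "\<forall>w. real_weights m w \<longrightarrow> (\<forall>Q\<in>cubes. class_product m d e x w Q \<le> ennreal K) \<longrightarrow>
      (\<forall>(f, fs)\<in>\<F>. product_bound m x w f fs C)"
    by (elim exE conjE)
  show thesis
  proof (rule that[OF C(1)])
    fix w :: "nat \<Rightarrow> real ^ 'n \<Rightarrow> real" and f fs
    assume w: "real_weights m w" "\<And>Q. Q \<in> cubes \<Longrightarrow> class_product m d e x w Q \<le> ennreal K" and F: "(f, fs) \<in> \<F>"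
    have "\<forall>Q\<in>cubes. class_product m d e x w Q \<le> ennreal K" using w(2) by (rule ballI)
    from C(2)[THEN spec, THEN mp, OF w(1), THEN mp, OF this, THEN bspec, OF F]
    show "product_bound m x w f fs C"
      by simp
  qed
qed

text \<open>x is the old tuple and y the new one; they differ at most at j. The old tuple may lie on
  the boundary of the admissible region, while strictness of y at j and in the sum makes b and b'
  positive.\<close>

locale exponent_step =
  fixes m :: nat and d :: "nat \<Rightarrow> real" and e :: real and x y :: "nat \<Rightarrow> real" and j :: nat
    and \<F> :: "((real ^ 'n \<Rightarrow> ennreal) \<times> (nat \<Rightarrow> real ^ 'n \<Rightarrow> ennreal)) set"
  assumes m: "2 \<le> m"
    and meas: "\<And>f fs. (f, fs) \<in> \<F> \<Longrightarrow>
      f \<in> borel_measurable lebesgue \<and> (\<forall>i\<in>{1..m}. fs i \<in> borel_measurable lebesgue)"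
    and x: "\<And>i. i \<in> {1..m} \<Longrightarrow> 0 \<le> x i \<and> x i \<le> d i" "e \<le> (\<Sum>i = 1..m. x i)" and e: "0 \<le> e"
    and j: "j \<in> {1..m}" and y_eq: "\<And>i. i \<noteq> j \<Longrightarrow> y i = x i"
    and y: "0 \<le> y j" "y j < d j" "e < (\<Sum>i = 1..m. y i)"
begin

abbreviation others where "others \<equiv> {1..m} - {j}"
abbreviation X where "X \<equiv> \<Sum>i = 1..m. x i"
abbreviation Y where "Y \<equiv> \<Sum>i = 1..m. y i"
abbreviation rest where "rest w Q \<equiv> \<Prod>i\<in>others. weight_norm Q (d i - x i) (\<lambda>z. 1 / w i z)"
abbreviation N where "N \<equiv> \<Sum>i\<in>others. d i - x i"

lemma others: "finite others" "others \<noteq> {}"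
proof -
  have "1 \<in> others \<or> 2 \<in> others" using m by auto
  then show "others \<noteq> {}" by blast
qed simp

lemma prod_split: "(\<Prod>i = 1..m. f i) = f j * (\<Prod>i\<in>others. f i)" for f :: "nat \<Rightarrow> 'b :: comm_monoid_mult"
  using j by (intro prod.remove) auto

lemma sum_X: "X = x j + (\<Sum>i\<in>others. x i)"
  using j by (intro sum.remove) auto

lemma sum_Y: "Y = y j + (\<Sum>i\<in>others. x i)"
proof -
  have "Y = y j + (\<Sum>i\<in>others. y i)" using j by (intro sum.remove) auto
  also have "(\<Sum>i\<in>others. y i) = (\<Sum>i\<in>others. x i)" using y_eq by (intro sum.cong) auto
  finally show ?thesis .
qed

lemma class_product_y:
  "class_product m d e y w Q = weight_norm Q (Y - e) (\<lambda>z. \<Prod>i = 1..m. w i z) *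
    (weight_norm Q (d j - y j) (\<lambda>z. 1 / w j z) * rest w Q)"
  unfolding class_product_def prod_split[of "\<lambda>i. weight_norm Q (d i - y i) (\<lambda>z. 1 / w i z)"]
  using y_eq by simp

lemma class_product_update:
  "class_product m d e x (w(j := w')) Q =
    weight_norm Q (X - e) (\<lambda>z. w' z * (\<Prod>i\<in>others. w i z)) *
    (weight_norm Q (d j - x j) (\<lambda>z. 1 / w' z) * rest w Q)"
  unfolding class_product_def prod_split by simp

lemma real_weights_update:
  assumes "real_weights m w" "w' \<in> borel_measurable lebesgue" "\<And>z. 0 < w' z"
  shows "real_weights m (w(j := w'))"
  using assms by (simp add: real_weights_def)

text \<open>The lower bound is Hoelder's inequality for 1 written as the product of the w_i times
  the product of the 1/w_i over the indices other than j, with total index b + b' + N. The first of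
  these products is u v because w_j cancels.\<close>

lemma pair:
  fixes w :: "nat \<Rightarrow> real ^ 'n \<Rightarrow> real"
  assumes w: "real_weights m w" and K: "\<forall>Q\<in>cubes. class_product m d e y w Q \<le> ennreal K"
  shows "exponent_pair (\<lambda>z. 1 / w j z) (\<lambda>z. \<Prod>i = 1..m. w i z) (rest w) (d j - y j) (Y - e) N (max K 1)"
proof
  note w_meas [measurable] = real_weightsD(1)[OF w] and w_pos = real_weightsD(2)[OF w]
  show "(\<lambda>z. 1 / w j z) \<in> borel_measurable lebesgue" using w_meas[OF j] by simp
  show "(\<lambda>z. \<Prod>i = 1..m. w i z) \<in> borel_measurable lebesgue" by (rule real_weights_prod(1)[OF w])
  show "0 < 1 / w j z" for z using w_pos[OF j] by simp
  show "0 < (\<Prod>i = 1..m. w i z)" for z by (rule real_weights_prod(2)[OF w])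
  show "0 < d j - y j" "0 < Y - e" "0 < max K 1" using y by auto
  show "0 \<le> N" using x by (intro sum_nonneg) auto
  fix Q :: "(real ^ 'n) set" assume Q: "Q \<in> cubes"
  have \<kappa>: "1 / w j z * (\<Prod>i = 1..m. w i z) = (\<Prod>i\<in>others. w i z)" for z
    using w_pos[OF j, of z] unfolding prod_split[of "\<lambda>i. w i z"] by simp
  have "1 = cube_norm Q (d j - y j + (Y - e) + N) (\<lambda>z. ennreal (\<Prod>i\<in>others. w i z) * (\<Prod>i\<in>others. ennreal (1 / w i z)))"
  proof -
    have "ennreal (\<Prod>i\<in>others. w i z) * (\<Prod>i\<in>others. ennreal (1 / w i z)) = 1" for z
    proof -
      have "(\<Prod>i\<in>others. ennreal (1 / w i z)) = ennreal (\<Prod>i\<in>others. 1 / w i z)"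
        using w_pos by (intro prod_ennreal) (auto simp: less_imp_le)
      also have "ennreal (\<Prod>i\<in>others. w i z) * \<dots> = ennreal ((\<Prod>i\<in>others. w i z) * (\<Prod>i\<in>others. 1 / w i z))"
        using w_pos by (intro ennreal_mult[symmetric] prod_nonneg) (auto simp: less_imp_le)
      also have "(\<Prod>i\<in>others. w i z) * (\<Prod>i\<in>others. 1 / w i z) = (\<Prod>i\<in>others. w i z * (1 / w i z))"
        by (rule prod.distrib[symmetric])
      also have "\<dots> = 1" using w_pos by (intro prod.neutral) (auto simp: less_imp_neq[symmetric])
      finally show ?thesis by simp
    qed
    then show ?thesis using emeasure_uniform_cube[OF Q] by (simp add: rnorm_1_le)
  qed
  also have "\<dots> \<le> weight_norm Q (d j - y j + (Y - e)) (\<lambda>z. \<Prod>i\<in>others. w i z) *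
      cube_norm Q N (\<lambda>z. \<Prod>i\<in>others. ennreal (1 / w i z))"
    using y x by (intro rnorm_Holder) (auto intro!: borel_measurable_prod_ennreal sum_nonneg)
  also have "\<dots> \<le> weight_norm Q (d j - y j + (Y - e)) (\<lambda>z. \<Prod>i\<in>others. w i z) * rest w Q"
    using others x by (intro mult_left_mono rnorm_Holder_prod) auto
  finally show "1 \<le> weight_norm Q (d j - y j + (Y - e)) (\<lambda>z. 1 / w j z * (\<Prod>i = 1..m. w i z)) * rest w Q"
    by (simp only: \<kappa>)
  show "weight_norm Q (d j - y j) (\<lambda>z. 1 / w j z) *
      weight_norm Q (Y - e) (\<lambda>z. \<Prod>i = 1..m. w i z) * rest w Q \<le> ennreal (max K 1)"
    using bspec[OF K Q] ennreal_leI[of K "max K 1"] unfolding class_product_y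
    by (simp only: mult_ac) (auto intro: order_trans)
  fix Q' :: "(real ^ 'n) set" assume Q': "Q' \<in> cubes" "Q \<subseteq> Q'"
  have "rest w Q \<le> (\<Prod>i\<in>others. epowr (emeasure lebesgue Q' / emeasure lebesgue Q) (d i - x i) *
      weight_norm Q' (d i - x i) (\<lambda>z. 1 / w i z))"
    using x by (intro prod_mono_ennreal cube_norm_subset Q Q') auto
  then show "rest w Q \<le> epowr (emeasure lebesgue Q' / emeasure lebesgue Q) N * rest w Q'"
    using others by (simp add: epowr_sum prod.distrib)
qed

text \<open>The reciprocal falls by t. Put g = f w, let I be the integral of g^(1/Y), and take H_0 =
  g^(t/Y). Then g H_0 = g^(X/Y) has norm I^X, which bounds the left side for the weight w_j H from
  below. On the right, Hoelder's inequality separates H from f_j w_j at the cost of a constant times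
  I^t. Dividing by I^t leaves I^Y, the norm of g.\<close>

lemma step_up:
  assumes up: "y j < x j" and hyp: "weighted_bound m d e x \<F>"
  shows "weighted_bound m d e y \<F>"
  unfolding weighted_bound_def
proof
  fix K :: real
  define K' where "K' = max K 1"
  define t where "t = x j - y j"
  define b where "b = d j - y j"
  define b' where "b' = Y - e"
  define P where "P = pair_const (3 ^ CARD('n)) b b' N K' t"
  define c where "c = 2 powr ((b + b') * t / b)"
  have t: "0 < t" "t \<le> b" using up x(1)[OF j] by (auto simp: t_def b_def)
  have Xt: "X = Y + t" using sum_X sum_Y unfolding t_def by linarith
  have Y_pos: "0 < Y" using y e by simp
  obtain C where C: "0 < C" "\<And>w f fs. real_weights m w \<Longrightarrow>
      (\<And>Q. Q \<in> cubes \<Longrightarrow> class_product m d e x w Q \<le> ennreal P) \<Longrightarrow> (f, fs) \<in> \<F> \<Longrightarrow>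
      product_bound m x w f fs C"
    by (rule weighted_boundE[OF hyp, of P]) blast
  have "product_bound m y w f fs (C * c)"
    if w: "real_weights m w" "\<forall>Q\<in>cubes. class_product m d e y w Q \<le> ennreal K" and F: "(f, fs) \<in> \<F>" for w f fs
  proof -
    note w_meas [measurable] = real_weightsD(1)[OF w(1)] and w_pos = real_weightsD(2)[OF w(1)]
    note [measurable] = w_meas[OF j]
    have [measurable]: "f \<in> borel_measurable lebesgue" "fs j \<in> borel_measurable lebesgue"
      using meas[OF F] j by auto
    note prod_meas [measurable] = real_weights_prod(1)[OF w(1)] and prod_pos = real_weights_prod(2)[OF w(1)]
    interpret E: exponent_pair "\<lambda>z. 1 / w j z" "\<lambda>z. \<Prod>i = 1..m. w i z" "rest w" b b' N K'
      unfolding b_def b'_def K'_def by (rule pair[OF w])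
    define g where "g z = f z * ennreal (\<Prod>i = 1..m. w i z)" for z
    have [measurable]: "g \<in> borel_measurable lebesgue" unfolding g_def by measurable
    let ?others = "\<Prod>i\<in>others. rnorm lebesgue (x i) (\<lambda>z. fs i z * ennreal (w i z))"
    let ?fj = "\<lambda>z. fs j z * ennreal (w j z)"
    define R where "R = ennreal (C * c) * (rnorm lebesgue (y j) ?fj * ?others)"
    \<comment> \<open>Bounded height and bounded support make I finite, as the division by I^t
      requires; g is recovered as an increasing limit.\<close>
    define gn where "gn n z = enn2real (min (g z) (of_nat n)) * indicator (cball 0 (real n)) z" for n :: nat and z
    have gn_nonneg: "0 \<le> gn n z" for n z by (simp add: gn_def)
    have gn_eq: "ennreal (gn n z) = min (g z) (of_nat n) * indicator (cball 0 (real n)) z" for n z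
    proof -
      have "min (g z) (of_nat n) < top" by (simp add: min_less_iff_disj ennreal_of_nat_eq_real_of_nat)
      then show ?thesis by (auto simp: gn_def split: split_indicator)
    qed
    have [measurable]: "cball (0 :: real ^ 'n) (real n) \<in> sets lebesgue" for n by simp
    have [measurable]: "gn n \<in> borel_measurable lebesgue" for n unfolding gn_def by measurable
    have bound: "rnorm lebesgue Y (\<lambda>z. ennreal (gn n z)) \<le> R" for n
    proof -
      let ?I = "\<integral>\<^sup>+z. epowr (ennreal (gn n z)) (1 / Y) \<partial>lebesgue"
      have "?I \<le> (\<integral>\<^sup>+z. epowr (of_nat n) (1 / Y) * indicator (cball (0 :: real ^ 'n) (real n)) z \<partial>lebesgue)"
        unfolding gn_eq using Y_pos
        by (intro nn_integral_mono) (auto intro!: epowr_mono split: split_indicator)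
      also have "\<dots> = epowr (of_nat n) (1 / Y) * emeasure lebesgue (cball (0 :: real ^ 'n) (real n))"
        by (intro nn_integral_cmult_indicator) auto
      also have "\<dots> < top"
        using emeasure_lborel_cball_finite[of "0 :: real ^ 'n" "real n"]
        by (auto simp: ennreal_mult_eq_top_iff less_top[symmetric] ennreal_of_nat_eq_real_of_nat)
      finally have "?I \<noteq> top" by simp
      show ?thesis
      proof (cases "?I = 0")
        case True
        then show ?thesis using Y_pos by (simp add: rnorm_def)
      next
        case False
        with \<open>?I \<noteq> top\<close> obtain I where I: "?I = ennreal I" "0 < I" by (cases ?I) (auto simp: less_le)
        define H\<^sub>0 where "H\<^sub>0 z = gn n z powr (t / Y)" for z
        have [measurable]: "H\<^sub>0 \<in> borel_measurable lebesgue" unfolding H\<^sub>0_def by measurable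
        have norm_H0: "rnorm lebesgue t (\<lambda>z. ennreal (H\<^sub>0 z)) = ennreal (I powr t)"
        proof -
          have "epowr (ennreal (H\<^sub>0 z)) (1 / t) = epowr (ennreal (gn n z)) (1 / Y)" for z
            using t gn_nonneg by (simp add: H\<^sub>0_def powr_powr)
          then show ?thesis using t I by (simp add: rnorm_def)
        qed
        obtain H where [measurable]: "H \<in> borel_measurable lebesgue" and H: "\<And>z. 0 < H z"
          "AE z in lebesgue. H\<^sub>0 z \<le> H z"
          "rnorm lebesgue t (\<lambda>z. ennreal (H z)) \<le> ennreal c * rnorm lebesgue t (\<lambda>z. ennreal (H\<^sub>0 z))"
          "\<And>Q. Q \<in> cubes \<Longrightarrow> weight_norm Q (b - t) (\<lambda>z. 1 / w j z / H z) *
            weight_norm Q (b' + t) (\<lambda>z. (\<Prod>i = 1..m. w i z) * H z) * rest w Q \<le> ennreal P"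
          using E.rubio_de_francia_pair[OF t, of H\<^sub>0] norm_H0 I unfolding P_def c_def
          by (auto simp: H\<^sub>0_def)
        let ?w = "w(j := \<lambda>z. w j z * H z)"
        have w': "real_weights m ?w"
          using w(1) w_pos[OF j] H(1) by (intro real_weights_update) auto
        have prod': "(\<Prod>i = 1..m. ?w i z) = (\<Prod>i = 1..m. w i z) * H z" for z
          unfolding prod_split by simp
        \<comment> \<open>b - t and b' + t are the indices of the old tuple, so the bound for the
          pair is the old class condition for the modified weights.\<close>
        have "class_product m d e x ?w Q \<le> ennreal P" if "Q \<in> cubes" for Q
        proof -
          have "b - t = d j - x j" "b' + t = X - e" using Xt t_def unfolding b_def b'_def by linarith+
          then show ?thesis
            using H(4)[OF that] unfolding class_product_update prod_split[of "\<lambda>i. w i _"]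
            by (simp add: mult_ac)
        qed
        from C(2)[OF w' this F] have "rnorm lebesgue X (\<lambda>z. g z * ennreal (H z))
            \<le> ennreal C * (\<Prod>i = 1..m. rnorm lebesgue (x i) (\<lambda>z. fs i z * ennreal (?w i z)))"
          unfolding prod' g_def using prod_pos H(1) by (simp add: ennreal_mult less_imp_le mult.assoc)
        also have "(\<Prod>i = 1..m. rnorm lebesgue (x i) (\<lambda>z. fs i z * ennreal (?w i z)))
            = rnorm lebesgue (x j) (\<lambda>z. ?fj z * ennreal (H z)) * ?others"
          unfolding prod_split[of "\<lambda>i. rnorm lebesgue (x i) (\<lambda>z. fs i z * ennreal (?w i z))"]
          using w_pos[OF j] H(1) by (simp add: ennreal_mult less_imp_le mult.assoc)
        also have "\<dots> \<le> (rnorm lebesgue (y j) ?fj * (ennreal c * ennreal (I powr t))) * ?others"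
        proof (rule mult_right_mono)
          have "rnorm lebesgue (y j + t) (\<lambda>z. ?fj z * ennreal (H z))
              \<le> rnorm lebesgue (y j) ?fj * rnorm lebesgue t (\<lambda>z. ennreal (H z))"
            using y t by (intro rnorm_Holder) auto
          also have "\<dots> \<le> rnorm lebesgue (y j) ?fj * (ennreal c * ennreal (I powr t))"
            using H(3) unfolding norm_H0 by (intro mult_left_mono) auto
          finally show "rnorm lebesgue (x j) (\<lambda>z. ?fj z * ennreal (H z))
            \<le> rnorm lebesgue (y j) ?fj * (ennreal c * ennreal (I powr t))"
            by (simp add: t_def)
        qed simp
        also have "ennreal C * \<dots> = R * ennreal (I powr t)"
          using C(1) by (simp add: R_def c_def ennreal_mult mult_ac)
        finally have "rnorm lebesgue X (\<lambda>z. g z * ennreal (H z)) \<le> R * ennreal (I powr t)"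
          by (simp add: mult_left_mono)
        moreover have "ennreal (I powr X) \<le> rnorm lebesgue X (\<lambda>z. g z * ennreal (H z))"
        proof -
          have X_pos: "0 < X" using Xt Y_pos t by simp
          have "ennreal (I powr X) = rnorm lebesgue X (\<lambda>z. ennreal (gn n z) * ennreal (H\<^sub>0 z))"
          proof -
            have "epowr (ennreal (gn n z) * ennreal (H\<^sub>0 z)) (1 / X) = epowr (ennreal (gn n z)) (1 / Y)" for z
            proof -
              have "gn n z * gn n z powr (t / Y) = gn n z powr (X / Y)"
                using Y_pos gn_nonneg[of n z] unfolding Xt
                by (cases "gn n z = 0") (auto simp: powr_add add_divide_distrib)
              then show ?thesis
                using gn_nonneg[of n z] X_pos by (simp add: H\<^sub>0_def ennreal_mult[symmetric] powr_powr)
            qed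
            then show ?thesis using I X_pos by (simp add: rnorm_def)
          qed
          also have "\<dots> \<le> rnorm lebesgue X (\<lambda>z. g z * ennreal (H z))"
          proof (rule rnorm_mono_AE)
            show "AE z in lebesgue. ennreal (gn n z) * ennreal (H\<^sub>0 z) \<le> g z * ennreal (H z)"
              using H(2)
            proof eventually_elim
              case (elim z)
              have "ennreal (gn n z) \<le> g z" by (auto simp: gn_eq split: split_indicator)
              then show ?case using elim by (intro mult_mono ennreal_leI) auto
            qed
          qed (use X_pos in auto)
          finally show ?thesis .
        qed
        ultimately have "ennreal (I powr Y) * ennreal (I powr t) \<le> R * ennreal (I powr t)"
          unfolding Xt by (simp add: powr_add ennreal_mult[symmetric])
        then have "ennreal (I powr Y) * ennreal (I powr t) * inverse (ennreal (I powr t))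
            \<le> R * ennreal (I powr t) * inverse (ennreal (I powr t))"
          by (rule mult_right_mono) simp
        then have "ennreal (I powr Y) \<le> R"
          using I ennreal_inverse_mult_cancel[of "ennreal (I powr t)"] by (simp add: mult.assoc)
        then show ?thesis using I Y_pos by (simp add: rnorm_def)
      qed
    qed
    have SUP: "g z = (SUP n. ennreal (gn n z))" for z
    proof (rule antisym)
      show "g z \<le> (SUP n. ennreal (gn n z))"
      proof (rule dense_le)
        fix l assume l: "l < g z"
        then obtain l' where l': "l = ennreal l'" "0 \<le> l'" by (cases l) auto
        obtain n1 :: nat where n1: "l' \<le> real n1" using real_arch_simple by blast
        obtain n2 :: nat where n2: "norm z \<le> real n2" using real_arch_simple by blast
        let ?n = "max n1 n2"
        have "l \<le> of_nat ?n" using n1 l' by (simp add: ennreal_of_nat_eq_real_of_nat ennreal_leI)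
        moreover have "z \<in> cball 0 (real ?n)" using n2 by simp
        ultimately have "l \<le> ennreal (gn ?n z)" using l by (simp add: gn_eq less_imp_le)
        then show "l \<le> (SUP n. ennreal (gn n z))" by (rule order_trans) (intro SUP_upper UNIV_I)
      qed
      show "(SUP n. ennreal (gn n z)) \<le> g z"
        by (intro SUP_least) (auto simp: gn_eq split: split_indicator)
    qed
    have "rnorm lebesgue Y g = (SUP n. rnorm lebesgue Y (\<lambda>z. ennreal (gn n z)))"
    proof -
      have "(\<integral>\<^sup>+z. epowr (g z) (1 / Y) \<partial>lebesgue) = (\<integral>\<^sup>+z. (SUP n. epowr (ennreal (gn n z)) (1 / Y)) \<partial>lebesgue)"
        unfolding SUP using Y_pos by (simp add: epowr_SUP)
      also have "\<dots> = (SUP n. \<integral>\<^sup>+z. epowr (ennreal (gn n z)) (1 / Y) \<partial>lebesgue)"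
      proof (rule nn_integral_monotone_convergence_SUP)
        show "incseq (\<lambda>n z. epowr (ennreal (gn n z)) (1 / Y))"
        proof (intro incseq_SucI le_funI epowr_mono)
          fix n z
          have "min (g z) (of_nat n) \<le> min (g z) (of_nat (Suc n))"
            by (intro min.mono order_refl) (simp add: ennreal_of_nat_eq_real_of_nat ennreal_leI)
          then show "ennreal (gn n z) \<le> ennreal (gn (Suc n) z)"
            unfolding gn_eq by (intro mult_mono) (auto split: split_indicator)
        qed (use Y_pos in simp)
      qed simp
      finally show ?thesis using Y_pos by (simp add: rnorm_def epowr_SUP)
    qed
    also have "\<dots> \<le> R" by (intro SUP_least bound)
    also have "R = ennreal (C * c) * (\<Prod>i = 1..m. rnorm lebesgue (y i) (\<lambda>z. fs i z * ennreal (w i z)))"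
      unfolding R_def prod_split[of "\<lambda>i. rnorm lebesgue (y i) (\<lambda>z. fs i z * ennreal (w i z))"]
      using y_eq by simp
    also have "g = (\<lambda>z. f z * ennreal (\<Prod>i = 1..m. w i z))" by (rule ext) (rule g_def)
    finally show ?thesis .
  qed
  then show "\<exists>C>0. \<forall>w. real_weights m w \<longrightarrow> (\<forall>Q\<in>cubes. class_product m d e y w Q \<le> ennreal K) \<longrightarrow>
    (\<forall>(f, fs)\<in>\<F>. product_bound m y w f fs C)"
    using C(1) by (intro exI[of _ "C * c"]) (auto simp: c_def)
qed

text \<open>The reciprocal rises by t, and H is built from k = f_j w_j: if H \<ge> k^(t/y_j), then
  k/H \<le> k^(x_j/y_j), so the right side at the old exponent is a power of the integral of
  k^(1/y_j). The left side is recovered by Hoelder's inequality from f w/H and H. The pair is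
  swapped because here b' is the index that loses t.\<close>

lemma step_down:
  assumes down: "x j < y j" and hyp: "weighted_bound m d e x \<F>"
  shows "weighted_bound m d e y \<F>"
  unfolding weighted_bound_def
proof
  fix K :: real
  define K' where "K' = max K 1"
  define t where "t = y j - x j"
  define b where "b = d j - y j"
  define b' where "b' = Y - e"
  define P where "P = pair_const (3 ^ CARD('n)) b' b N K' t"
  define c where "c = 2 powr ((b' + b) * t / b')"
  have Xt: "Y = X + t" using sum_X sum_Y unfolding t_def by linarith
  have t: "0 < t" "t \<le> b'" using down x(2) Xt by (auto simp: t_def b'_def)
  have X_nonneg: "0 \<le> X" using x(2) e by simp
  obtain C where C: "0 < C" "\<And>w f fs. real_weights m w \<Longrightarrow>
      (\<And>Q. Q \<in> cubes \<Longrightarrow> class_product m d e x w Q \<le> ennreal P) \<Longrightarrow> (f, fs) \<in> \<F> \<Longrightarrow>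
      product_bound m x w f fs C"
    by (rule weighted_boundE[OF hyp, of P]) blast
  have "product_bound m y w f fs (C * c)"
    if w: "real_weights m w" "\<forall>Q\<in>cubes. class_product m d e y w Q \<le> ennreal K" and F: "(f, fs) \<in> \<F>" for w f fs
  proof -
    note w_meas [measurable] = real_weightsD(1)[OF w(1)] and w_pos = real_weightsD(2)[OF w(1)]
    note [measurable] = w_meas[OF j]
    have fs_meas: "fs i \<in> borel_measurable lebesgue" if "i \<in> {1..m}" for i
      using meas[OF F] that by auto
    have [measurable]: "f \<in> borel_measurable lebesgue" "fs j \<in> borel_measurable lebesgue"
      using meas[OF F] j by auto
    note prod_meas [measurable] = real_weights_prod(1)[OF w(1)] and prod_pos = real_weights_prod(2)[OF w(1)]
    interpret E0: exponent_pair "\<lambda>z. 1 / w j z" "\<lambda>z. \<Prod>i = 1..m. w i z" "rest w" b b' N K'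
      unfolding b_def b'_def K'_def by (rule pair[OF w])
    interpret E: exponent_pair "\<lambda>z. \<Prod>i = 1..m. w i z" "\<lambda>z. 1 / w j z" "rest w" b' b N K'
      by (rule E0.swap)
    \<comment> \<open>The hypothesis for w_j/H in place of w_j, with H grown from any starting
      function of finite positive norm; two different starting functions follow.\<close>
    have update: "\<exists>H. H \<in> borel_measurable lebesgue \<and> (\<forall>z. 0 < H z) \<and> (AE z in lebesgue. H\<^sub>0 z \<le> H z) \<and>
        rnorm lebesgue t (\<lambda>z. ennreal (H z)) \<le> ennreal c * rnorm lebesgue t (\<lambda>z. ennreal (H\<^sub>0 z)) \<and>
        rnorm lebesgue X (\<lambda>z. f z * ennreal (\<Prod>i = 1..m. w i z) * ennreal (1 / H z))
          \<le> ennreal C * (rnorm lebesgue (x j) (\<lambda>z. fs j z * ennreal (w j z) * ennreal (1 / H z)) *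
            (\<Prod>i\<in>others. rnorm lebesgue (x i) (\<lambda>z. fs i z * ennreal (w i z))))"
      if h0: "H\<^sub>0 \<in> borel_measurable lebesgue" "\<And>z. 0 \<le> H\<^sub>0 z"
        "rnorm lebesgue t (\<lambda>z. ennreal (H\<^sub>0 z)) \<noteq> 0" "rnorm lebesgue t (\<lambda>z. ennreal (H\<^sub>0 z)) \<noteq> top"
      for H\<^sub>0 :: "real ^ 'n \<Rightarrow> real"
    proof -
      obtain H where [measurable]: "H \<in> borel_measurable lebesgue" and H: "\<And>z. 0 < H z"
        "AE z in lebesgue. H\<^sub>0 z \<le> H z"
        "rnorm lebesgue t (\<lambda>z. ennreal (H z)) \<le> ennreal c * rnorm lebesgue t (\<lambda>z. ennreal (H\<^sub>0 z))"
        "\<And>Q. Q \<in> cubes \<Longrightarrow> weight_norm Q (b' - t) (\<lambda>z. (\<Prod>i = 1..m. w i z) / H z) *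
          weight_norm Q (b + t) (\<lambda>z. 1 / w j z * H z) * rest w Q \<le> ennreal P"
        using E.rubio_de_francia_pair[OF t h0] unfolding P_def c_def by blast
      let ?w = "w(j := \<lambda>z. w j z / H z)"
      have w': "real_weights m ?w"
        using w(1) w_pos[OF j] H(1) by (intro real_weights_update) auto
      have prod': "(\<Prod>i = 1..m. ?w i z) = (\<Prod>i = 1..m. w i z) * (1 / H z)" for z
        unfolding prod_split by simp
      have "class_product m d e x ?w Q \<le> ennreal P" if "Q \<in> cubes" for Q
      proof -
        have "b + t = d j - x j" "b' - t = X - e" using Xt t_def unfolding b_def b'_def by linarith+
        then show ?thesis
          using H(4)[OF that] unfolding class_product_update prod_split[of "\<lambda>i. w i _"]
          by (simp add: mult_ac)
      qed
      from C(2)[OF w' this F] have "rnorm lebesgue X (\<lambda>z. f z * ennreal (\<Prod>i = 1..m. w i z) * ennreal (1 / H z))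
          \<le> ennreal C * (\<Prod>i = 1..m. rnorm lebesgue (x i) (\<lambda>z. fs i z * ennreal (?w i z)))"
        unfolding prod' using prod_pos H(1) by (simp add: ennreal_mult[symmetric] less_imp_le mult.assoc)
      also have "(\<Prod>i = 1..m. rnorm lebesgue (x i) (\<lambda>z. fs i z * ennreal (?w i z)))
          = rnorm lebesgue (x j) (\<lambda>z. fs j z * ennreal (w j z) * ennreal (1 / H z)) *
            (\<Prod>i\<in>others. rnorm lebesgue (x i) (\<lambda>z. fs i z * ennreal (w i z)))"
        unfolding prod_split[of "\<lambda>i. rnorm lebesgue (x i) (\<lambda>z. fs i z * ennreal (?w i z))"]
        using w_pos[OF j] H(1) by (simp add: ennreal_mult[symmetric] less_imp_le mult.assoc)
      finally show ?thesis using H(1-3) by (intro exI[of _ H]) auto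
    qed
    let ?fj = "\<lambda>z. fs j z * ennreal (w j z)" and ?g = "\<lambda>z. f z * ennreal (\<Prod>i = 1..m. w i z)"
    let ?others = "\<Prod>i\<in>others. rnorm lebesgue (x i) (\<lambda>z. fs i z * ennreal (w i z))"
    have prod_y: "(\<Prod>i = 1..m. rnorm lebesgue (y i) (\<lambda>z. fs i z * ennreal (w i z)))
        = rnorm lebesgue (y j) ?fj * ?others"
      unfolding prod_split[of "\<lambda>i. rnorm lebesgue (y i) (\<lambda>z. fs i z * ennreal (w i z))"]
      using y_eq by simp
    consider "rnorm lebesgue (y j) ?fj * ?others = 0" | "rnorm lebesgue (y j) ?fj * ?others = top"
      | "rnorm lebesgue (y j) ?fj * ?others \<noteq> 0" "rnorm lebesgue (y j) ?fj * ?others \<noteq> top"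
      by blast
    then show ?thesis
    proof cases
      case 1
      \<comment> \<open>A vanishing right-hand side may offer no function to start from, so the
        iteration starts from the indicator of a unit cube. Any positive H then shows that f w
        vanishes almost everywhere.\<close>
      let ?Q = "cube (0 :: real ^ 'n) 1"
      have "rnorm lebesgue t (\<lambda>z. ennreal (indicator ?Q z)) = 1"
      proof -
        have "(\<integral>\<^sup>+z. epowr (ennreal (indicator ?Q z)) (1 / t) \<partial>lebesgue) = (\<integral>\<^sup>+z. indicator ?Q z \<partial>lebesgue)"
          by (intro nn_integral_cong) (auto split: split_indicator)
        also have "\<dots> = emeasure lebesgue ?Q" by (rule nn_integral_indicator) simp
        also have "\<dots> = 1" using emeasure_cube[of 1 "0 :: real ^ 'n"] by (simp only: power_one ennreal_1 zero_le_one)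
        finally show ?thesis using t by (simp add: rnorm_def)
      qed
      then obtain H where H: "H \<in> borel_measurable lebesgue" "\<forall>z. 0 < H z"
        "rnorm lebesgue X (\<lambda>z. ?g z * ennreal (1 / H z))
          \<le> ennreal C * (rnorm lebesgue (x j) (\<lambda>z. ?fj z * ennreal (1 / H z)) * ?others)"
        using update[of "indicator ?Q", OF borel_measurable_indicator] by auto
      have [measurable]: "H \<in> borel_measurable lebesgue" by (rule H)
      have "rnorm lebesgue (x j) (\<lambda>z. ?fj z * ennreal (1 / H z)) * ?others = 0"
      proof (cases "?others = 0")
        case False
        then have "rnorm lebesgue (y j) ?fj = 0" using 1 by auto
        then have "AE z in lebesgue. ?fj z = 0" by (subst (asm) rnorm_eq_0_iff) auto
        then have "rnorm lebesgue (x j) (\<lambda>z. ?fj z * ennreal (1 / H z)) = 0"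
          by (subst rnorm_eq_0_iff) (auto elim!: eventually_mono)
        then show ?thesis by simp
      qed simp
      with H(3) have "rnorm lebesgue X (\<lambda>z. ?g z * ennreal (1 / H z)) = 0"
        by (simp only: mult_zero_right le_zero_eq)
      then have "AE z in lebesgue. ?g z * ennreal (1 / H z) = 0" by (subst (asm) rnorm_eq_0_iff) auto
      then have "AE z in lebesgue. ?g z = 0" using H(2) by (subst (asm) AE_mult_pos_eq_0_iff) auto
      then have "rnorm lebesgue Y ?g = 0" by (subst rnorm_eq_0_iff) auto
      then show ?thesis by simp
    next
      case 2
      have "0 < c" by (simp add: c_def)
      then show ?thesis unfolding prod_y 2 using C(1) by (simp add: ennreal_mult_top)
    next
      case 3
      have yj: "0 < y j" using down x(1)[OF j] by simp
      let ?J = "\<integral>\<^sup>+z. epowr (?fj z) (1 / y j) \<partial>lebesgue"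
      have J_norm: "rnorm lebesgue (y j) ?fj = epowr ?J (y j)" using yj by (simp add: rnorm_def)
      have "?others \<noteq> 0" using 3 by auto
      then have "rnorm lebesgue (y j) ?fj \<noteq> 0" "rnorm lebesgue (y j) ?fj \<noteq> top"
        using 3 by (auto simp: ennreal_mult_eq_top_iff)
      then have "?J \<noteq> 0" "?J \<noteq> top" unfolding J_norm by auto
      then obtain J where J: "?J = ennreal J" "0 < J" by (cases ?J) (auto simp: less_le)
      \<comment> \<open>The norm of f_j w_j is finite, hence so is the function almost everywhere,
        and it may be taken real.\<close>
      define k where "k z = enn2real (?fj z)" for z
      have [measurable]: "k \<in> borel_measurable lebesgue" unfolding k_def by measurable
      have "AE z in lebesgue. epowr (?fj z) (1 / y j) \<noteq> \<infinity>"
        using J by (intro nn_integral_PInf_AE) auto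
      then have k_eq: "AE z in lebesgue. ?fj z = ennreal (k z)"
        by eventually_elim (auto simp: k_def less_top)
      have k_nonneg: "0 \<le> k z" for z by (simp add: k_def)
      have J_k: "(\<integral>\<^sup>+z. epowr (ennreal (k z)) (1 / y j) \<partial>lebesgue) = ennreal J"
        unfolding J(1)[symmetric] using k_eq by (intro nn_integral_cong_AE) (auto elim!: eventually_mono)
      define H\<^sub>0 where "H\<^sub>0 z = k z powr (t / y j)" for z
      have [measurable]: "H\<^sub>0 \<in> borel_measurable lebesgue" unfolding H\<^sub>0_def by measurable
      have norm_H0: "rnorm lebesgue t (\<lambda>z. ennreal (H\<^sub>0 z)) = ennreal (J powr t)"
      proof -
        have "epowr (ennreal (H\<^sub>0 z)) (1 / t) = epowr (ennreal (k z)) (1 / y j)" for z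
          using t k_nonneg by (simp add: H\<^sub>0_def powr_powr)
        then show ?thesis using t J J_k by (simp add: rnorm_def)
      qed
      have "rnorm lebesgue t (\<lambda>z. ennreal (H\<^sub>0 z)) \<noteq> 0" "rnorm lebesgue t (\<lambda>z. ennreal (H\<^sub>0 z)) \<noteq> top"
        unfolding norm_H0 using J by auto
      then obtain H where H: "H \<in> borel_measurable lebesgue" "\<And>z. 0 < H z" "AE z in lebesgue. H\<^sub>0 z \<le> H z"
        "rnorm lebesgue t (\<lambda>z. ennreal (H z)) \<le> ennreal c * rnorm lebesgue t (\<lambda>z. ennreal (H\<^sub>0 z))"
        "rnorm lebesgue X (\<lambda>z. ?g z * ennreal (1 / H z))
          \<le> ennreal C * (rnorm lebesgue (x j) (\<lambda>z. ?fj z * ennreal (1 / H z)) * ?others)"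
        using update[of H\<^sub>0] by (auto simp: H\<^sub>0_def)
      have [measurable]: "H \<in> borel_measurable lebesgue" by (rule H)
      have xj: "0 \<le> x j" "x j + t = y j" using x(1)[OF j] by (auto simp: t_def)
      have fj: "rnorm lebesgue (x j) (\<lambda>z. ?fj z * ennreal (1 / H z)) \<le> ennreal (J powr x j)"
      proof -
        have "AE z in lebesgue. ?fj z * ennreal (1 / H z) \<le> ennreal (k z powr (x j / y j))"
          using k_eq H(3)
        proof eventually_elim
          case (elim z)
          have "k z / H z \<le> k z powr (x j / y j)"
          proof (cases "k z = 0")
            case False
            then have kz: "0 < k z" using k_nonneg[of z] by simp
            have "k z = k z powr (x j / y j) * k z powr (t / y j)"
              using kz yj xj by (simp add: powr_add[symmetric] add_divide_distrib[symmetric])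
            also have "\<dots> \<le> k z powr (x j / y j) * H z"
              using elim by (intro mult_left_mono) (auto simp: H\<^sub>0_def)
            finally show ?thesis using H(2)[of z] by (simp add: field_simps)
          qed simp
          then show ?case
            unfolding elim(1) using k_nonneg[of z] H(2)[of z]
            by (simp add: ennreal_mult[symmetric] less_imp_le ennreal_leI)
        qed
        then have "rnorm lebesgue (x j) (\<lambda>z. ?fj z * ennreal (1 / H z))
            \<le> rnorm lebesgue (x j) (\<lambda>z. ennreal (k z powr (x j / y j)))"
          using xj by (intro rnorm_mono_AE) auto
        also have "\<dots> \<le> ennreal (J powr x j)"
        proof (cases "x j = 0")
          \<comment> \<open>For x_j = 0 the power k^0 takes only the values 0 (where k = 0) and 1,
            so its essential supremum is at most 1.\<close>
          case True
          have "k z powr 0 \<le> 1" for z by simp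
          then have "rnorm lebesgue (x j) (\<lambda>z. ennreal (k z powr (x j / y j))) \<le> 1"
            unfolding rnorm_def using True by (auto intro!: esssup_I)
          then show ?thesis using True J by simp
        next
          case False
          then have "epowr (ennreal (k z powr (x j / y j))) (1 / x j) = epowr (ennreal (k z)) (1 / y j)" for z
            using k_nonneg by (simp add: powr_powr)
          then show ?thesis using False J J_k by (simp add: rnorm_def)
        qed
        finally show ?thesis .
      qed
      have "?g z = ?g z * ennreal (1 / H z) * ennreal (H z)" for z
        using H(2)[of z] by (simp add: mult.assoc ennreal_mult[symmetric] less_imp_le)
      then have "rnorm lebesgue Y ?g = rnorm lebesgue Y (\<lambda>z. ?g z * ennreal (1 / H z) * ennreal (H z))"
        by simp
      also have "\<dots> \<le> rnorm lebesgue X (\<lambda>z. ?g z * ennreal (1 / H z)) * rnorm lebesgue t (\<lambda>z. ennreal (H z))"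
        unfolding Xt using X_nonneg t by (intro rnorm_Holder) auto
      also have "\<dots> \<le> (ennreal C * (ennreal (J powr x j) * ?others)) * (ennreal c * ennreal (J powr t))"
        using H(4) unfolding norm_H0
        by (intro mult_mono order_trans[OF H(5)] mult_left_mono mult_right_mono fj) auto
      also have "\<dots> = ennreal (C * c) * ((ennreal (J powr x j) * ennreal (J powr t)) * ?others)"
        using C(1) by (simp add: c_def ennreal_mult mult_ac)
      also have "ennreal (J powr x j) * ennreal (J powr t) = rnorm lebesgue (y j) ?fj"
        unfolding J_norm J(1) using J(2) xj by (simp add: ennreal_mult[symmetric] powr_add[symmetric])
      finally show ?thesis unfolding prod_y .
    qed
  qed
  then show "\<exists>C>0. \<forall>w. real_weights m w \<longrightarrow> (\<forall>Q\<in>cubes. class_product m d e y w Q \<le> ennreal K) \<longrightarrow>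
    (\<forall>(f, fs)\<in>\<F>. product_bound m y w f fs C)"
    using C(1) by (intro exI[of _ "C * c"]) (auto simp: c_def)
qed

end

section \<open>Changing all exponents, and sequences of functions\<close>

text \<open>The intermediate tuples take y on a set of indices and x elsewhere. The sum of x may
  equal e, but every raise of a reciprocal is strict, so already the first new tuple lies strictly
  above e. During the lowering phase the sum never falls below that of y.\<close>

theorem weighted_bound_extrapolation:
  fixes \<F> :: "((real ^ 'n \<Rightarrow> ennreal) \<times> (nat \<Rightarrow> real ^ 'n \<Rightarrow> ennreal)) set"
  assumes m: "2 \<le> m"
    and meas: "\<And>f fs. (f, fs) \<in> \<F> \<Longrightarrow>
      f \<in> borel_measurable lebesgue \<and> (\<forall>i\<in>{1..m}. fs i \<in> borel_measurable lebesgue)"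
    and x: "\<And>i. i \<in> {1..m} \<Longrightarrow> 0 \<le> x i \<and> x i \<le> d i" "e \<le> (\<Sum>i = 1..m. x i)"
    and e: "0 \<le> e"
    and y: "\<And>i. i \<in> {1..m} \<Longrightarrow> 0 \<le> y i \<and> y i < d i" "e < (\<Sum>i = 1..m. y i)"
    and xy: "\<And>i. i \<notin> {1..m} \<Longrightarrow> x i = y i"
    and bound: "weighted_bound m d e x \<F>"
  shows "weighted_bound m d e y \<F>"
proof -
  define z where "z A i = (if i \<in> A then y i else x i)" for A i
  have z: "0 \<le> z A i \<and> z A i \<le> d i" if "i \<in> {1..m}" for A i
    using x(1)[OF that] y(1)[OF that] by (auto simp: z_def)
  have step: "weighted_bound m d e (z (insert j A)) \<F>"
    if A: "weighted_bound m d e (z A) \<F>" "j \<in> {1..m}" "j \<notin> A" "e \<le> (\<Sum>i = 1..m. z A i)"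
      "e < (\<Sum>i = 1..m. z (insert j A) i)" for A j
  proof (cases "x j = y j")
    case True
    then have "z (insert j A) = z A" by (auto simp: z_def)
    then show ?thesis using A by simp
  next
    case False
    interpret exponent_step m d e "z A" "z (insert j A)" j \<F>
    proof
      show "0 \<le> z (insert j A) j" "z (insert j A) j < d j" using y(1)[OF A(2)] by (auto simp: z_def)
      show "z (insert j A) i = z A i" if "i \<noteq> j" for i using that by (simp add: z_def)
    qed (use m meas e A z in auto)
    show ?thesis
    proof (cases "y j < x j")
      case True
      then show ?thesis using A by (intro step_up) (auto simp: z_def)
    next
      case False
      then show ?thesis using A \<open>x j \<noteq> y j\<close> by (intro step_down) (auto simp: z_def)
    qed
  qed
  define up where "up = {i \<in> {1..m}. x i < y i}"
  have 1: "weighted_bound m d e (z A) \<F>" if "finite A" "A \<subseteq> up" for A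
    using that
  proof (induction A rule: finite_induct)
    case empty
    have "z {} = x" by (auto simp: z_def)
    then show ?case using bound by simp
  next
    case (insert j A)
    have "(\<Sum>i = 1..m. x i) \<le> (\<Sum>i = 1..m. z A i)"
      using insert.prems by (intro sum_mono) (auto simp: z_def up_def less_imp_le subset_iff)
    moreover have "(\<Sum>i = 1..m. z A i) < (\<Sum>i = 1..m. z (insert j A) i)"
    proof (rule sum_strict_mono_ex1)
      show "\<exists>i\<in>{1..m}. z A i < z (insert j A) i"
        using insert.prems insert.hyps by (intro bexI[of _ j]) (auto simp: z_def up_def)
      show "\<forall>i\<in>{1..m}. z A i \<le> z (insert j A) i"
        using insert.prems by (auto simp: z_def up_def less_imp_le)
    qed simp
    ultimately show ?case
      using insert x(2) by (intro step) (auto simp: up_def)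
  qed
  have 2: "weighted_bound m d e (z (B \<union> up)) \<F>" if "finite B" "B \<subseteq> {1..m} - up" for B
    using that
  proof (induction B rule: finite_induct)
    case empty
    have "finite up" by (simp add: up_def)
    then show ?case using 1 by simp
  next
    case (insert j B)
    have "(\<Sum>i = 1..m. y i) \<le> (\<Sum>i = 1..m. z (A \<union> up) i)" for A
      by (intro sum_mono) (auto simp: z_def up_def)
    from this[of B] this[of "insert j B"] y(2)
    have "e \<le> (\<Sum>i = 1..m. z (B \<union> up) i)" "e < (\<Sum>i = 1..m. z (insert j (B \<union> up)) i)" by auto
    then show ?case
      using insert by (simp only: Un_insert_left) (intro step, auto)
  qed
  have "z ({1..m} - up \<union> up) = y"
    using xy by (auto simp: z_def up_def fun_eq_iff)
  then show ?thesis using 2[of "{1..m} - up"] by simp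
qed

text \<open>With l^s as a norm over the counting measure, Hoelder's inequality and homogeneity for
  sequences are instances of the lemmas on \<open>rnorm\<close>.\<close>

lemma lnorm_eq_rnorm:
  assumes "0 \<le> a"
  shows "lnorm (inverse (ennreal a)) f = rnorm (count_space UNIV) a f"
proof (cases "a = 0")
  case True
  have "esssup (count_space UNIV) f = (SUP j. f j)"
    by (subst esssup_eq_AE) (auto simp: AE_count_space SUP_le_iff intro!: antisym Inf_lower Inf_greatest SUP_least SUP_upper)
  then show ?thesis using True by (simp add: lnorm_def rnorm_def)
next
  case False
  then show ?thesis using assms
    by (simp add: lnorm_def rnorm_def inverse_ennreal nn_integral_count_space_nat inverse_eq_divide)
qed

lemma rnorm_0_count_space: "rnorm (count_space UNIV) 0 f = (SUP j :: nat. f j)"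
  using lnorm_eq_rnorm[of 0 f] by (simp add: lnorm_def)

lemma rnorm_pos_count_space:
  "a \<noteq> 0 \<Longrightarrow> rnorm (count_space UNIV) a f = epowr (\<Sum>j :: nat. epowr (f j) (1 / a)) a"
  by (simp add: rnorm_def nn_integral_count_space_nat)

lemma measurable_rnorm_count_space [measurable]:
  assumes [measurable]: "\<And>j :: nat. f j \<in> borel_measurable M"
  shows "(\<lambda>z. rnorm (count_space UNIV) a (\<lambda>j. f j z)) \<in> borel_measurable M"
  by (cases "a = 0") (simp_all add: rnorm_0_count_space rnorm_pos_count_space)

text \<open>For equal exponents this is the interchange of sum and integral.\<close>

lemma rnorm_rnorm_count_space:
  assumes [measurable]: "\<And>j :: nat. f j \<in> borel_measurable M" and a: "0 < a"
  shows "rnorm M a (\<lambda>z. rnorm (count_space UNIV) a (\<lambda>j. f j z)) = rnorm (count_space UNIV) a (\<lambda>j. rnorm M a (f j))"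
  using a by (simp add: rnorm_pos_count_space rnorm_def[of M] nn_integral_suminf)

text \<open>At a = 0 each function lies below the pointwise supremum. This is the direction needed
  for the factors on the right, some of whose exponents may be infinite.\<close>

lemma rnorm_count_space_rnorm_le:
  assumes [measurable]: "\<And>j :: nat. f j \<in> borel_measurable M" and a: "0 \<le> a"
  shows "rnorm (count_space UNIV) a (\<lambda>j. rnorm M a (f j)) \<le> rnorm M a (\<lambda>z. rnorm (count_space UNIV) a (\<lambda>j. f j z))"
proof (cases "a = 0")
  case True
  then show ?thesis
    by (simp add: rnorm_0_count_space) (auto simp: rnorm_def intro!: SUP_least esssup_mono SUP_upper)
next
  case False
  then show ?thesis using assms by (simp add: rnorm_rnorm_count_space)
qed

text \<open>Each sequence is condensed into one tuple by pointwise sequence norms. The vector-valued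
  bound becomes a scalar bound for this family, to which extrapolation applies again.\<close>

definition sequence_family where
  "sequence_family m y \<F> = {(\<lambda>z. rnorm (count_space UNIV) (\<Sum>i = 1..m. y i) (\<lambda>j :: nat. F j z),
     \<lambda>i z. rnorm (count_space UNIV) (y i) (\<lambda>j. Fs j i z)) | F Fs. \<forall>j. (F j, Fs j) \<in> \<F>}"

text \<open>When the Lebesgue exponents equal the sequence exponents, the norms in z and in the
  sequence index can be interchanged. The scalar bound applies to each term, and Hoelder's
  inequality over the sequence index distributes the norm over the factors.\<close>

lemma weighted_bound_sequence_family:
  fixes \<F> :: "((real ^ 'n \<Rightarrow> ennreal) \<times> (nat \<Rightarrow> real ^ 'n \<Rightarrow> ennreal)) set"
  assumes m: "2 \<le> m"
    and meas: "\<And>f fs. (f, fs) \<in> \<F> \<Longrightarrow>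
      f \<in> borel_measurable lebesgue \<and> (\<forall>i\<in>{1..m}. fs i \<in> borel_measurable lebesgue)"
    and y: "\<And>i. i \<in> {1..m} \<Longrightarrow> 0 \<le> y i" "0 < (\<Sum>i = 1..m. y i)"
    and bound: "weighted_bound m d e y \<F>"
  shows "weighted_bound m d e y (sequence_family m y \<F>)"
  unfolding weighted_bound_def
proof
  fix K :: real
  obtain C where C: "0 < C" "\<And>w f fs. real_weights m w \<Longrightarrow>
      (\<And>Q. Q \<in> cubes \<Longrightarrow> class_product m d e y w Q \<le> ennreal K) \<Longrightarrow> (f, fs) \<in> \<F> \<Longrightarrow>
      product_bound m y w f fs C"
    by (rule weighted_boundE[OF bound, of K]) blast
  let ?Y = "\<Sum>i = 1..m. y i" and ?c = "count_space (UNIV :: nat set)"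
  have "rnorm lebesgue ?Y (\<lambda>z. rnorm ?c ?Y (\<lambda>j. F j z) * ennreal (\<Prod>i = 1..m. w i z))
      \<le> ennreal C * (\<Prod>i = 1..m. rnorm lebesgue (y i) (\<lambda>z. rnorm ?c (y i) (\<lambda>j. Fs j i z) * ennreal (w i z)))"
    if w: "real_weights m w" "\<forall>Q\<in>cubes. class_product m d e y w Q \<le> ennreal K" and F: "\<forall>j. (F j, Fs j) \<in> \<F>"
    for w F Fs
  proof -
    note w_meas [measurable] = real_weightsD(1)[OF w(1)] and w_pos = real_weightsD(2)[OF w(1)]
    have F_meas [measurable]: "F j \<in> borel_measurable lebesgue" for j using F meas by blast
    have Fs_meas [measurable]: "i \<in> {1..m} \<Longrightarrow> Fs j i \<in> borel_measurable lebesgue" for i j using F meas by blast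
    have hom: "rnorm ?c a (\<lambda>j. h j) * ennreal r = rnorm ?c a (\<lambda>j. h j * ennreal r)" if "0 \<le> a" for a r h
      using rnorm_cmult[of h ?c "ennreal r" a] that by (simp add: mult.commute)
    have "rnorm lebesgue ?Y (\<lambda>z. rnorm ?c ?Y (\<lambda>j. F j z) * ennreal (\<Prod>i = 1..m. w i z))
        = rnorm ?c ?Y (\<lambda>j. rnorm lebesgue ?Y (\<lambda>z. F j z * ennreal (\<Prod>i = 1..m. w i z)))"
      unfolding hom[OF less_imp_le[OF y(2)]]
      using y(2) by (intro rnorm_rnorm_count_space) auto
    also have "\<dots> \<le> rnorm ?c ?Y (\<lambda>j. ennreal C * (\<Prod>i = 1..m. rnorm lebesgue (y i) (\<lambda>z. Fs j i z * ennreal (w i z))))"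
    proof (rule rnorm_mono)
      fix j
      show "rnorm lebesgue ?Y (\<lambda>z. F j z * ennreal (\<Prod>i = 1..m. w i z))
          \<le> ennreal C * (\<Prod>i = 1..m. rnorm lebesgue (y i) (\<lambda>z. Fs j i z * ennreal (w i z)))"
        using w(2) F by (intro C(2)[OF w(1)]) auto
    qed (use y(2) in auto)
    also have "\<dots> = ennreal C * rnorm ?c ?Y (\<lambda>j. \<Prod>i = 1..m. rnorm lebesgue (y i) (\<lambda>z. Fs j i z * ennreal (w i z)))"
      using y(2) by (intro rnorm_cmult) auto
    also have "\<dots> \<le> ennreal C * (\<Prod>i = 1..m. rnorm ?c (y i) (\<lambda>j. rnorm lebesgue (y i) (\<lambda>z. Fs j i z * ennreal (w i z))))"
      using y(1) m by (intro mult_left_mono rnorm_Holder_prod) auto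
    also have "\<dots> \<le> ennreal C * (\<Prod>i = 1..m. rnorm lebesgue (y i) (\<lambda>z. rnorm ?c (y i) (\<lambda>j. Fs j i z * ennreal (w i z))))"
      using y(1) by (intro mult_left_mono prod_mono_ennreal rnorm_count_space_rnorm_le) auto
    also have "(\<Prod>i = 1..m. rnorm lebesgue (y i) (\<lambda>z. rnorm ?c (y i) (\<lambda>j. Fs j i z * ennreal (w i z))))
        = (\<Prod>i = 1..m. rnorm lebesgue (y i) (\<lambda>z. rnorm ?c (y i) (\<lambda>j. Fs j i z) * ennreal (w i z)))"
      using y(1) by (intro prod.cong refl) (simp only: hom)
    finally show ?thesis .
  qed
  then show "\<exists>C>0. \<forall>w. real_weights m w \<longrightarrow> (\<forall>Q\<in>cubes. class_product m d e y w Q \<le> ennreal K) \<longrightarrow>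
    (\<forall>(f, fs)\<in>sequence_family m y \<F>. product_bound m y w f fs C)"
    using C(1) by (intro exI[of _ C]) (auto simp: sequence_family_def)
qed

lemma sequence_family_measurable:
  assumes meas: "\<And>f fs. (f, fs) \<in> \<F> \<Longrightarrow>
      f \<in> borel_measurable lebesgue \<and> (\<forall>i\<in>{1..m}. fs i \<in> borel_measurable lebesgue)"
    and "(f, fs) \<in> sequence_family m y \<F>"
  shows "f \<in> borel_measurable lebesgue \<and> (\<forall>i\<in>{1..m}. fs i \<in> borel_measurable lebesgue)"
proof -
  obtain F Fs where F: "\<forall>j. (F j, Fs j) \<in> \<F>"
    "f = (\<lambda>z. rnorm (count_space UNIV) (\<Sum>i = 1..m. y i) (\<lambda>j :: nat. F j z))"
    "fs = (\<lambda>i z. rnorm (count_space UNIV) (y i) (\<lambda>j. Fs j i z))"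
    using assms(2) unfolding sequence_family_def by blast
  have "F j \<in> borel_measurable lebesgue" "i \<in> {1..m} \<Longrightarrow> Fs j i \<in> borel_measurable lebesgue" for i j
    using F(1) meas by blast+
  then show ?thesis unfolding F by (auto intro!: measurable_rnorm_count_space)
qed

section \<open>Translation of the exponents\<close>

lemma ennreal_inverse_inverse [simp]: "inverse (inverse x) = (x :: ennreal)"
proof (cases x)
  case (real r)
  then show ?thesis by (cases "r = 0") (auto simp: inverse_ennreal)
qed simp

lemma ennreal_inverse_antimono: "x \<le> y \<Longrightarrow> inverse y \<le> inverse (x :: ennreal)"
proof (cases x; cases y)
  fix a b assume "x \<le> y" and *: "0 \<le> a" "x = ennreal a" "0 \<le> b" "y = ennreal b"
  then show "inverse y \<le> inverse x"
    by (cases "a = 0") (auto simp: inverse_ennreal intro!: ennreal_leI le_imp_inverse_le)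
qed (auto simp: top_unique)

lemma ennreal_inverse_strict_antimono: "x < y \<Longrightarrow> inverse y < inverse (x :: ennreal)"
  using ennreal_inverse_antimono[of "inverse x" "inverse y"] unfolding ennreal_inverse_inverse
  by (meson not_le)

text \<open>The value outside \<open>{1..m}\<close> is irrelevant; it is fixed to make tuples of reciprocals canonical.\<close>

definition recips :: "nat \<Rightarrow> (nat \<Rightarrow> ennreal) \<Rightarrow> nat \<Rightarrow> real" where
  "recips m q i = (if i \<in> {1..m} then enn2real (inverse (q i)) else 0)"

definition last_recip :: "nat \<Rightarrow> (nat \<Rightarrow> ennreal) \<Rightarrow> real" where
  "last_recip m r = enn2real (1 - inverse (r (m + 1)))"

abbreviation recip_sum :: "nat \<Rightarrow> (nat \<Rightarrow> ennreal) \<Rightarrow> real" where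
  "recip_sum m q \<equiv> \<Sum>i = 1..m. recips m q i"

abbreviation recip_product where
  "recip_product m r q \<equiv> class_product m (recips m r) (last_recip m r) (recips m q)"

lemma recips_nonneg: "0 \<le> recips m q i"
  by (simp add: recips_def)

lemma last_recip_nonneg: "0 \<le> last_recip m r"
  by (simp add: last_recip_def)

lemma inverse_conj_exp: "inverse (conj_exp (r (m + 1))) = ennreal (last_recip m r)"
proof -
  have "1 - inverse (r (m + 1)) < top" using diff_less_top_ennreal[of 1 "inverse (r (m + 1))"] by simp
  then show ?thesis by (simp add: conj_exp_def last_recip_def)
qed

context
  fixes m :: nat and q :: "nat \<Rightarrow> ennreal"
  assumes q: "\<And>i. i \<in> {1..m} \<Longrightarrow> 1 \<le> q i"
begin

lemma inverse_exponent: "i \<in> {1..m} \<Longrightarrow> inverse (q i) = ennreal (recips m q i)"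
proof -
  assume i: "i \<in> {1..m}"
  have "inverse (q i) \<le> inverse 1" using q[OF i] by (rule ennreal_inverse_antimono)
  then have "inverse (q i) < top" by (auto intro: le_less_trans)
  then show ?thesis using i by (simp add: recips_def)
qed

lemma exponent_eq: "i \<in> {1..m} \<Longrightarrow> q i = inverse (ennreal (recips m q i))"
  by (subst inverse_exponent[symmetric]) simp_all

lemma harm_exp_eq: "harm_exp m q = inverse (ennreal (recip_sum m q))"
proof -
  have "(\<Sum>i = 1..m. inverse (q i)) = (\<Sum>i = 1..m. ennreal (recips m q i))"
    by (intro sum.cong refl inverse_exponent)
  then show ?thesis by (simp add: harm_exp_def sum_ennreal recips_nonneg)
qed

lemma sum_recips_nonneg: "0 \<le> recip_sum m q"
  by (intro sum_nonneg recips_nonneg)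

lemma exps_le_sum:
  assumes "exps_le m r q"
  shows "last_recip m r \<le> recip_sum m q"
proof -
  have "inverse (conj_exp (r (m + 1))) \<le> inverse (harm_exp m q)"
    using assms by (intro ennreal_inverse_antimono) (simp add: exps_le_def)
  then show ?thesis
    unfolding inverse_conj_exp harm_exp_eq using sum_recips_nonneg by (simp del: One_nat_def)
qed

lemma exps_less_sum:
  assumes "exps_less m r q"
  shows "last_recip m r < recip_sum m q"
proof -
  have "inverse (conj_exp (r (m + 1))) < inverse (harm_exp m q)"
    using assms by (intro ennreal_inverse_strict_antimono) (simp add: exps_less_def)
  then show ?thesis
    unfolding inverse_conj_exp harm_exp_eq using last_recip_nonneg
    by (simp add: ennreal_less_iff del: One_nat_def)
qed

lemma recips_le:
  assumes "exps_le m r q" "i \<in> {1..m}" "1 \<le> r i"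
  shows "recips m q i \<le> recips m r i"
proof -
  have "inverse (q i) \<le> inverse (r i)"
    using assms by (intro ennreal_inverse_antimono) (simp add: exps_le_def)
  moreover have "inverse (r i) < top"
    using ennreal_inverse_antimono[OF assms(3)] by (auto intro: le_less_trans)
  ultimately show ?thesis using assms by (simp add: recips_def enn2real_mono)
qed

lemma recips_less:
  assumes "exps_less m r q" "i \<in> {1..m}" "1 \<le> r i"
  shows "recips m q i < recips m r i"
proof -
  have "inverse (q i) < inverse (r i)"
    using assms by (intro ennreal_inverse_strict_antimono) (simp add: exps_less_def)
  moreover have "inverse (r i) < top"
    using ennreal_inverse_antimono[OF assms(3)] by (auto intro: le_less_trans)
  ultimately show ?thesis using assms by (simp add: recips_def enn2real_less_iff)
qed

text \<open>The weights v and w agree almost everywhere, which no cube average detects, and the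
  differences of reciprocals inside \<open>delta\<close> become differences of real indices.\<close>

lemma class_product_eq:
  assumes r: "\<And>i. i \<in> {1..m} \<Longrightarrow> 1 \<le> r i" and le: "exps_le m r q"
    and v: "\<And>i. i \<in> {1..m} \<Longrightarrow> v i \<in> borel_measurable lebesgue"
    and w: "real_weights m w" and vw: "AE z in lebesgue. \<forall>i\<in>{1..m}. v i z = ennreal (w i z)"
    and Q: "Q \<in> cubes"
  shows "cube_mean Q (delta m q r (m + 1)) (\<lambda>x. \<Prod>i = 1..m. v i x) *
      (\<Prod>i = 1..m. cube_mean Q (delta m q r i) (\<lambda>x. inverse (v i x)))
    = recip_product m r q w Q"
proof -
  note w_meas = real_weightsD(1)[OF w] and w_pos = real_weightsD(2)[OF w]
  have vw_Q: "AE z in uniform_measure lebesgue Q. \<forall>i\<in>{1..m}. v i z = ennreal (w i z)"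
    unfolding AE_uniform_cube[OF Q] using vw by (auto elim!: eventually_mono)
  have "delta m q r (m + 1) = inverse (ennreal (recip_sum m q - last_recip m r))"
    using last_recip_nonneg[of m r]
    by (simp add: delta_def inverse_conj_exp harm_exp_eq ennreal_minus del: One_nat_def)
  then have "cube_mean Q (delta m q r (m + 1)) (\<lambda>x. \<Prod>i = 1..m. v i x)
      = cube_norm Q (recip_sum m q - last_recip m r) (\<lambda>x. \<Prod>i = 1..m. v i x)"
    using v exps_le_sum[OF le] by (simp only:) (intro cube_mean_eq_rnorm Q, auto)
  also have "\<dots> = weight_norm Q (recip_sum m q - last_recip m r) (\<lambda>x. \<Prod>i = 1..m. w i x)"
  proof (rule rnorm_cong_AE)
    show "AE z in uniform_measure lebesgue Q. (\<Prod>i = 1..m. v i z) = ennreal (\<Prod>i = 1..m. w i z)"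
      using vw_Q
    proof eventually_elim
      case (elim z)
      then have "(\<Prod>i = 1..m. v i z) = (\<Prod>i = 1..m. ennreal (w i z))" by (intro prod.cong) auto
      also have "\<dots> = ennreal (\<Prod>i = 1..m. w i z)"
        using w_pos by (intro prod_ennreal) (auto simp: less_imp_le)
      finally show ?case .
    qed
    show "(\<lambda>z. \<Prod>i = 1..m. v i z) \<in> borel_measurable (uniform_measure lebesgue Q)" using v by simp
    show "(\<lambda>z. ennreal (\<Prod>i = 1..m. w i z)) \<in> borel_measurable (uniform_measure lebesgue Q)"
      using real_weights_prod(1)[OF w] by simp
  qed (use exps_le_sum[OF le] in simp)
  finally have 1: "cube_mean Q (delta m q r (m + 1)) (\<lambda>x. \<Prod>i = 1..m. v i x) = \<dots>" .
  have 2: "cube_mean Q (delta m q r i) (\<lambda>x. inverse (v i x))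
      = weight_norm Q (recips m r i - recips m q i) (\<lambda>z. 1 / w i z)" if i: "i \<in> {1..m}" for i
  proof -
    have "inverse (r i) < top"
      using ennreal_inverse_antimono[OF r[OF i]] by (auto intro: le_less_trans)
    then have "inverse (r i) = ennreal (recips m r i)" using i by (simp add: recips_def)
    then have "delta m q r i = inverse (ennreal (recips m r i - recips m q i))"
      using i inverse_exponent[OF i] by (simp add: delta_def ennreal_minus recips_nonneg)
    then have "cube_mean Q (delta m q r i) (\<lambda>x. inverse (v i x))
        = cube_norm Q (recips m r i - recips m q i) (\<lambda>x. inverse (v i x))"
      using v[OF i] recips_le[OF le i r[OF i]] by (simp only:) (intro cube_mean_eq_rnorm Q, auto)
    also have "\<dots> = weight_norm Q (recips m r i - recips m q i) (\<lambda>z. 1 / w i z)"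
    proof (rule rnorm_cong_AE)
      show "AE z in uniform_measure lebesgue Q. inverse (v i z) = ennreal (1 / w i z)"
        using vw_Q by eventually_elim (use i w_pos[OF i] in \<open>auto simp: inverse_ennreal inverse_eq_divide\<close>)
    qed (use v[OF i] w_meas[OF i] recips_le[OF le i r[OF i]] in auto)
    finally show ?thesis .
  qed
  show ?thesis unfolding class_product_def 1 using 2 by simp
qed

lemma weight_const_eq:
  assumes r: "\<And>i. i \<in> {1..m} \<Longrightarrow> 1 \<le> r i" and le: "exps_le m r q"
    and v: "\<And>i. i \<in> {1..m} \<Longrightarrow> v i \<in> borel_measurable lebesgue"
    and w: "real_weights m w" and vw: "AE z in lebesgue. \<forall>i\<in>{1..m}. v i z = ennreal (w i z)"
  shows "weight_const m q r v = (SUP Q\<in>cubes. recip_product m r q w Q)"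
  unfolding weight_const_def using class_product_eq[OF assms] by (intro SUP_cong refl) auto

lemma weighted_boundI:
  fixes \<F> :: "((real ^ 'n \<Rightarrow> ennreal) \<times> (nat \<Rightarrow> real ^ 'n \<Rightarrow> ennreal)) set"
  assumes r: "\<And>i. i \<in> {1..m} \<Longrightarrow> 1 \<le> r i" and le: "exps_le m r q" and \<phi>: "growth_fun \<phi>"
    and hyp: "\<And>w f fs. w \<in> weight_class m q r \<Longrightarrow> (f, fs) \<in> \<F> \<Longrightarrow>
      Lnorm lebesgue (harm_exp m q) (\<lambda>x. f x * (\<Prod>i = 1..m. w i x))
      \<le> ennreal (\<phi> (enn2real (weight_const m q r w))) *
         (\<Prod>i = 1..m. Lnorm lebesgue (q i) (\<lambda>x. fs i x * w i x))"
  shows "weighted_bound m (recips m r) (last_recip m r) (recips m q) \<F>"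
  unfolding weighted_bound_def
proof
  fix K :: real
  \<comment> \<open>\<open>K\<close> may be negative, outside the domain on which the growth
    function is monotone; the maximum with 1 keeps the constant positive.\<close>
  define C where "C = max 1 (\<phi> (max K 0))"
  have "product_bound m (recips m q) w f fs C"
    if w: "real_weights m w" "\<forall>Q\<in>cubes. recip_product m r q w Q \<le> ennreal K"
      and F: "(f, fs) \<in> \<F>" for w f fs
  proof -
    define v where "v i z = ennreal (w i z)" for i z
    note w_meas = real_weightsD(1)[OF w(1)] and w_pos = real_weightsD(2)[OF w(1)]
    have v_meas: "v i \<in> borel_measurable lebesgue" if "i \<in> {1..m}" for i
      unfolding v_def using w_meas[OF that] by simp
    have "weight_const m q r v = (SUP Q\<in>cubes. recip_product m r q w Q)"
      using r le v_meas w(1) by (intro weight_const_eq) (auto simp: v_def)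
    also have "\<dots> \<le> ennreal K" using w(2) by (intro SUP_least) auto
    finally have const: "weight_const m q r v \<le> ennreal K" .
    have prod_v: "(\<Prod>i = 1..m. v i z) = ennreal (\<Prod>i = 1..m. w i z)" for z
      unfolding v_def using w_pos by (intro prod_ennreal) (auto simp: less_imp_le)
    have "v \<in> weight_class m q r"
      unfolding weight_class_def using v_meas w_pos const
      by (auto simp: v_def intro!: AE_I2 le_less_trans[OF const])
    from hyp[OF this F] have "rnorm lebesgue (recip_sum m q) (\<lambda>z. f z * ennreal (\<Prod>i = 1..m. w i z))
      \<le> ennreal (\<phi> (enn2real (weight_const m q r v))) * (\<Prod>i = 1..m. Lnorm lebesgue (q i) (\<lambda>x. fs i x * v i x))"
      unfolding harm_exp_eq Lnorm_inverse[OF sum_recips_nonneg] prod_v .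
    also have "\<dots> \<le> ennreal C * (\<Prod>i = 1..m. Lnorm lebesgue (q i) (\<lambda>x. fs i x * v i x))"
    proof (intro mult_right_mono ennreal_leI)
      have "enn2real (weight_const m q r v) \<le> max K 0"
        using enn2real_mono[OF const] by (cases "0 \<le> K") (auto simp: ennreal_neg)
      then have "\<phi> (enn2real (weight_const m q r v)) \<le> \<phi> (max K 0)"
        using \<phi> by (auto simp: growth_fun_def mono_on_def)
      then show "\<phi> (enn2real (weight_const m q r v)) \<le> C" by (simp add: C_def)
    qed simp
    also have "(\<Prod>i = 1..m. Lnorm lebesgue (q i) (\<lambda>x. fs i x * v i x))
        = (\<Prod>i = 1..m. rnorm lebesgue (recips m q i) (\<lambda>z. fs i z * ennreal (w i z)))"
      by (intro prod.cong refl) (simp add: exponent_eq Lnorm_inverse recips_nonneg v_def)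
    finally show ?thesis .
  qed
  then show "\<exists>C>0. \<forall>w. real_weights m w \<longrightarrow>
    (\<forall>Q\<in>cubes. recip_product m r q w Q \<le> ennreal K) \<longrightarrow>
    (\<forall>(f, fs)\<in>\<F>. product_bound m (recips m q) w f fs C)"
    by (intro exI[of _ C]) (auto simp: C_def)
qed

lemma weighted_boundD:
  fixes \<F> :: "((real ^ 'n \<Rightarrow> ennreal) \<times> (nat \<Rightarrow> real ^ 'n \<Rightarrow> ennreal)) set"
  assumes r: "\<And>i. i \<in> {1..m} \<Longrightarrow> 1 \<le> r i" and le: "exps_le m r q"
    and meas: "\<And>f fs. (f, fs) \<in> \<F> \<Longrightarrow>
      f \<in> borel_measurable lebesgue \<and> (\<forall>i\<in>{1..m}. fs i \<in> borel_measurable lebesgue)"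
    and bound: "weighted_bound m (recips m r) (last_recip m r) (recips m q) \<F>"
  shows "\<exists>\<phi>. growth_fun \<phi> \<and> (\<forall>v \<in> weight_class m q r. \<forall>(f, fs) \<in> \<F>.
    Lnorm lebesgue (harm_exp m q) (\<lambda>x. f x * (\<Prod>i = 1..m. v i x))
      \<le> ennreal (\<phi> (enn2real (weight_const m q r v))) *
         (\<Prod>i = 1..m. Lnorm lebesgue (q i) (\<lambda>x. fs i x * v i x)))"
proof -
  let ?Y = "recip_sum m q"
  define good where "good k C \<longleftrightarrow> 0 < C \<and> (\<forall>w f fs. real_weights m w \<longrightarrow>
      (\<forall>Q\<in>cubes. recip_product m r q w Q \<le> ennreal (real k)) \<longrightarrow> (f, fs) \<in> \<F> \<longrightarrow>
      product_bound m (recips m q) w f fs C)"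
    for k :: nat and C
  have "\<forall>k. \<exists>C. good k C"
  proof
    fix k
    show "\<exists>C. good k C"
      unfolding good_def by (rule weighted_boundE[OF bound, of "real k"]) blast
  qed
  from choice[OF this] obtain C where C_good: "\<forall>k. good k (C k)" ..
  have C: "0 < C k" "real_weights m w \<Longrightarrow>
      (\<And>Q. Q \<in> cubes \<Longrightarrow> recip_product m r q w Q \<le> ennreal (real k)) \<Longrightarrow> (f, fs) \<in> \<F> \<Longrightarrow>
      product_bound m (recips m q) w f fs (C k)" for k w f fs
    using C_good unfolding good_def by blast+
  \<comment> \<open>Partial sums of positive constants are nondecreasing in t, and the last summand
    belongs to an integer bound that is at least t.\<close>
  define \<phi> where "\<phi> t = (\<Sum>k\<le>nat \<lceil>t\<rceil>. C k)" for t :: real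
  have "growth_fun \<phi>"
    unfolding growth_fun_def mono_on_def \<phi>_def
    using C(1) by (auto intro!: sum_mono2 sum_nonneg nat_mono ceiling_mono simp: less_imp_le)
  moreover have "Lnorm lebesgue (harm_exp m q) (\<lambda>x. f x * (\<Prod>i = 1..m. v i x))
      \<le> ennreal (\<phi> (enn2real (weight_const m q r v))) *
         (\<Prod>i = 1..m. Lnorm lebesgue (q i) (\<lambda>x. fs i x * v i x))"
    if v: "v \<in> weight_class m q r" and F: "(f, fs) \<in> \<F>" for v f fs
  proof -
    have v_meas: "v i \<in> borel_measurable lebesgue" and v_pos: "AE x in lebesgue. 0 < v i x \<and> v i x < \<infinity>"
      if "i \<in> {1..m}" for i
      using v that by (auto simp: weight_class_def)
    \<comment> \<open>The value 1 on the exceptional set makes the weights real and positive at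
      every point.\<close>
    define w where "w i z = (if 0 < v i z \<and> v i z < top then enn2real (v i z) else 1)" for i z
    have w: "real_weights m w"
      unfolding real_weights_def
    proof (intro ballI conjI allI)
      fix i assume "i \<in> {1..m}"
      note [measurable] = v_meas[OF this]
      show "w i \<in> borel_measurable lebesgue" unfolding w_def by measurable
      show "0 < w i z" for z by (auto simp: w_def enn2real_positive_iff)
    qed
    have "AE z in lebesgue. \<forall>i\<in>{1..m}. 0 < v i z \<and> v i z < \<infinity>"
      using v_pos by (intro AE_finite_allI) auto
    then have vw: "AE z in lebesgue. \<forall>i\<in>{1..m}. v i z = ennreal (w i z)"
      by eventually_elim (auto simp: w_def)
    have f_meas: "f \<in> borel_measurable lebesgue" and fs_meas: "\<And>i. i \<in> {1..m} \<Longrightarrow> fs i \<in> borel_measurable lebesgue"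
      using meas[OF F] by auto
    note w_meas = real_weightsD(1)[OF w] and w_pos = real_weightsD(2)[OF w]
    define t where "t = enn2real (weight_const m q r v)"
    have "weight_const m q r v < top" using v by (simp add: weight_class_def)
    then have const: "weight_const m q r v = ennreal t" by (simp add: t_def)
    have "recip_product m r q w Q \<le> ennreal (real (nat \<lceil>t\<rceil>))" if "Q \<in> cubes" for Q
    proof -
      have "recip_product m r q w Q \<le> (SUP Q\<in>cubes. recip_product m r q w Q)" using that by (rule SUP_upper)
      also have "\<dots> = ennreal t"
        unfolding const[symmetric] using r le v_meas w vw by (intro weight_const_eq[symmetric]) auto
      also have "\<dots> \<le> ennreal (real (nat \<lceil>t\<rceil>))" by (intro ennreal_leI real_nat_ceiling_ge)
      finally show ?thesis .
    qed
    from C(2)[OF w this F] have main: "product_bound m (recips m q) w f fs (C (nat \<lceil>t\<rceil>))" .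
    have "Lnorm lebesgue (harm_exp m q) (\<lambda>x. f x * (\<Prod>i = 1..m. v i x)) = rnorm lebesgue ?Y (\<lambda>x. f x * (\<Prod>i = 1..m. v i x))"
      unfolding harm_exp_eq by (rule Lnorm_inverse[OF sum_recips_nonneg])
    also have "\<dots> = rnorm lebesgue ?Y (\<lambda>z. f z * ennreal (\<Prod>i = 1..m. w i z))"
    proof (rule rnorm_cong_AE)
      show "AE z in lebesgue. f z * (\<Prod>i = 1..m. v i z) = f z * ennreal (\<Prod>i = 1..m. w i z)"
        using vw
      proof eventually_elim
        case (elim z)
        then have "(\<Prod>i = 1..m. v i z) = (\<Prod>i = 1..m. ennreal (w i z))" by (intro prod.cong) auto
        also have "\<dots> = ennreal (\<Prod>i = 1..m. w i z)"
          using w_pos by (intro prod_ennreal) (auto simp: less_imp_le)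
        finally show ?case by simp
      qed
      show "(\<lambda>z. f z * (\<Prod>i = 1..m. v i z)) \<in> borel_measurable lebesgue"
        using f_meas v_meas by (intro borel_measurable_times_ennreal borel_measurable_prod_ennreal) auto
      show "(\<lambda>z. f z * ennreal (\<Prod>i = 1..m. w i z)) \<in> borel_measurable lebesgue"
        using f_meas real_weights_prod(1)[OF w] by simp
    qed (rule sum_recips_nonneg)
    also note main
    also have "(\<Prod>i = 1..m. rnorm lebesgue (recips m q i) (\<lambda>z. fs i z * ennreal (w i z)))
        = (\<Prod>i = 1..m. Lnorm lebesgue (q i) (\<lambda>x. fs i x * v i x))"
    proof (intro prod.cong refl)
      fix i assume i: "i \<in> {1..m}"
      have "rnorm lebesgue (recips m q i) (\<lambda>z. fs i z * ennreal (w i z)) = rnorm lebesgue (recips m q i) (\<lambda>x. fs i x * v i x)"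
      proof (rule rnorm_cong_AE)
        show "AE z in lebesgue. fs i z * ennreal (w i z) = fs i z * v i z"
          using vw by eventually_elim (use i in auto)
      qed (use i fs_meas[OF i] w_meas[OF i] v_meas[OF i] recips_nonneg in auto)
      then show "rnorm lebesgue (recips m q i) (\<lambda>z. fs i z * ennreal (w i z)) = Lnorm lebesgue (q i) (\<lambda>x. fs i x * v i x)"
        using i by (simp add: exponent_eq Lnorm_inverse recips_nonneg)
    qed
    also have "ennreal (C (nat \<lceil>t\<rceil>)) * \<dots> \<le> ennreal (\<phi> t) * \<dots>"
    proof (intro mult_right_mono ennreal_leI)
      have "(\<Sum>k\<in>{nat \<lceil>t\<rceil>}. C k) \<le> (\<Sum>k\<le>nat \<lceil>t\<rceil>. C k)"
        using C(1) by (intro sum_mono2) (auto simp: less_imp_le)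
      then show "C (nat \<lceil>t\<rceil>) \<le> \<phi> t" by (simp add: \<phi>_def)
    qed simp
    finally show ?thesis by (simp add: t_def)
  qed
  ultimately show ?thesis by blast
qed

end

lemma exps_less_imp_le: "exps_less m r q \<Longrightarrow> exps_le m r q"
  by (auto simp: exps_less_def exps_le_def less_imp_le)

theorem theorem2p1:
  fixes m :: nat
    and \<F> :: "((real ^ 'n \<Rightarrow> ennreal) \<times> (nat \<Rightarrow> real ^ 'n \<Rightarrow> ennreal)) set"
    and r p :: "nat \<Rightarrow> ennreal"
    and \<phi> :: "real \<Rightarrow> real"
  assumes m: "m \<ge> 2"
    and meas: "\<And>f fs. (f, fs) \<in> \<F> \<Longrightarrow>
      f \<in> borel_measurable lebesgue \<and> (\<forall>i\<in>{1..m}. fs i \<in> borel_measurable lebesgue)"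
    and r: "\<And>i. i \<in> {1..m + 1} \<Longrightarrow> 1 \<le> r i \<and> r i < \<infinity>"
    and p: "\<And>i. i \<in> {1..m} \<Longrightarrow> 1 \<le> p i"
    and rp: "exps_le m r p"
    and \<phi>: "growth_fun \<phi>"
    and hyp: "\<And>w f fs. w \<in> weight_class m p r \<Longrightarrow> (f, fs) \<in> \<F> \<Longrightarrow>
      Lnorm lebesgue (harm_exp m p) (\<lambda>x. f x * (\<Prod>i = 1..m. w i x))
      \<le> ennreal (\<phi> (enn2real (weight_const m p r w))) *
         (\<Prod>i = 1..m. Lnorm lebesgue (p i) (\<lambda>x. fs i x * w i x))"
  shows "\<forall>q :: nat \<Rightarrow> ennreal. (\<forall>i\<in>{1..m}. 1 < q i) \<and> exps_less m r q \<longrightarrow>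
    inverse (harm_exp m q) > 0 \<and>
    (\<exists>\<phi>'. growth_fun \<phi>' \<and>
      (\<forall>v \<in> weight_class m q r. \<forall>(f, fs) \<in> \<F>.
        Lnorm lebesgue (harm_exp m q) (\<lambda>x. f x * (\<Prod>i = 1..m. v i x))
        \<le> ennreal (\<phi>' (enn2real (weight_const m q r v))) *
           (\<Prod>i = 1..m. Lnorm lebesgue (q i) (\<lambda>x. fs i x * v i x)))) \<and>
    (\<forall>s :: nat \<Rightarrow> ennreal. (\<forall>i\<in>{1..m}. 1 < s i) \<and> exps_less m r s \<longrightarrow>
      inverse (harm_exp m s) > 0 \<and>
      (\<exists>\<phi>'. growth_fun \<phi>' \<and>
        (\<forall>v \<in> weight_class m q r.
         \<forall>(F :: nat \<Rightarrow> real ^ 'n \<Rightarrow> ennreal) (Fs :: nat \<Rightarrow> nat \<Rightarrow> real ^ 'n \<Rightarrow> ennreal).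
          (\<forall>j. (F j, Fs j) \<in> \<F>) \<longrightarrow>
          Llnorm lebesgue (harm_exp m q) (harm_exp m s) (\<lambda>j x. F j x * (\<Prod>i = 1..m. v i x))
          \<le> ennreal (\<phi>' (enn2real (weight_const m q r v))) *
             (\<Prod>i = 1..m. Llnorm lebesgue (q i) (s i) (\<lambda>j x. Fs j i x * v i x)))))"
proof -
  let ?d = "recips m r" and ?e = "last_recip m r"
  have r': "1 \<le> r i" if "i \<in> {1..m}" for i using r[of i] that by auto
  have bound_p: "weighted_bound m ?d ?e (recips m p) \<F>"
    using p r' rp \<phi> hyp by (intro weighted_boundI)
  \<comment> \<open>This serves three passages: p to q and p to s on the given family, and s to q on
    the family of sequence norms.\<close>
  have extrapolate: "weighted_bound m ?d ?e (recips m t) \<G>"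
    if "\<And>f fs. (f, fs) \<in> \<G> \<Longrightarrow>
        f \<in> borel_measurable lebesgue \<and> (\<forall>i\<in>{1..m}. fs i \<in> borel_measurable lebesgue)"
      and u: "\<And>i. i \<in> {1..m} \<Longrightarrow> 1 \<le> u i" "exps_le m r u"
      and t: "\<And>i. i \<in> {1..m} \<Longrightarrow> 1 \<le> t i" "exps_less m r t"
      and "weighted_bound m ?d ?e (recips m u) \<G>"
    for u t and \<G> :: "((real ^ 'n \<Rightarrow> ennreal) \<times> (nat \<Rightarrow> real ^ 'n \<Rightarrow> ennreal)) set"
  proof (rule weighted_bound_extrapolation[where x = "recips m u"])
    show "0 \<le> recips m u i \<and> recips m u i \<le> ?d i" if "i \<in> {1..m}" for i
      using recips_le[OF u that r'[OF that]] recips_nonneg by blast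
    show "0 \<le> recips m t i \<and> recips m t i < ?d i" if "i \<in> {1..m}" for i
      using recips_less[OF t that r'[OF that]] recips_nonneg by blast
    show "?e \<le> recip_sum m u" using u by (rule exps_le_sum)
    show "?e < recip_sum m t" using t by (rule exps_less_sum)
    show "recips m u i = recips m t i" if "i \<notin> {1..m}" for i using that by (auto simp: recips_def)
  qed (use m last_recip_nonneg that in auto)
  have sum_pos: "0 < recip_sum m t"
    if t: "\<And>i. i \<in> {1..m} \<Longrightarrow> 1 \<le> t i" "exps_less m r t" for t
    using exps_less_sum[OF t] last_recip_nonneg[of m r] by linarith
  have harm_pos: "inverse (harm_exp m t) > 0"
    if t: "\<And>i. i \<in> {1..m} \<Longrightarrow> 1 \<le> t i" "exps_less m r t" for t
    using sum_pos[OF t] by (subst harm_exp_eq[OF t(1)]) (auto simp del: One_nat_def)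
  show ?thesis
  proof (intro allI impI, elim conjE, intro conjI allI impI)
    fix q :: "nat \<Rightarrow> ennreal"
    assume q1: "\<forall>i\<in>{1..m}. 1 < q i" and rq: "exps_less m r q"
    have q: "1 \<le> q i" if "i \<in> {1..m}" for i using q1 that by (auto simp: less_imp_le)
    show "inverse (harm_exp m q) > 0" using q rq by (rule harm_pos)
    show "\<exists>\<phi>'. growth_fun \<phi>' \<and>
      (\<forall>v \<in> weight_class m q r. \<forall>(f, fs) \<in> \<F>.
        Lnorm lebesgue (harm_exp m q) (\<lambda>x. f x * (\<Prod>i = 1..m. v i x))
        \<le> ennreal (\<phi>' (enn2real (weight_const m q r v))) *
           (\<Prod>i = 1..m. Lnorm lebesgue (q i) (\<lambda>x. fs i x * v i x)))"
      using q r' exps_less_imp_le[OF rq] meas extrapolate[OF meas p rp q rq bound_p]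
      by (rule weighted_boundD)
    fix s :: "nat \<Rightarrow> ennreal"
    assume s1: "(\<forall>i\<in>{1..m}. 1 < s i) \<and> exps_less m r s"
    then have rs: "exps_less m r s" by simp
    have s: "1 \<le> s i" if "i \<in> {1..m}" for i using s1 that by (auto simp: less_imp_le)
    show "inverse (harm_exp m s) > 0" using s rs by (rule harm_pos)
    let ?S = "recip_sum m s" and ?Y = "recip_sum m q"
      and ?c = "count_space (UNIV :: nat set)"
    let ?\<G> = "sequence_family m (recips m s) \<F>"
    \<comment> \<open>Extrapolation first reaches s, where the sequence norms can be inserted, and
      then starts again from there towards q.\<close>
    have "weighted_bound m ?d ?e (recips m s) ?\<G>"
      using m meas recips_nonneg sum_pos[OF s rs] extrapolate[OF meas p rp s rs bound_p]
      by (rule weighted_bound_sequence_family)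
    then have bound: "weighted_bound m ?d ?e (recips m q) ?\<G>"
      using sequence_family_measurable[OF meas] s exps_less_imp_le[OF rs] q rq
      by (intro extrapolate[of ?\<G> s q]) auto
    have seq_meas: "f \<in> borel_measurable lebesgue \<and> (\<forall>i\<in>{1..m}. fs i \<in> borel_measurable lebesgue)"
      if "(f, fs) \<in> ?\<G>" for f fs
      using meas that by (rule sequence_family_measurable)
    obtain \<phi>' where \<phi>': "growth_fun \<phi>'"
      "\<forall>v \<in> weight_class m q r. \<forall>(f, fs) \<in> ?\<G>.
        Lnorm lebesgue (harm_exp m q) (\<lambda>x. f x * (\<Prod>i = 1..m. v i x))
        \<le> ennreal (\<phi>' (enn2real (weight_const m q r v))) *
           (\<Prod>i = 1..m. Lnorm lebesgue (q i) (\<lambda>x. fs i x * v i x))"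
      using weighted_boundD[OF q r' exps_less_imp_le[OF rq] seq_meas bound] by (auto simp only:)
    show "\<exists>\<phi>'. growth_fun \<phi>' \<and>
        (\<forall>v \<in> weight_class m q r.
         \<forall>(F :: nat \<Rightarrow> real ^ 'n \<Rightarrow> ennreal) (Fs :: nat \<Rightarrow> nat \<Rightarrow> real ^ 'n \<Rightarrow> ennreal).
          (\<forall>j. (F j, Fs j) \<in> \<F>) \<longrightarrow>
          Llnorm lebesgue (harm_exp m q) (harm_exp m s) (\<lambda>j x. F j x * (\<Prod>i = 1..m. v i x))
          \<le> ennreal (\<phi>' (enn2real (weight_const m q r v))) *
             (\<Prod>i = 1..m. Llnorm lebesgue (q i) (s i) (\<lambda>j x. Fs j i x * v i x)))"
    proof (intro exI[of _ \<phi>'] conjI ballI allI impI \<phi>'(1))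
      fix v :: "nat \<Rightarrow> real ^ 'n \<Rightarrow> ennreal" and F and Fs :: "nat \<Rightarrow> nat \<Rightarrow> real ^ 'n \<Rightarrow> ennreal"
      assume v: "v \<in> weight_class m q r" and F: "\<forall>j. (F j, Fs j) \<in> \<F>"
      have v_meas: "v i \<in> borel_measurable lebesgue" and v_fin: "AE x in lebesgue. v i x < top"
        if "i \<in> {1..m}" for i
        using v that by (auto simp: weight_class_def)
      have F_meas: "F j \<in> borel_measurable lebesgue" for j using F meas by blast
      have Fs_meas: "Fs j i \<in> borel_measurable lebesgue" if "i \<in> {1..m}" for i j using F meas that by blast
      \<comment> \<open>The weight leaves the sequence norm as a constant factor, which requires a
        finite value; this holds almost everywhere.\<close>
      have Llnorm_eq: "Llnorm lebesgue (inverse (ennreal a)) (inverse (ennreal b)) (\<lambda>j x. h j x * c x)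
          = Lnorm lebesgue (inverse (ennreal a)) (\<lambda>x. rnorm ?c b (\<lambda>j. h j x) * c x)"
        if "0 \<le> a" "0 \<le> b" and [measurable]: "\<And>j. h j \<in> borel_measurable lebesgue" "c \<in> borel_measurable lebesgue"
          and c: "AE x in lebesgue. c x < top" for a b c and h :: "nat \<Rightarrow> real ^ 'n \<Rightarrow> ennreal"
        unfolding Llnorm_def lnorm_eq_rnorm[OF that(2)] Lnorm_inverse[OF that(1)]
      proof (rule rnorm_cong_AE)
        show "AE x in lebesgue. rnorm ?c b (\<lambda>j. h j x * c x) = rnorm ?c b (\<lambda>j. h j x) * c x"
          using c
        proof eventually_elim
          case (elim x)
          then show ?case
            using rnorm_cmult[of "\<lambda>j. h j x" ?c "c x" b] that(2) by (simp add: mult.commute less_top)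
        qed
        show "(\<lambda>x. rnorm ?c b (\<lambda>j. h j x * c x)) \<in> borel_measurable lebesgue"
          "(\<lambda>x. rnorm ?c b (\<lambda>j. h j x) * c x) \<in> borel_measurable lebesgue"
          by (intro borel_measurable_times_ennreal measurable_rnorm_count_space that)+
      qed (rule that)
      have "AE x in lebesgue. \<forall>i\<in>{1..m}. v i x < top"
        using v_fin by (intro AE_finite_allI) auto
      then have prod_fin: "AE x in lebesgue. (\<Prod>i = 1..m. v i x) < top"
        by eventually_elim (force simp: less_top[symmetric] ennreal_prod_eq_top)
      have "(\<lambda>z. rnorm ?c ?S (\<lambda>j. F j z), \<lambda>i z. rnorm ?c (recips m s i) (\<lambda>j. Fs j i z)) \<in> ?\<G>"
        using F by (auto simp: sequence_family_def)
      from bspec[OF bspec[OF \<phi>'(2) v] this] have "Lnorm lebesgue (harm_exp m q) (\<lambda>x. rnorm ?c ?S (\<lambda>j. F j x) * (\<Prod>i = 1..m. v i x))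
        \<le> ennreal (\<phi>' (enn2real (weight_const m q r v))) *
           (\<Prod>i = 1..m. Lnorm lebesgue (q i) (\<lambda>x. rnorm ?c (recips m s i) (\<lambda>j. Fs j i x) * v i x))"
        by simp
      also have "Lnorm lebesgue (harm_exp m q) (\<lambda>x. rnorm ?c ?S (\<lambda>j. F j x) * (\<Prod>i = 1..m. v i x))
          = Llnorm lebesgue (harm_exp m q) (harm_exp m s) (\<lambda>j x. F j x * (\<Prod>i = 1..m. v i x))"
      proof -
        have "harm_exp m q = inverse (ennreal ?Y)" using q by (rule harm_exp_eq)
        moreover have "harm_exp m s = inverse (ennreal ?S)" using s by (rule harm_exp_eq)
        moreover have "0 \<le> ?Y" "0 \<le> ?S" by (intro sum_nonneg recips_nonneg)+
        ultimately show ?thesis using F_meas v_meas prod_fin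
          by (simp only:) (intro Llnorm_eq[symmetric] borel_measurable_prod_ennreal, auto)
      qed
      also have "(\<Prod>i = 1..m. Lnorm lebesgue (q i) (\<lambda>x. rnorm ?c (recips m s i) (\<lambda>j. Fs j i x) * v i x))
          = (\<Prod>i = 1..m. Llnorm lebesgue (q i) (s i) (\<lambda>j x. Fs j i x * v i x))"
      proof (intro prod.cong refl)
        fix i assume i: "i \<in> {1..m}"
        show "Lnorm lebesgue (q i) (\<lambda>x. rnorm ?c (recips m s i) (\<lambda>j. Fs j i x) * v i x)
            = Llnorm lebesgue (q i) (s i) (\<lambda>j x. Fs j i x * v i x)"
        proof -
          have "q i = inverse (ennreal (recips m q i))" using q i by (rule exponent_eq)
          moreover have "s i = inverse (ennreal (recips m s i))" using s i by (rule exponent_eq)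
          ultimately show ?thesis using i Fs_meas v_meas v_fin recips_nonneg
            by (simp only:) (intro Llnorm_eq[symmetric], auto)
        qed
      qed
      finally show "Llnorm lebesgue (harm_exp m q) (harm_exp m s) (\<lambda>j x. F j x * (\<Prod>i = 1..m. v i x))
          \<le> ennreal (\<phi>' (enn2real (weight_const m q r v))) *
             (\<Prod>i = 1..m. Llnorm lebesgue (q i) (s i) (\<lambda>j x. Fs j i x * v i x))" .
    qed
  qed
qed

end
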